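(* Suppose $S\in{\mathcal S}_d({\mathcal U},{\mathcal Y})$ is inner, pure (i.e., $u\in{\mathcal U}$, $\|S(0)u\|=\|u\|$ imply $u=0$), and satisfies $\dim{\mathcal D}^\perp=\dim{\mathcal U}_S^0$, where ${\mathcal D}=\overline{\mathrm{span}}\{Z(\zeta)^*K_S(\cdot,\zeta)y:\zeta\in{\mathbb B}^d,y\in{\mathcal Y}\}\subset{\mathcal H}(K_S)^d$, ${\mathcal D}^\perp={\mathcal H}(K_S)^d\ominus{\mathcal D}$ and ${\mathcal U}_S^0=\{u\in{\mathcal U}:S(\lambda)u=0\ \forall\lambda\in{\mathbb B}^d\}$. Then $S$ coincides with the characteristic function of a $*$-strongly stable commutative row contraction.
   Context: Let ${\mathbb B}^d=\{\lambda\in{\mathbb C}^d:\langle\lambda,\lambda\rangle<1\}$. ${\mathcal H}_{\mathcal Y}(k_d)$ is the reproducing kernel Hilbert space of ${\mathcal Y}$-valued functions on ${\mathbb B}^d$ with kernel $I_{\mathcal Y}/(1-\langle\lambda,\zeta\rangle)$. ${\mathcal S}_d({\mathcal U},{\mathcal Y})$: ${\mathcal L}({\mathcal U},{\mathcal Y})$-valued holomorphic $S$ on ${\mathbb B}^d$ with $M_S:f\mapsto Sf$ a contraction ${\mathcal H}_{\mathcal U}(k_d)\to{\mathcal H}_{\mathcal Y}(k_d)$; $S$ is inner if $M_S$ is a partial isometry. ${\mathcal H}(K_S)$ is the reproducing kernel Hilbert space of $K_S(\lambda,\zeta)=\frac{I-S(\lambda)S(\zeta)^*}{1-\langle\lambda,\zeta\rangle}$.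 $Z(\lambda)=[\lambda_1I\ \cdots\ \lambda_dI]$. A commutative row contraction is a $d$-tuple ${\mathbf T}=(T_1,\dots,T_d)$ of pairwise commuting operators on a Hilbert space ${\mathcal X}$ with $T=[T_1\ \cdots\ T_d]:{\mathcal X}^d\to{\mathcal X}$, $\|T\|\le1$; it is $*$-strongly stable if $\lim_{N\to\infty}\sum_{|n|=N}\frac{N!}{n!}\|T_1^{*n_1}\cdots T_d^{*n_d}x\|^2=0$ for all $x\in{\mathcal X}$. With $D_T=(I-T^*T)^{1/2}$, ${\mathcal D}_T=\overline{\operatorname{Ran}}D_T$, $D_{T^*}=(I-TT^* )^{1/2}$, ${\mathcal D}_{T^*}=\overline{\operatorname{Ran}}D_{T^*}$, the characteristic function is $\theta_{\mathbf T}(\lambda)=[-T+D_{T^*}(I-Z(\lambda)T^* )^{-1}Z(\lambda)D_T]|_{{\mathcal D}_T}$. $S$ coincides with $\theta_{\mathbf T}$ if $S(\lambda)=\alpha\theta_{\mathbf T}(\lambda)\beta^*$ for unitaries $\alpha:{\mathcal D}_{T^*}\to{\mathcal Y}$, $\beta:{\mathcal D}_T\to{\mathcal U}$. *)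

theory Defs
  imports "HOL-Analysis.Analysis" "HOL-Library.Function_Algebras"
begin

section \<open>Complex Hilbert spaces (not available in the distribution)\<close>

class complex_vector = real_vector +
  fixes scaleC :: "complex \<Rightarrow> 'a \<Rightarrow> 'a" (infixr "*\<^sub>C" 75)
  assumes scaleC_add_right: "scaleC a (x + y) = scaleC a x + scaleC a y"
    and scaleC_add_left: "scaleC (a + b) x = scaleC a x + scaleC b x"
    and scaleC_scaleC: "scaleC a (scaleC b x) = scaleC (a * b) x"
    and scaleC_one: "scaleC 1 x = x"
    and scaleR_scaleC: "scaleR r x = scaleC (complex_of_real r) x"

class complex_inner = complex_vector + real_normed_vector +
  fixes cinner :: "'a \<Rightarrow> 'a \<Rightarrow> complex"
  assumes cinner_commute: "cinner x y = cnj (cinner y x)"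
    and cinner_add_left: "cinner (x + y) z = cinner x z + cinner y z"
    and cinner_scaleC_left: "cinner (scaleC r x) y = r * cinner x y"
    and cinner_ge_zero: "0 \<le> Re (cinner x x)"
    and cinner_eq_zero_iff: "cinner x x = 0 \<longleftrightarrow> x = 0"
    and norm_eq_sqrt_cinner: "norm x = sqrt (Re (cinner x x))"

class chilbert_space = complex_inner + complete_space

text \<open>Bounded linear operators and (Hilbert space) adjoints.\<close>

definition bounded_clinear_op :: "('a::complex_inner \<Rightarrow> 'b::complex_inner) \<Rightarrow> bool" where
  "bounded_clinear_op A \<longleftrightarrow> (\<forall>x y. A (x + y) = A x + A y) \<and> (\<forall>c x. A (c *\<^sub>C x) = c *\<^sub>C A x)
     \<and> (\<exists>K. \<forall>x. norm (A x) \<le> K * norm x)"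

definition cadj :: "('a::complex_inner \<Rightarrow> 'b::complex_inner) \<Rightarrow> 'b \<Rightarrow> 'a" where
  "cadj A = (THE B. \<forall>x y. cinner (A x) y = cinner x (B y))"

section \<open>The unit ball of C^d\<close>

text \<open>Points of C^d are functions from a finite index type 'd (with d = CARD('d)).\<close>

definition dinner :: "('d::finite \<Rightarrow> complex) \<Rightarrow> ('d \<Rightarrow> complex) \<Rightarrow> complex" where
  "dinner l z = (\<Sum>i\<in>UNIV. l i * cnj (z i))"

definition Ball_d :: "('d::finite \<Rightarrow> complex) set" where
  "Ball_d = {l. Re (dinner l l) < 1}"

section \<open>Reproducing kernel Hilbert spaces of vector-valued functions\<close>

text \<open>A kernel K : Omega x Omega -> L(V).  The RKHS H(K) is described (Aronszajn) as the set
  of functions f on Omega (normalised to be 0 off Omega) with finite norm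
  ||f|| = sup |sum_i <f(z_i), y_i>| over finite families with sum_{i,j} <K(z_i,z_j)y_j, y_i> <= 1.\<close>

definition fscale :: "complex \<Rightarrow> ('x \<Rightarrow> 'v::complex_vector) \<Rightarrow> 'x \<Rightarrow> 'v" where
  "fscale c f = (\<lambda>x. c *\<^sub>C f x)"

definition rk_norm :: "'x set \<Rightarrow> ('x \<Rightarrow> 'x \<Rightarrow> 'v \<Rightarrow> 'v) \<Rightarrow> ('x \<Rightarrow> 'v::complex_inner) \<Rightarrow> ereal" where
  "rk_norm \<Omega> K f = (SUP p \<in> {(n, zs, ys). (\<forall>i<n. zs i \<in> \<Omega>) \<and>
        Re (\<Sum>i<n. \<Sum>j<n. cinner (K (zs i) (zs j) (ys j)) (ys i)) \<le> 1}.
      (case p of (n, zs, ys) \<Rightarrow> ereal (cmod (\<Sum>i<(n::nat). cinner (f (zs i)) (ys i)))))"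

definition rkhs :: "'x set \<Rightarrow> ('x \<Rightarrow> 'x \<Rightarrow> 'v \<Rightarrow> 'v) \<Rightarrow> ('x \<Rightarrow> 'v::complex_inner) set" where
  "rkhs \<Omega> K = {f. (\<forall>x. x \<notin> \<Omega> \<longrightarrow> f x = 0) \<and> rk_norm \<Omega> K f < \<infinity>}"

definition rk_nrm :: "'x set \<Rightarrow> ('x \<Rightarrow> 'x \<Rightarrow> 'v \<Rightarrow> 'v) \<Rightarrow> ('x \<Rightarrow> 'v::complex_inner) \<Rightarrow> real" where
  "rk_nrm \<Omega> K f = real_of_ereal (rk_norm \<Omega> K f)"

text \<open>Inner product (linear in the first argument) by polarisation.\<close>
definition rk_inner :: "'x set \<Rightarrow> ('x \<Rightarrow> 'x \<Rightarrow> 'v \<Rightarrow> 'v) \<Rightarrow> ('x \<Rightarrow> 'v::complex_inner)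
    \<Rightarrow> ('x \<Rightarrow> 'v) \<Rightarrow> complex" where
  "rk_inner \<Omega> K f g = (\<Sum>k<(4::nat). \<i> ^ k * complex_of_real ((rk_nrm \<Omega> K (f + fscale (\<i> ^ k) g))\<^sup>2)) / 4"

text \<open>The function K(., z) y, normalised to vanish off Omega.\<close>
definition kfun :: "'x set \<Rightarrow> ('x \<Rightarrow> 'x \<Rightarrow> 'v \<Rightarrow> 'v) \<Rightarrow> 'x \<Rightarrow> 'v \<Rightarrow> 'x \<Rightarrow> 'v::zero" where
  "kfun \<Omega> K z y = (\<lambda>l. if l \<in> \<Omega> then K l z y else 0)"

section \<open>Drury--Arveson space H_V(k_d)\<close>

definition kd_kernel :: "('d::finite \<Rightarrow> complex) \<Rightarrow> ('d \<Rightarrow> complex) \<Rightarrow> 'v \<Rightarrow> 'v::complex_vector" where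
  "kd_kernel l z y = (1 / (1 - dinner l z)) *\<^sub>C y"

definition HDA :: "(('d::finite \<Rightarrow> complex) \<Rightarrow> 'v::complex_inner) set" where
  "HDA = rkhs Ball_d kd_kernel"

definition hda_norm :: "(('d::finite \<Rightarrow> complex) \<Rightarrow> 'v::complex_inner) \<Rightarrow> real" where
  "hda_norm f = rk_nrm Ball_d kd_kernel f"

definition hda_inner :: "(('d::finite \<Rightarrow> complex) \<Rightarrow> 'v::complex_inner) \<Rightarrow> (('d \<Rightarrow> complex) \<Rightarrow> 'v) \<Rightarrow> complex" where
  "hda_inner f g = rk_inner Ball_d kd_kernel f g"

section \<open>Schur class, inner, pure\<close>

definition mult_op :: "(('d::finite \<Rightarrow> complex) \<Rightarrow> 'u \<Rightarrow> 'y::zero) \<Rightarrow> (('d \<Rightarrow> complex) \<Rightarrow> 'u) \<Rightarrow> ('d \<Rightarrow> complex) \<Rightarrow> 'y" where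
  "mult_op S f = (\<lambda>l. if l \<in> Ball_d then S l (f l) else 0)"

text \<open>Holomorphy of an operator-valued function on the ball: weakly and separately holomorphic
  (equivalent to holomorphy for locally bounded functions, by Hartogs).\<close>
definition holo_op :: "(('d::finite \<Rightarrow> complex) \<Rightarrow> 'u::complex_inner \<Rightarrow> 'y::complex_inner) \<Rightarrow> bool" where
  "holo_op S \<longleftrightarrow> (\<forall>u y. \<forall>l\<in>Ball_d. \<forall>i.
      (\<lambda>z. cinner (S (l(i := z)) u) y) field_differentiable (at (l i)))"

definition schur_class :: "(('d::finite \<Rightarrow> complex) \<Rightarrow> 'u::chilbert_space \<Rightarrow> 'y::chilbert_space) \<Rightarrow> bool" where
  "schur_class S \<longleftrightarrow> (\<forall>l\<in>Ball_d. bounded_clinear_op (S l)) \<and> holo_op S \<and>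
     (\<forall>f\<in>(HDA :: (('d \<Rightarrow> complex) \<Rightarrow> 'u) set).
        mult_op S f \<in> HDA \<and> hda_norm (mult_op S f) \<le> hda_norm f)"

text \<open>S inner: M_S is a partial isometry, i.e. isometric on the orthogonal complement of its kernel.\<close>
definition inner_schur :: "(('d::finite \<Rightarrow> complex) \<Rightarrow> 'u::chilbert_space \<Rightarrow> 'y::chilbert_space) \<Rightarrow> bool" where
  "inner_schur S \<longleftrightarrow> (\<forall>f\<in>(HDA :: (('d \<Rightarrow> complex) \<Rightarrow> 'u) set).
      (\<forall>g\<in>HDA. mult_op S g = 0 \<longrightarrow> hda_inner f g = 0) \<longrightarrow> hda_norm (mult_op S f) = hda_norm f)"

definition pure_schur :: "(('d::finite \<Rightarrow> complex) \<Rightarrow> 'u::chilbert_space \<Rightarrow> 'y::chilbert_space) \<Rightarrow> bool" where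
  "pure_schur S \<longleftrightarrow> (\<forall>u. norm (S 0 u) = norm u \<longrightarrow> u = 0)"

section \<open>The de Branges--Rovnyak space H(K_S), the space D and U_S^0\<close>

definition KS :: "(('d::finite \<Rightarrow> complex) \<Rightarrow> 'u::chilbert_space \<Rightarrow> 'y::chilbert_space)
    \<Rightarrow> ('d \<Rightarrow> complex) \<Rightarrow> ('d \<Rightarrow> complex) \<Rightarrow> 'y \<Rightarrow> 'y" where
  "KS S l z y = (1 / (1 - dinner l z)) *\<^sub>C (y - S l (cadj (S z) y))"

definition HKS :: "(('d::finite \<Rightarrow> complex) \<Rightarrow> 'u::chilbert_space \<Rightarrow> 'y::chilbert_space)
    \<Rightarrow> (('d \<Rightarrow> complex) \<Rightarrow> 'y) set" where
  "HKS S = rkhs Ball_d (KS S)"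

text \<open>Inner product of H(K_S)^d.\<close>
definition tup_inner :: "(('d::finite \<Rightarrow> complex) \<Rightarrow> 'u::chilbert_space \<Rightarrow> 'y::chilbert_space)
    \<Rightarrow> ('d \<Rightarrow> ('d \<Rightarrow> complex) \<Rightarrow> 'y) \<Rightarrow> ('d \<Rightarrow> ('d \<Rightarrow> complex) \<Rightarrow> 'y) \<Rightarrow> complex" where
  "tup_inner S F G = (\<Sum>j\<in>UNIV. rk_inner Ball_d (KS S) (F j) (G j))"

text \<open>The generators Z(z)^* K_S(., z) y of D, as elements of H(K_S)^d.\<close>
definition Dgen :: "(('d::finite \<Rightarrow> complex) \<Rightarrow> 'u::chilbert_space \<Rightarrow> 'y::chilbert_space)
    \<Rightarrow> ('d \<Rightarrow> complex) \<Rightarrow> 'y \<Rightarrow> 'd \<Rightarrow> ('d \<Rightarrow> complex) \<Rightarrow> 'y" where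
  "Dgen S z y = (\<lambda>j. fscale (cnj (z j)) (kfun Ball_d (KS S) z y))"

text \<open>D-perp = H(K_S)^d minus the closed span of the generators = orthogonal complement of the generators.\<close>
definition Dperp :: "(('d::finite \<Rightarrow> complex) \<Rightarrow> 'u::chilbert_space \<Rightarrow> 'y::chilbert_space)
    \<Rightarrow> ('d \<Rightarrow> ('d \<Rightarrow> complex) \<Rightarrow> 'y) set" where
  "Dperp S = {F. (\<forall>j. F j \<in> HKS S) \<and> (\<forall>z\<in>Ball_d. \<forall>y. tup_inner S F (Dgen S z y) = 0)}"

definition US0 :: "(('d::finite \<Rightarrow> complex) \<Rightarrow> 'u::chilbert_space \<Rightarrow> 'y::chilbert_space) \<Rightarrow> 'u set" where
  "US0 S = {u. \<forall>l\<in>Ball_d. S l u = 0}"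

section \<open>Hilbert space dimension\<close>

definition is_onb :: "('a \<Rightarrow> 'a \<Rightarrow> complex) \<Rightarrow> 'a set \<Rightarrow> 'a::zero set \<Rightarrow> bool" where
  "is_onb ip V B \<longleftrightarrow> B \<subseteq> V \<and> (\<forall>b\<in>B. ip b b = 1) \<and> (\<forall>b\<in>B. \<forall>c\<in>B. b \<noteq> c \<longrightarrow> ip b c = 0)
     \<and> (\<forall>x\<in>V. (\<forall>b\<in>B. ip x b = 0) \<longrightarrow> x = 0)"

definition same_hdim :: "('a \<Rightarrow> 'a \<Rightarrow> complex) \<Rightarrow> 'a::zero set \<Rightarrow> ('b \<Rightarrow> 'b \<Rightarrow> complex) \<Rightarrow> 'b::zero set \<Rightarrow> bool" where
  "same_hdim ip1 V1 ip2 V2 \<longleftrightarrow>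
     (\<exists>B1 B2. is_onb ip1 V1 B1 \<and> is_onb ip2 V2 B2 \<and> (\<exists>f. bij_betw f B1 B2))"

section \<open>Commutative row contractions and characteristic functions\<close>

text \<open>T^{*n} = T_1^{*n_1} ... T_d^{*n_d}.\<close>
definition mpow :: "('d::{finite,linorder} \<Rightarrow> 'a \<Rightarrow> 'a) \<Rightarrow> ('d \<Rightarrow> nat) \<Rightarrow> 'a \<Rightarrow> 'a" where
  "mpow A n = foldr (\<lambda>j g. (A j ^^ n j) \<circ> g) (sorted_list_of_set UNIV) id"

text \<open>The Hilbert space X on which the row contraction acts is realised as a closed subspace of
  H_Y(k_d) (see NOTES.md).  T are the operators, Ta their adjoints on X.\<close>
definition closed_subspace_hda :: "(('d::finite \<Rightarrow> complex) \<Rightarrow> 'y::chilbert_space) set \<Rightarrow> bool" where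
  "closed_subspace_hda X \<longleftrightarrow> X \<subseteq> HDA \<and> 0 \<in> X \<and> (\<forall>f\<in>X. \<forall>g\<in>X. f + g \<in> X) \<and>
     (\<forall>c. \<forall>f\<in>X. fscale c f \<in> X) \<and>
     (\<forall>f\<in>HDA. (\<forall>e>0. \<exists>g\<in>X. hda_norm (f - g) < e) \<longrightarrow> f \<in> X)"

definition op_on :: "'a set \<Rightarrow> ('a \<Rightarrow> 'a) \<Rightarrow> bool" where
  "op_on X A \<longleftrightarrow> (\<forall>x\<in>X. A x \<in> X)"

definition lin_on_hda :: "(('d::finite \<Rightarrow> complex) \<Rightarrow> 'y::chilbert_space) set \<Rightarrow>
    ((('d \<Rightarrow> complex) \<Rightarrow> 'y) \<Rightarrow> (('d \<Rightarrow> complex) \<Rightarrow> 'y)) \<Rightarrow> bool" where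
  "lin_on_hda X A \<longleftrightarrow> op_on X A \<and> (\<forall>x\<in>X. \<forall>y\<in>X. A (x + y) = A x + A y) \<and>
     (\<forall>c. \<forall>x\<in>X. A (fscale c x) = fscale c (A x)) \<and> (\<exists>K. \<forall>x\<in>X. hda_norm (A x) \<le> K * hda_norm x)"

definition comm_row_contraction :: "(('d::{finite,linorder} \<Rightarrow> complex) \<Rightarrow> 'y::chilbert_space) set \<Rightarrow>
    ('d \<Rightarrow> (('d \<Rightarrow> complex) \<Rightarrow> 'y) \<Rightarrow> (('d \<Rightarrow> complex) \<Rightarrow> 'y)) \<Rightarrow> bool" where
  "comm_row_contraction X T \<longleftrightarrow> (\<forall>j. lin_on_hda X (T j)) \<and>
     (\<forall>i j. \<forall>x\<in>X. T i (T j x) = T j (T i x)) \<and>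
     (\<forall>xs. (\<forall>j. xs j \<in> X) \<longrightarrow> (hda_norm (\<Sum>j\<in>UNIV. T j (xs j)))\<^sup>2 \<le> (\<Sum>j\<in>UNIV. (hda_norm (xs j))\<^sup>2))"

definition is_adjoint_on :: "(('d::finite \<Rightarrow> complex) \<Rightarrow> 'y::chilbert_space) set \<Rightarrow>
    ((('d \<Rightarrow> complex) \<Rightarrow> 'y) \<Rightarrow> (('d \<Rightarrow> complex) \<Rightarrow> 'y)) \<Rightarrow>
    ((('d \<Rightarrow> complex) \<Rightarrow> 'y) \<Rightarrow> (('d \<Rightarrow> complex) \<Rightarrow> 'y)) \<Rightarrow> bool" where
  "is_adjoint_on X A B \<longleftrightarrow> op_on X B \<and> (\<forall>x\<in>X. \<forall>y\<in>X. hda_inner (A x) y = hda_inner x (B y))"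

definition star_strongly_stable :: "(('d::{finite,linorder} \<Rightarrow> complex) \<Rightarrow> 'y::chilbert_space) set \<Rightarrow>
    ('d \<Rightarrow> (('d \<Rightarrow> complex) \<Rightarrow> 'y) \<Rightarrow> (('d \<Rightarrow> complex) \<Rightarrow> 'y)) \<Rightarrow> bool" where
  "star_strongly_stable X Ta \<longleftrightarrow> (\<forall>x\<in>X.
     (\<lambda>N. \<Sum>n\<in>{n. sum n UNIV = N}. (fact N / (\<Prod>j\<in>UNIV. fact (n j)) :: real) * (hda_norm (mpow Ta n x))\<^sup>2)
       \<longlonglongrightarrow> 0)"

text \<open>X^d with its inner product and norm.\<close>
definition tupX :: "'a set \<Rightarrow> ('d \<Rightarrow> 'a) set" where
  "tupX X = {xs. \<forall>j. xs j \<in> X}"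

definition tup_hda_inner :: "('d::finite \<Rightarrow> ('d \<Rightarrow> complex) \<Rightarrow> 'y::chilbert_space)
    \<Rightarrow> ('d \<Rightarrow> ('d \<Rightarrow> complex) \<Rightarrow> 'y) \<Rightarrow> complex" where
  "tup_hda_inner xs ys = (\<Sum>j\<in>UNIV. hda_inner (xs j) (ys j))"

definition tup_hda_norm :: "('d::finite \<Rightarrow> ('d \<Rightarrow> complex) \<Rightarrow> 'y::chilbert_space) \<Rightarrow> real" where
  "tup_hda_norm xs = sqrt (\<Sum>j\<in>UNIV. (hda_norm (xs j))\<^sup>2)"

text \<open>P is the positive square root of A on the (pre-)Hilbert space (V, ip):
  P maps V to V, is linear, selfadjoint, positive, and P^2 = A on V.\<close>
definition is_pos_sqrt_on :: "'a set \<Rightarrow> ('a \<Rightarrow> 'a \<Rightarrow> complex) \<Rightarrow> (complex \<Rightarrow> 'a \<Rightarrow> 'a) \<Rightarrow>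
    ('a::ab_group_add \<Rightarrow> 'a) \<Rightarrow> ('a \<Rightarrow> 'a) \<Rightarrow> bool" where
  "is_pos_sqrt_on V ip sc A P \<longleftrightarrow> (\<forall>x\<in>V. P x \<in> V) \<and>
     (\<forall>x\<in>V. \<forall>y\<in>V. P (x + y) = P x + P y) \<and> (\<forall>c. \<forall>x\<in>V. P (sc c x) = sc c (P x)) \<and>
     (\<forall>x\<in>V. \<forall>y\<in>V. ip (P x) y = ip x (P y)) \<and>
     (\<forall>x\<in>V. Im (ip (P x) x) = 0 \<and> Re (ip (P x) x) \<ge> 0) \<and>
     (\<forall>x\<in>V. P (P x) = A x)"

text \<open>S coincides with the characteristic function of a *-strongly stable commutative row
  contraction T on X: there are X, T (with adjoints Ta), the defect operators D_T, D_{T*},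
  the resolvents R(l) = (I - Z(l)T^* )^{-1}, and unitaries alpha : D_{T*} -> Y,
  beta : D_T -> U with S(l) beta = alpha theta_T(l) on the defect space D_T.\<close>
definition char_coincide :: "(('d::{finite,linorder} \<Rightarrow> complex) \<Rightarrow> 'u::chilbert_space \<Rightarrow> 'y::chilbert_space) \<Rightarrow> bool" where
  "char_coincide S \<longleftrightarrow>
    (\<exists>(X :: (('d \<Rightarrow> complex) \<Rightarrow> 'y) set) T Ta DT DTs R (\<alpha> :: (('d \<Rightarrow> complex) \<Rightarrow> 'y) \<Rightarrow> 'y)
        (\<beta> :: ('d \<Rightarrow> ('d \<Rightarrow> complex) \<Rightarrow> 'y) \<Rightarrow> 'u).
      closed_subspace_hda X \<and>
      comm_row_contraction X T \<and>
      (\<forall>j. is_adjoint_on X (T j) (Ta j)) \<and>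
      star_strongly_stable X Ta \<and>
      is_pos_sqrt_on (tupX X) tup_hda_inner (\<lambda>c xs. (\<lambda>j. fscale c (xs j)))
        (\<lambda>xs. xs - (\<lambda>j. Ta j (\<Sum>k\<in>UNIV. T k (xs k)))) DT \<and>
      is_pos_sqrt_on X hda_inner fscale (\<lambda>x. x - (\<Sum>j\<in>UNIV. T j (Ta j x))) DTs \<and>
      (\<forall>l\<in>Ball_d. \<forall>x\<in>X. R l x \<in> X \<and>
          R l (x - (\<Sum>j\<in>UNIV. fscale (l j) (Ta j x))) = x \<and>
          R l x - (\<Sum>j\<in>UNIV. fscale (l j) (Ta j (R l x))) = x) \<and>
      (let calDT = {xs\<in>tupX X. \<forall>e>0. \<exists>zs\<in>tupX X. tup_hda_norm (xs - DT zs) < e};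
           calDTs = {x\<in>X. \<forall>e>0. \<exists>z\<in>X. hda_norm (x - DTs z) < e};
           \<theta> = (\<lambda>l xs. - (\<Sum>j\<in>UNIV. T j (xs j)) + DTs (R l (\<Sum>j\<in>UNIV. fscale (l j) (DT xs j))))
       in (\<forall>x\<in>calDTs. \<forall>y\<in>calDTs. \<alpha> (x + y) = \<alpha> x + \<alpha> y) \<and>
          (\<forall>c. \<forall>x\<in>calDTs. \<alpha> (fscale c x) = c *\<^sub>C \<alpha> x) \<and>
          (\<forall>x\<in>calDTs. \<forall>y\<in>calDTs. cinner (\<alpha> x) (\<alpha> y) = hda_inner x y) \<and>
          \<alpha> ` calDTs = UNIV \<and>
          (\<forall>x\<in>calDT. \<forall>y\<in>calDT. \<beta> (x + y) = \<beta> x + \<beta> y) \<and>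
          (\<forall>c. \<forall>x\<in>calDT. \<beta> (\<lambda>j. fscale c (x j)) = c *\<^sub>C \<beta> x) \<and>
          (\<forall>x\<in>calDT. \<forall>y\<in>calDT. cinner (\<beta> x) (\<beta> y) = tup_hda_inner x y) \<and>
          \<beta> ` calDT = UNIV \<and>
          (\<forall>l\<in>Ball_d. \<forall>xs\<in>calDT. S l (\<beta> xs) = \<alpha> (\<theta> l xs))))"

end

theory Submission
  imports Defs
begin

text \<open>
  The space \<open>H(k\<^sub>d)\<close> is realised inside the full Fock space of square summable families
  indexed by words, where the adjoints of the coordinate multipliers become the backward shifts.
  Since \<open>S\<close> is inner, \<open>H(K\<^sub>S)\<close> is isometrically the orthogonal complement \<open>X\<close> of
  the range of \<open>M\<^sub>S\<close>, and \<open>X\<close> is invariant under the backward shifts; their restrictions are the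
  adjoints \<open>T\<^sub>j\<^sup>*\<close> of a commutative row contraction, \<open>*\<close>-strongly stable because the
  shifts move every vector to the tail of its word expansion.

  The identity \<open>(1 - \<langle>\<lambda>,\<zeta>\<rangle>) K\<^sub>S = I - S S\<^sup>*\<close> says that
  \<open>(Z(\<zeta>)\<^sup>* K\<^sub>S(\<cdot>,\<zeta>) y, y) \<mapsto> (K\<^sub>S(\<cdot>,\<zeta>) y, S(\<zeta>)\<^sup>* y)\<close> preserves inner products. The
  hypothesis on dimensions extends it to a unitary \<open>X\<^sup>d \<oplus> Y \<rightarrow> X \<oplus> U\<close>, whose restriction to
  \<open>X\<^sup>d\<close> is a column \<open>(T, B)\<close> with \<open>B\<^sup>* B = I - T\<^sup>* T\<close> and
  \<open>S(z) B x = \<Sum>\<^sub>j z\<^sub>j x\<^sub>j(z) - (T x)(z)\<close>. Purity makes the range of \<open>B\<close> and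
  the values at the origin dense, so \<open>D\<^sub>T x \<mapsto> B x\<close> and \<open>D\<^sub>T\<^sub>* x \<mapsto> x(0)\<close> extend to the
  unitaries \<open>\<beta>\<close> and \<open>\<alpha>\<close> that identify \<open>S\<close> with the characteristic function.
\<close>


section \<open>Complex inner product spaces\<close>

instance chilbert_space \<subseteq> banach ..

lemma scaleC_zero_right [simp]: "c *\<^sub>C (0::'a::complex_vector) = 0"
  using scaleC_add_right[of c 0 0] by simp

lemma scaleC_zero_left [simp]: "0 *\<^sub>C (x::'a::complex_vector) = 0"
  using scaleC_add_left[of 0 0 x] by simp

lemma scaleC_minus_one: "(-1) *\<^sub>C x = - (x::'a::complex_vector)"
  using scaleR_scaleC[of "-1" x] by simp

lemma scaleC_minus_right: "c *\<^sub>C (- x) = - (c *\<^sub>C (x::'a::complex_vector))"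
  by (metis mult.commute scaleC_minus_one scaleC_scaleC)

lemma scaleC_diff_right: "c *\<^sub>C (x - y) = c *\<^sub>C x - c *\<^sub>C (y::'a::complex_vector)"
  using scaleC_add_right[of c x "- y"] by (simp add: scaleC_minus_right)

lemma scaleC_sum_right: "c *\<^sub>C (\<Sum>i\<in>I. f i) = (\<Sum>i\<in>I. c *\<^sub>C (f i::'a::complex_vector))"
  by (induction I rule: infinite_finite_induct) (auto simp: scaleC_add_right)

lemma cinner_add_right: "cinner x (y + z) = cinner x y + cinner x z"
  by (metis cinner_add_left cinner_commute complex_cnj_add)

lemma cinner_scaleC_right: "cinner x (c *\<^sub>C y) = cnj c * cinner x y"
  by (metis cinner_commute cinner_scaleC_left complex_cnj_mult)

lemma cinner_zero_left [simp]: "cinner 0 y = 0"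
  using cinner_add_left[of 0 0 y] by simp

lemma cinner_zero_right [simp]: "cinner y 0 = 0"
  using cinner_add_right[of y 0 0] by simp

lemma cinner_minus_left: "cinner (- x) y = - cinner x y"
  using cinner_add_left[of x "- x" y] by (simp add: add_eq_0_iff)

lemma cinner_minus_right: "cinner x (- y) = - cinner x y"
  using cinner_add_right[of x y "- y"] by (simp add: add_eq_0_iff)

lemma cinner_diff_left: "cinner (x - y) z = cinner x z - cinner y z"
  using cinner_add_left[of x "- y" z] by (simp add: cinner_minus_left)

lemma cinner_diff_right: "cinner x (y - z) = cinner x y - cinner x z"
  using cinner_add_right[of x y "- z"] by (simp add: cinner_minus_right)

lemma cinner_sum_left: "cinner (\<Sum>i\<in>I. f i) y = (\<Sum>i\<in>I. cinner (f i) y)"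
  by (induction I rule: infinite_finite_induct) (auto simp: cinner_add_left)

lemma cinner_sum_right: "cinner y (\<Sum>i\<in>I. f i) = (\<Sum>i\<in>I. cinner y (f i))"
  by (induction I rule: infinite_finite_induct) (auto simp: cinner_add_right)

lemma cinner_eq_0_commute: "cinner x y = 0 \<longleftrightarrow> cinner y x = 0"
  by (metis cinner_commute complex_cnj_zero_iff)

lemma norm_sq_cinner: "(norm x)\<^sup>2 = Re (cinner x x)"
  by (simp add: norm_eq_sqrt_cinner cinner_ge_zero)

lemma cinner_self: "cinner x x = complex_of_real ((norm x)\<^sup>2)"
proof -
  have "Im (cinner x x) = - Im (cinner x x)"
    using arg_cong[OF cinner_commute[of x x], of Im] by simp
  then show ?thesis by (simp add: complex_eq_iff norm_sq_cinner)
qed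

lemma cinner_extI: "(\<And>y. cinner x y = cinner x' y) \<Longrightarrow> x = x'"
  by (metis cinner_diff_left cinner_eq_zero_iff eq_iff_diff_eq_0)

lemma cinner_extI_right: "(\<And>y. cinner y x = cinner y x') \<Longrightarrow> x = x'"
  by (metis cinner_diff_right cinner_eq_zero_iff eq_iff_diff_eq_0)

lemma norm_scaleC: "norm (c *\<^sub>C (x::'a::complex_inner)) = cmod c * norm x"
proof -
  have "cinner (c *\<^sub>C x) (c *\<^sub>C x) = (c * cnj c) * cinner x x"
    by (simp add: cinner_scaleC_left cinner_scaleC_right)
  also have "\<dots> = complex_of_real ((cmod c)\<^sup>2 * (norm x)\<^sup>2)"
    by (simp only: complex_norm_square[symmetric] cinner_self of_real_mult)
  finally show ?thesis
    by (simp add: norm_eq_sqrt_cinner[of "c *\<^sub>C x"] real_sqrt_mult)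
qed

lemma norm_add_sq: "(norm (x + y))\<^sup>2 = (norm x)\<^sup>2 + (norm y)\<^sup>2 + 2 * Re (cinner x y)"
proof -
  have "Re (cinner y x) = Re (cinner x y)"
    by (metis cinner_commute cnj.sel(1))
  then show ?thesis
    by (simp add: norm_sq_cinner cinner_add_left cinner_add_right)
qed

lemma norm_diff_sq: "(norm (x - y))\<^sup>2 = (norm x)\<^sup>2 + (norm y)\<^sup>2 - 2 * Re (cinner x y)"
  using norm_add_sq[of x "- y"] by (simp add: cinner_minus_right)

lemma Cauchy_Schwarz_cinner: "cmod (cinner x y) \<le> norm x * norm y"
proof (cases "y = 0")
  case False
  define b where "b = (norm y)\<^sup>2"
  define c where "c = cinner x y / complex_of_real b"
  have b: "b > 0" using False by (simp add: b_def)
  have "0 \<le> (norm (x - c *\<^sub>C y))\<^sup>2" by simp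
  also have "\<dots> = (norm x)\<^sup>2 + (cmod c)\<^sup>2 * b - 2 * Re (cnj c * cinner x y)"
    by (simp add: norm_diff_sq norm_scaleC cinner_scaleC_right power_mult_distrib b_def)
  also have "cnj c * cinner x y = complex_of_real ((cmod (cinner x y))\<^sup>2 / b)"
    by (simp add: c_def complex_norm_square[of "cinner x y", unfolded of_real_power] mult.commute)
  also have "(cmod c)\<^sup>2 * b = (cmod (cinner x y))\<^sup>2 / b"
    using b by (simp add: c_def norm_divide power_divide power2_eq_square)
  finally have "(cmod (cinner x y))\<^sup>2 / b \<le> (norm x)\<^sup>2" by simp
  then have "(cmod (cinner x y))\<^sup>2 \<le> (norm x * norm y)\<^sup>2"
    using b by (simp add: divide_simps power_mult_distrib b_def)
  then show ?thesis by (rule power2_le_imp_le) simp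
qed simp

lemma bounded_bilinear_cinner: "bounded_bilinear cinner"
proof
  show "\<exists>K. \<forall>a b. norm (cinner a b) \<le> norm a * norm b * K"
    by (rule exI[of _ 1]) (simp add: Cauchy_Schwarz_cinner)
qed (auto simp: cinner_add_left cinner_add_right scaleR_scaleC cinner_scaleC_left
       cinner_scaleC_right scaleR_conv_of_real)

lemmas tendsto_cinner = bounded_bilinear.tendsto[OF bounded_bilinear_cinner]
lemmas continuous_on_cinner = bounded_bilinear.continuous_on[OF bounded_bilinear_cinner]

section \<open>Bounded operators\<close>

lemma bclinD:
  assumes "bounded_clinear_op A"
  shows "A (x + y) = A x + A y" "A (c *\<^sub>C x) = c *\<^sub>C A x" "\<exists>K. \<forall>x. norm (A x) \<le> K * norm x"
  using assms by (auto simp: bounded_clinear_op_def)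

lemma bclin_bounded_linear:
  assumes "bounded_clinear_op A" shows "bounded_linear A"
proof -
  obtain K where "\<And>x. norm (A x) \<le> K * norm x" using bclinD(3)[OF assms] by blast
  then show ?thesis
    by (intro bounded_linear_intro[where K=K])
       (auto simp: bclinD(1,2)[OF assms] scaleR_scaleC mult.commute)
qed

lemma bclinI:
  assumes "\<And>x y. A (x + y) = A x + A y" "\<And>c x. A (c *\<^sub>C x) = c *\<^sub>C A x"
    "\<And>x. norm (A x) \<le> K * norm x"
  shows "bounded_clinear_op A"
  using assms by (auto simp: bounded_clinear_op_def)

lemma bclin_diff:
  "bounded_clinear_op A \<Longrightarrow> A (x - y) = A x - A y"
  by (simp add: bclin_bounded_linear bounded_linear.axioms(1) linear_diff)

lemma bclin_sum:
  "bounded_clinear_op A \<Longrightarrow> A (\<Sum>i\<in>I. f i) = (\<Sum>i\<in>I. A (f i))"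
  by (simp add: bclin_bounded_linear bounded_linear.axioms(1) linear_sum)

lemma bclin_zero: "bounded_clinear_op A \<Longrightarrow> A 0 = 0"
  by (simp add: bclin_bounded_linear bounded_linear.axioms(1) linear_0)

lemma bclin_uminus: "bounded_clinear_op A \<Longrightarrow> A (- x) = - A x"
  using bclin_diff[of A 0 x] bclin_zero[of A] by simp

lemma bclin_continuous_on: "bounded_clinear_op A \<Longrightarrow> continuous_on U A"
  by (simp add: bclin_bounded_linear linear_continuous_on)

lemma bclin_tendsto:
  "bounded_clinear_op A \<Longrightarrow> (f \<longlongrightarrow> x) F \<Longrightarrow> ((\<lambda>n. A (f n)) \<longlongrightarrow> A x) F"
  using bounded_linear.tendsto bclin_bounded_linear by blast

lemma bclin_compose:
  assumes A: "bounded_clinear_op A" and B: "bounded_clinear_op B"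
  shows "bounded_clinear_op (\<lambda>x. A (B x))"
proof -
  obtain K where K: "\<And>x. norm (A (B x)) \<le> norm x * K"
    using bounded_linear.bounded[OF bounded_linear_compose[OF
      bclin_bounded_linear[OF A] bclin_bounded_linear[OF B]]] by blast
  show ?thesis
    by (rule bclinI[where K=K])
       (use K in \<open>auto simp: bclinD(1,2)[OF A] bclinD(1,2)[OF B] mult.commute\<close>)
qed

lemma bclin_id: "bounded_clinear_op (\<lambda>x. x)"
  by (rule bclinI[where K=1]) auto

lemma bclin_minus:
  assumes A: "bounded_clinear_op A" and B: "bounded_clinear_op B"
  shows "bounded_clinear_op (\<lambda>x. A x - B x)"
proof -
  obtain K where K: "\<And>x. norm (A x - B x) \<le> norm x * K"
    using bounded_linear.bounded[OF bounded_linear_sub[OF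
      bclin_bounded_linear[OF A] bclin_bounded_linear[OF B]]] by blast
  show ?thesis
    by (rule bclinI[where K=K])
       (use K in \<open>auto simp: bclinD(1,2)[OF A] bclinD(1,2)[OF B]
          scaleC_diff_right mult.commute\<close>)
qed

lemma bclin_scaleC:
  assumes A: "bounded_clinear_op A"
  shows "bounded_clinear_op (\<lambda>x. c *\<^sub>C A x)"
proof -
  obtain K where K: "\<And>x. norm (A x) \<le> K * norm x"
    using bclinD(3)[OF A] by blast
  have "cmod c * norm (A x) \<le> cmod c * K * norm x" for x
    using mult_left_mono[OF K, of "cmod c" x] by (simp add: mult.assoc)
  then show ?thesis
    by (intro bclinI[where K="cmod c * K"])
       (auto simp: bclinD(1,2)[OF A] scaleC_add_right scaleC_scaleC mult.commute norm_scaleC)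
qed

lemma bclin_sum_fun:
  assumes A: "\<And>i. i \<in> I \<Longrightarrow> bounded_clinear_op (A i)"
  shows "bounded_clinear_op (\<lambda>x. \<Sum>i\<in>I. A i x)"
proof -
  have "bounded_linear (\<lambda>x. \<Sum>i\<in>I. A i x)"
    using A by (intro bounded_linear_sum bclin_bounded_linear)
  then obtain K where K: "\<And>x. norm (\<Sum>i\<in>I. A i x) \<le> norm x * K"
    using bounded_linear.bounded by blast
  show ?thesis
    by (rule bclinI[where K=K])
       (use K in \<open>auto simp: bclinD(1,2)[OF A] sum.distrib scaleC_sum_right mult.commute\<close>)
qed

section \<open>Closed subspaces, the Riesz theorem and adjoints\<close>

definition csubspace :: "'a::complex_vector set \<Rightarrow> bool" where
  "csubspace L \<longleftrightarrow> 0 \<in> L \<and> (\<forall>x\<in>L. \<forall>y\<in>L. x + y \<in> L) \<and> (\<forall>c. \<forall>x\<in>L. c *\<^sub>C x \<in> L)"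

definition closed_csubspace :: "'a::complex_inner set \<Rightarrow> bool" where
  "closed_csubspace L \<longleftrightarrow> csubspace L \<and> closed L"

lemma csubspaceD:
  assumes "csubspace L"
  shows "0 \<in> L" "x \<in> L \<Longrightarrow> y \<in> L \<Longrightarrow> x + y \<in> L" "x \<in> L \<Longrightarrow> c *\<^sub>C x \<in> L"
  using assms by (auto simp: csubspace_def)

lemma csubspace_diff: "csubspace L \<Longrightarrow> x \<in> L \<Longrightarrow> y \<in> L \<Longrightarrow> x - y \<in> L"
  using csubspaceD(2)[of L x "(-1) *\<^sub>C y"] csubspaceD(3)[of L y "-1"]
  by (simp add: scaleC_minus_one)

lemma csubspace_uminus: "csubspace L \<Longrightarrow> y \<in> L \<Longrightarrow> - y \<in> L"
  using csubspace_diff[of L 0 y] csubspaceD(1)[of L] by simp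

lemma csubspace_sum: "csubspace L \<Longrightarrow> (\<And>i. i \<in> I \<Longrightarrow> f i \<in> L) \<Longrightarrow> (\<Sum>i\<in>I. f i) \<in> L"
  by (induction I rule: infinite_finite_induct) (auto simp: csubspaceD)

lemma closed_csubspaceD:
  assumes "closed_csubspace L"
  shows "csubspace L" "closed L"
  using assms by (auto simp: closed_csubspace_def)

lemma closed_csubspace_UNIV: "closed_csubspace UNIV"
  by (auto simp: closed_csubspace_def csubspace_def)

text \<open>The minimiser of \<open>\<parallel>q\<parallel>\<^sup>2 - 2 Re (F q)\<close> over \<open>L\<close> exists by the parallelogram law and
  represents \<open>F\<close>; projections and adjoints are special cases.\<close>

lemma riesz_subspace:
  fixes L :: "'a::chilbert_space set" and F :: "'a \<Rightarrow> complex"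
  assumes L: "csubspace L"
    and add: "\<And>p q. p \<in> L \<Longrightarrow> q \<in> L \<Longrightarrow> F (p + q) = F p + F q"
    and scale: "\<And>c q. q \<in> L \<Longrightarrow> F (c *\<^sub>C q) = c * F q"
    and bd: "\<And>q. q \<in> L \<Longrightarrow> cmod (F q) \<le> M * norm q"
  shows "\<exists>x\<in>closure L. \<forall>q\<in>L. cinner q x = F q"
proof -
  define J where "J q = (norm q)\<^sup>2 - 2 * Re (F q)" for q
  have low: "- (M\<^sup>2) \<le> J q" if "q \<in> L" for q
  proof -
    have "Re (F q) \<le> M * norm q"
      using bd[OF that] complex_Re_le_cmod[of "F q"] by linarith
    moreover have "0 \<le> (norm q - M)\<^sup>2" by simp
    ultimately show ?thesis by (simp add: J_def power2_eq_square algebra_simps)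
  qed
  define m where "m = Inf (J ` L)"
  have bdd: "bdd_below (J ` L)" using low by (auto simp: bdd_below_def)
  have ne: "J ` L \<noteq> {}" using csubspaceD(1)[OF L] by auto
  have m_le: "m \<le> J q" if "q \<in> L" for q
    unfolding m_def using bdd that by (auto intro: cInf_lower)
  have "\<exists>p\<in>L. J p < m + 1 / (real n + 1)" for n
    using cInf_lessD[OF ne, of "m + 1 / (real n + 1)"] by (auto simp: m_def)
  then obtain p where p: "\<And>n. p n \<in> L" "\<And>n. J (p n) < m + 1 / (real n + 1)"
    by metis
  have key: "(norm (q - r))\<^sup>2 \<le> 2 * J q + 2 * J r - 4 * m" if "q \<in> L" "r \<in> L" for q r
  proof -
    define s where "s = (1/2) *\<^sub>C (q + r)"
    have s: "s \<in> L" using that L by (simp add: s_def csubspaceD)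
    have "J s = (norm (q + r))\<^sup>2 / 4 - Re (F q) - Re (F r)"
      using that arg_cong[OF scale[of "q + r" "1/2"], of Re] L
      by (simp add: J_def s_def norm_scaleC norm_divide power_divide add csubspaceD)
    then have "(norm (q - r))\<^sup>2 = 2 * J q + 2 * J r - 4 * J s"
      by (simp add: J_def norm_add_sq norm_diff_sq field_simps)
    then show ?thesis using m_le[OF s] by linarith
  qed
  have dif: "(norm (p i - p j))\<^sup>2 \<le> 2 * (1 / (real i + 1)) + 2 * (1 / (real j + 1))" for i j
    using key[OF p(1) p(1), of i j] p(2)[of i] p(2)[of j] by linarith
  have "Cauchy p"
  proof (rule metric_CauchyI)
    fix e :: real assume e: "0 < e"
    obtain N where N: "4 / e\<^sup>2 < real N" using reals_Archimedean2 by blast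
    have small: "2 * (1 / (real i + 1)) < e\<^sup>2 / 2" if "i \<ge> N" for i
    proof -
      have "4 / e\<^sup>2 < real i + 1" using N that by linarith
      then show ?thesis using e by (simp add: field_simps)
    qed
    have "dist (p i) (p j) < e" if "i \<ge> N" "j \<ge> N" for i j
    proof -
      have "(norm (p i - p j))\<^sup>2 < e\<^sup>2"
        using dif[of i j] small[OF that(1)] small[OF that(2)] by linarith
      then show ?thesis using e by (simp add: dist_norm power_less_imp_less_base)
    qed
    then show "\<exists>N. \<forall>i\<ge>N. \<forall>j\<ge>N. dist (p i) (p j) < e" by blast
  qed
  then obtain x where x: "p \<longlonglongrightarrow> x" using Cauchy_convergent convergent_def by blast
  have xcl: "x \<in> closure L" using p(1) x closure_sequential by blast
  have J_lim: "(\<lambda>n. J (p n)) \<longlonglongrightarrow> m"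
  proof (rule tendsto_sandwich[OF _ _ tendsto_const])
    have "(\<lambda>n. m + inverse (real (Suc n))) \<longlonglongrightarrow> m + 0"
      by (intro tendsto_intros LIMSEQ_inverse_real_of_nat)
    then show "(\<lambda>n. m + inverse (real (Suc n))) \<longlonglongrightarrow> m" by simp
    show "\<forall>\<^sub>F n in sequentially. J (p n) \<le> m + inverse (real (Suc n))"
      using p(2) by (auto intro!: always_eventually less_imp_le simp: inverse_eq_divide add.commute)
  qed (use m_le p(1) in auto)
  have ReF: "Re (cinner q x) = Re (F q)" if q: "q \<in> L" for q
  proof -
    define a where "a = Re (cinner q x) - Re (F q)"
    have ge: "0 \<le> 2 * t * a + t\<^sup>2 * (norm q)\<^sup>2" for t :: real
    proof -
      have expand: "J (p n + complex_of_real t *\<^sub>C q) =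
          J (p n) + 2 * t * (Re (cinner (p n) q) - Re (F q)) + t\<^sup>2 * (norm q)\<^sup>2" for n
        using q p(1)[of n] L
        by (simp add: J_def norm_add_sq add scale csubspaceD norm_scaleC cinner_scaleC_right
            power_mult_distrib algebra_simps)
      have "(\<lambda>n. J (p n) + 2 * t * (Re (cinner (p n) q) - Re (F q)) + t\<^sup>2 * (norm q)\<^sup>2)
          \<longlonglongrightarrow> m + 2 * t * (Re (cinner x q) - Re (F q)) + t\<^sup>2 * (norm q)\<^sup>2"
        by (intro tendsto_intros J_lim tendsto_Re tendsto_cinner x)
      moreover have "m \<le> J (p n) + 2 * t * (Re (cinner (p n) q) - Re (F q)) + t\<^sup>2 * (norm q)\<^sup>2" for n
        unfolding expand[symmetric] using q p(1) L by (intro m_le) (simp add: csubspaceD)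
      ultimately have "m \<le> m + 2 * t * (Re (cinner x q) - Re (F q)) + t\<^sup>2 * (norm q)\<^sup>2"
        by (meson LIMSEQ_le_const)
      moreover have "Re (cinner x q) = Re (cinner q x)" by (metis cinner_commute cnj.sel(1))
      ultimately show ?thesis by (simp add: a_def)
    qed
    define b where "b = (norm q)\<^sup>2"
    have b: "b \<ge> 0" by (simp add: b_def)
    have "0 \<le> 2 * (- a / (b + 1)) * a + (- a / (b + 1))\<^sup>2 * b" using ge b_def by blast
    also have "\<dots> = - (a\<^sup>2 * (b + 2)) / (b + 1)\<^sup>2"
      using b by (simp add: power2_eq_square divide_simps) (simp add: algebra_simps)
    finally have "a\<^sup>2 * (b + 2) \<le> 0"
      using b by (simp add: divide_simps split: if_splits)
    then have "a = 0" using b by (simp add: mult_le_0_iff)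
    then show ?thesis by (simp add: a_def)
  qed
  have "cinner q x = F q" if q: "q \<in> L" for q
    using ReF[OF q] ReF[OF csubspaceD(3)[OF L q, of \<i>]] scale[OF q, of \<i>]
    by (simp add: cinner_scaleC_left complex_eq_iff)
  then show ?thesis using xcl by blast
qed

definition proj :: "'a::chilbert_space set \<Rightarrow> 'a \<Rightarrow> 'a" where
  "proj L x = (THE p. p \<in> L \<and> (\<forall>q\<in>L. cinner q p = cinner q x))"

lemma proj_works:
  assumes L: "closed_csubspace L"
  shows "proj L x \<in> L" "q \<in> L \<Longrightarrow> cinner q (proj L x) = cinner q x"
proof -
  have "\<exists>p\<in>closure L. \<forall>q\<in>L. cinner q p = cinner q x"
    by (rule riesz_subspace[where M="norm x"])
       (use L Cauchy_Schwarz_cinner in \<open>auto simp: closed_csubspaceD cinner_add_left cinner_scaleC_left mult.commute\<close>)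
  then have ex: "\<exists>p. p \<in> L \<and> (\<forall>q\<in>L. cinner q p = cinner q x)"
    using L by (auto simp: closed_csubspaceD)
  have "\<exists>!p. p \<in> L \<and> (\<forall>q\<in>L. cinner q p = cinner q x)"
  proof (rule ex_ex1I[OF ex])
    fix p p' assume "p \<in> L \<and> (\<forall>q\<in>L. cinner q p = cinner q x)" "p' \<in> L \<and> (\<forall>q\<in>L. cinner q p' = cinner q x)"
    then have "cinner (p - p') (p - p') = 0"
      using csubspace_diff[OF closed_csubspaceD(1)[OF L], of p p'] by (simp add: cinner_diff_right)
    then show "p = p'" by (simp add: cinner_eq_zero_iff)
  qed
  from theI'[OF this] show "proj L x \<in> L" "q \<in> L \<Longrightarrow> cinner q (proj L x) = cinner q x"
    unfolding proj_def by blast+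
qed

lemma proj_eqI:
  assumes L: "closed_csubspace L" and p: "p \<in> L" "\<And>q. q \<in> L \<Longrightarrow> cinner q p = cinner q x"
  shows "proj L x = p"
proof -
  have "cinner (proj L x - p) (proj L x - p) = 0"
    using csubspace_diff[OF closed_csubspaceD(1)[OF L] proj_works(1)[OF L] p(1)]
    by (simp add: cinner_diff_right[of _ "proj L x" p] proj_works(2)[OF L] p(2))
  then show ?thesis by (simp add: cinner_eq_zero_iff)
qed

lemma proj_id: "closed_csubspace L \<Longrightarrow> x \<in> L \<Longrightarrow> proj L x = x"
  by (rule proj_eqI) auto

lemma proj_left: "closed_csubspace L \<Longrightarrow> q \<in> L \<Longrightarrow> cinner (proj L x) q = cinner x q"
  using proj_works(2) cinner_commute by metis

lemma proj_selfadjoint: "closed_csubspace L \<Longrightarrow> cinner (proj L x) y = cinner x (proj L y)"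
  by (metis proj_left proj_works)

lemma norm_proj_le:
  assumes L: "closed_csubspace L" shows "norm (proj L x) \<le> norm x"
proof -
  have "(norm (proj L x))\<^sup>2 = Re (cinner x (proj L x))"
    using proj_left[OF L proj_works(1)[OF L], of x x] by (simp add: norm_sq_cinner)
  also have "\<dots> \<le> norm x * norm (proj L x)"
    using Cauchy_Schwarz_cinner complex_Re_le_cmod order_trans by blast
  finally have "norm (proj L x) * norm (proj L x) \<le> norm x * norm (proj L x)"
    by (simp add: power2_eq_square)
  then show ?thesis
    by (cases "norm (proj L x) = 0") (auto simp: mult_le_cancel_right)
qed

lemma bclin_proj:
  assumes L: "closed_csubspace L" shows "bounded_clinear_op (proj L)"
proof (rule bclinI[where K=1])
  note S = closed_csubspaceD(1)[OF L] and w = proj_works[OF L]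
  show "proj L (x + y) = proj L x + proj L y" for x y
    by (rule proj_eqI[OF L]) (auto simp: S csubspaceD w cinner_add_right)
  show "proj L (c *\<^sub>C x) = c *\<^sub>C proj L x" for c x
    by (rule proj_eqI[OF L]) (auto simp: S csubspaceD w cinner_scaleC_right)
qed (simp add: norm_proj_le[OF L])

lemma closed_csubspace_eq_total:
  assumes L: "closed_csubspace L" and V: "csubspace V" and LV: "L \<subseteq> V"
    and tot: "\<And>x. x \<in> V \<Longrightarrow> (\<And>q. q \<in> L \<Longrightarrow> cinner q x = 0) \<Longrightarrow> x = 0"
  shows "L = (V :: 'a::chilbert_space set)"
proof (rule antisym[OF LV], rule subsetI)
  fix x assume x: "x \<in> V"
  have "x - proj L x = 0"
    by (rule tot) (use csubspace_diff[OF V x, of "proj L x"] proj_works[OF L] LV in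
      \<open>auto simp: cinner_diff_right\<close>)
  then show "x \<in> L" using proj_works(1)[OF L, of x] by simp
qed

lemma cinner_cadj:
  fixes A :: "'a::chilbert_space \<Rightarrow> 'b::complex_inner"
  assumes A: "bounded_clinear_op A"
  shows "cinner (A x) y = cinner x (cadj A y)"
proof -
  obtain K where K: "\<And>x. norm (A x) \<le> K * norm x" using bclinD(3)[OF A] by blast
  have "\<exists>z. \<forall>x. cinner (A x) y = cinner x z" for y
  proof -
    have bd: "cmod (cinner (A x) y) \<le> K * norm y * norm x" for x
      using Cauchy_Schwarz_cinner[of "A x" y] mult_right_mono[OF K[of x], of "norm y"]
      by (simp add: mult_ac)
    have "\<exists>z\<in>closure UNIV. \<forall>x\<in>UNIV. cinner x z = cinner (A x) y"
      by (rule riesz_subspace[where M="K * norm y"])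
         (auto simp: csubspace_def bclinD(1,2)[OF A] cinner_add_left cinner_scaleC_left bd)
    then show ?thesis by (metis UNIV_I)
  qed
  then obtain B where B: "\<And>x y. cinner (A x) y = cinner x (B y)" by metis
  have "cadj A = B"
    unfolding cadj_def
  proof (rule the_equality)
    fix B' assume "\<forall>x y. cinner (A x) y = cinner x (B' y)"
    then have "cinner x (B' y) = cinner x (B y)" for x y using B by metis
    then show "B' = B" by (intro ext cinner_extI_right)
  qed (use B in blast)
  then show ?thesis using B by simp
qed

lemma cinner_cadj_left:
  fixes A :: "'a::chilbert_space \<Rightarrow> 'b::complex_inner"
  shows "bounded_clinear_op A \<Longrightarrow> cinner (cadj A y) x = cinner y (A x)"
  using cinner_cadj[of A x y] cinner_commute by metis

lemma bclin_cadj: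
  fixes A :: "'a::chilbert_space \<Rightarrow> 'b::complex_inner"
  assumes A: "bounded_clinear_op A"
  shows "bounded_clinear_op (cadj A)"
proof -
  obtain K where K: "\<And>x. norm (A x) \<le> K * norm x" using bclinD(3)[OF A] by blast
  show ?thesis
  proof (rule bclinI[where K="\<bar>K\<bar>"])
    show "cadj A (x + y) = cadj A x + cadj A y" for x y
      by (rule cinner_extI_right) (simp add: cinner_add_right cinner_cadj[OF A, symmetric])
    show "cadj A (c *\<^sub>C x) = c *\<^sub>C cadj A x" for c x
      by (rule cinner_extI_right) (simp add: cinner_scaleC_right cinner_cadj[OF A, symmetric])
    fix x
    have "(norm (cadj A x))\<^sup>2 = Re (cinner (A (cadj A x)) x)"
      by (simp add: norm_sq_cinner cinner_cadj[OF A])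
    also have "\<dots> \<le> norm (A (cadj A x)) * norm x"
      using Cauchy_Schwarz_cinner complex_Re_le_cmod order_trans by blast
    also have "\<dots> \<le> \<bar>K\<bar> * norm (cadj A x) * norm x"
      by (intro mult_right_mono order_trans[OF K]) auto
    finally have "norm (cadj A x) * norm (cadj A x) \<le> norm (cadj A x) * (\<bar>K\<bar> * norm x)"
      by (simp add: power2_eq_square mult_ac)
    then show "norm (cadj A x) \<le> \<bar>K\<bar> * norm x"
      by (cases "norm (cadj A x) = 0") (auto simp: mult_le_cancel_left)
  qed
qed

definition ccspan :: "'a::complex_inner set \<Rightarrow> 'a set" where
  "ccspan G = \<Inter>{L. closed_csubspace L \<and> G \<subseteq> L}"

lemma ccspan_superset: "G \<subseteq> ccspan G"
  by (auto simp: ccspan_def)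

lemma ccspan_least: "closed_csubspace L \<Longrightarrow> G \<subseteq> L \<Longrightarrow> ccspan G \<subseteq> L"
  by (auto simp: ccspan_def)

lemma closed_csubspace_Inter: "(\<And>L. L \<in> C \<Longrightarrow> closed_csubspace L) \<Longrightarrow> closed_csubspace (\<Inter>C)"
  unfolding closed_csubspace_def csubspace_def by (auto intro!: closed_Inter)

lemma closed_csubspace_ccspan: "closed_csubspace (ccspan G)"
  unfolding ccspan_def by (rule closed_csubspace_Inter) auto

lemma closed_csubspace_orth: "closed_csubspace {x. \<forall>g\<in>G. cinner x g = 0}"
proof -
  have "closed (\<Inter>g\<in>G. {x. cinner x g = 0})"
    by (intro closed_INT ballI closed_Collect_eq continuous_on_cinner continuous_on_id continuous_on_const)
  then show ?thesis
    by (auto simp: closed_csubspace_def csubspace_def cinner_add_left cinner_scaleC_left Collect_ball_eq)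
qed

lemma closed_csubspace_Int: "closed_csubspace L \<Longrightarrow> closed_csubspace M \<Longrightarrow> closed_csubspace (L \<inter> M)"
  by (auto simp: closed_csubspace_def csubspace_def)

lemma closed_csubspace_vimage:
  assumes A: "bounded_clinear_op A" and L: "closed_csubspace L"
  shows "closed_csubspace {x. A x \<in> L}"
proof -
  have "closed (A -` L)"
    by (rule continuous_closed_vimage)
       (use L bclin_continuous_on[OF A, of UNIV] in \<open>auto simp: closed_csubspaceD continuous_on_eq_continuous_at\<close>)
  then show ?thesis
    using csubspaceD[OF closed_csubspaceD(1)[OF L]]
    by (auto simp: closed_csubspace_def csubspace_def vimage_def bclin_zero[OF A]
        bclinD(1,2)[OF A])
qed

lemma closed_csubspace_eq:
  assumes A: "bounded_clinear_op A" and B: "bounded_clinear_op B"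
  shows "closed_csubspace {x. A x = B x}"
proof -
  have "closed {x. A x = B x}"
    by (intro closed_Collect_eq bclin_continuous_on A B)
  then show ?thesis
    by (auto simp: closed_csubspace_def csubspace_def bclin_zero[OF A] bclin_zero[OF B]
        bclinD(1,2)[OF A] bclinD(1,2)[OF B])
qed

lemma closed_csubspace_closure:
  fixes L :: "'a::complex_inner set"
  assumes L: "csubspace L" shows "closed_csubspace (closure L)"
  unfolding closed_csubspace_def csubspace_def
proof (intro conjI ballI allI closed_closure)
  show "0 \<in> closure L" using csubspaceD(1)[OF L] closure_subset by blast
next
  fix x y assume "x \<in> closure L" "y \<in> closure L"
  then obtain p q where "\<And>n. p n \<in> L" "p \<longlonglongrightarrow> x" "\<And>n. q n \<in> L" "q \<longlonglongrightarrow> y"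
    unfolding closure_sequential by metis
  then show "x + y \<in> closure L"
    unfolding closure_sequential using csubspaceD(2)[OF L]
    by (intro exI[of _ "\<lambda>n. p n + q n"]) (auto intro: tendsto_add)
next
  fix c x assume "x \<in> closure L"
  then obtain p where "\<And>n. p n \<in> L" "p \<longlonglongrightarrow> x" unfolding closure_sequential by metis
  then show "c *\<^sub>C x \<in> closure L"
    unfolding closure_sequential using csubspaceD(3)[OF L]
    by (intro exI[of _ "\<lambda>n. c *\<^sub>C p n"])
       (auto intro: bclin_tendsto[OF bclin_scaleC[OF bclin_id]])
qed

lemma csubspace_image:
  assumes A: "bounded_clinear_op A" and L: "csubspace L" shows "csubspace (A ` L)"
  unfolding csubspace_def
proof (intro conjI ballI allI)
  show "0 \<in> A ` L" using csubspaceD(1)[OF L] bclin_zero[OF A] by force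
  show "x + y \<in> A ` L" if "x \<in> A ` L" "y \<in> A ` L" for x y
    using that csubspaceD(2)[OF L] by (auto simp: bclinD(1)[OF A, symmetric])
  show "c *\<^sub>C x \<in> A ` L" if "x \<in> A ` L" for c x
    using that csubspaceD(3)[OF L] by (auto simp: bclinD(2)[OF A, symmetric])
qed

lemma closed_csubspace_image:
  fixes A :: "'a::chilbert_space \<Rightarrow> 'b::chilbert_space"
  assumes A: "bounded_clinear_op A" and L: "closed_csubspace L"
    and e: "0 < e" "\<And>x. x \<in> L \<Longrightarrow> e * norm x \<le> norm (A x)"
  shows "closed_csubspace (A ` L)"
proof -
  note S = csubspaceD[OF closed_csubspaceD(1)[OF L]]
  have "subspace L" using S by (auto simp: subspace_def scaleR_scaleC)
  then have "complete (A ` L)"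
    using e bclin_bounded_linear[OF A] closed_csubspaceD(2)[OF L]
    by (intro complete_isometric_image[of e]) (auto simp: complete_eq_closed)
  then show ?thesis
    by (simp add: closed_csubspace_def complete_imp_closed csubspace_image[OF A closed_csubspaceD(1)[OF L]])
qed

lemma ccspan_total:
  assumes "x \<in> ccspan G" "\<And>g. g \<in> G \<Longrightarrow> cinner x g = 0"
  shows "x = 0"
proof -
  have "ccspan G \<subseteq> {z. \<forall>g\<in>{x}. cinner z g = 0}"
    by (rule ccspan_least[OF closed_csubspace_orth]) (use assms(2) cinner_eq_0_commute in auto)
  then have "cinner x x = 0" using assms(1) by auto
  then show ?thesis by (simp add: cinner_eq_zero_iff)
qed

lemma closure_orth_eq_0:
  assumes "x \<in> closure A" "\<And>a. a \<in> A \<Longrightarrow> cinner x a = 0" shows "x = 0"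
proof -
  have "closure A \<subseteq> {w. cinner x w = 0}"
    by (rule closure_minimal)
       (use assms(2) in \<open>auto intro!: closed_Collect_eq continuous_on_cinner continuous_on_id continuous_on_const\<close>)
  then show ?thesis using assms(1) cinner_eq_zero_iff by blast
qed

lemma isometry_tendsto:
  assumes iso: "\<And>x y. x \<in> V \<Longrightarrow> y \<in> V \<Longrightarrow> cinner (W x) (W y) = cinner x y"
    and f: "\<And>n. f n \<in> V" "x \<in> V" "f \<longlonglongrightarrow> x"
  shows "(\<lambda>n. W (f n)) \<longlonglongrightarrow> W x"
proof -
  have "(norm (W (f n) - W x))\<^sup>2 = (norm (f n - x))\<^sup>2" for n
    by (simp add: norm_sq_cinner cinner_diff_left cinner_diff_right iso f)
  then have "norm (W (f n) - W x) = norm (f n - x)" for n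
    by (simp add: power2_eq_iff_nonneg)
  then show ?thesis using f(3) by (simp add: LIMSEQ_iff)
qed

section \<open>Products\<close>

instantiation prod :: (complex_vector, complex_vector) complex_vector
begin
definition scaleC_prod :: "complex \<Rightarrow> 'a \<times> 'b \<Rightarrow> 'a \<times> 'b" where
  "scaleC_prod c p = (c *\<^sub>C fst p, c *\<^sub>C snd p)"
instance
  by standard (auto simp: scaleC_prod_def prod_eq_iff scaleC_add_right scaleC_add_left scaleC_scaleC
      scaleC_one scaleR_scaleC)
end

instantiation prod :: (complex_inner, complex_inner) complex_inner
begin
definition cinner_prod :: "'a \<times> 'b \<Rightarrow> 'a \<times> 'b \<Rightarrow> complex" where
  "cinner_prod p q = cinner (fst p) (fst q) + cinner (snd p) (snd q)"
instance
proof
  fix x y z :: "'a \<times> 'b" and r :: complex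
  show "cinner x y = cnj (cinner y x)"
    by (simp add: cinner_prod_def cinner_commute[symmetric])
  show "cinner (x + y) z = cinner x z + cinner y z"
    by (simp add: cinner_prod_def cinner_add_left)
  show "cinner (r *\<^sub>C x) y = r * cinner x y"
    by (simp add: cinner_prod_def scaleC_prod_def cinner_scaleC_left algebra_simps)
  have *: "cinner x x = complex_of_real ((norm (fst x))\<^sup>2 + (norm (snd x))\<^sup>2)"
    by (simp add: cinner_prod_def cinner_self)
  show "0 \<le> Re (cinner x x)" unfolding * by simp
  show "cinner x x = 0 \<longleftrightarrow> x = 0" unfolding * of_real_eq_0_iff
    by (auto simp: add_nonneg_eq_0_iff prod_eq_iff)
  show "norm x = sqrt (Re (cinner x x))" unfolding * by (simp add: norm_prod_def)
qed
end

instance prod :: (chilbert_space, chilbert_space) chilbert_space ..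

instantiation vec :: (complex_vector, finite) complex_vector
begin
definition scaleC_vec :: "complex \<Rightarrow> 'a ^ 'b \<Rightarrow> 'a ^ 'b" where
  "scaleC_vec c x = (\<chi> i. c *\<^sub>C (x $ i))"
instance
  by standard (auto simp: scaleC_vec_def vec_eq_iff scaleC_add_right scaleC_add_left scaleC_scaleC
      scaleC_one scaleR_scaleC)
end

instantiation vec :: (complex_inner, finite) complex_inner
begin
definition cinner_vec :: "'a ^ 'b \<Rightarrow> 'a ^ 'b \<Rightarrow> complex" where
  "cinner_vec x y = (\<Sum>i\<in>UNIV. cinner (x $ i) (y $ i))"
instance
proof
  fix x y z :: "'a ^ 'b" and r :: complex
  show "cinner x y = cnj (cinner y x)"
    by (simp add: cinner_vec_def cinner_commute[symmetric])
  show "cinner (x + y) z = cinner x z + cinner y z"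
    by (simp add: cinner_vec_def cinner_add_left sum.distrib)
  show "cinner (r *\<^sub>C x) y = r * cinner x y"
    by (simp add: cinner_vec_def scaleC_vec_def cinner_scaleC_left sum_distrib_left)
  have *: "cinner x x = complex_of_real (\<Sum>i\<in>UNIV. (norm (x $ i))\<^sup>2)"
    by (simp add: cinner_vec_def cinner_self)
  show "0 \<le> Re (cinner x x)" unfolding * by (simp add: sum_nonneg)
  show "cinner x x = 0 \<longleftrightarrow> x = 0" unfolding * of_real_eq_0_iff
    by (simp add: sum_nonneg_eq_0_iff vec_eq_iff)
  show "norm x = sqrt (Re (cinner x x))" unfolding * by (simp add: norm_vec_def L2_set_def)
qed
end

instance vec :: (chilbert_space, finite) chilbert_space ..

lemma scaleC_vec_nth [simp]: "(c *\<^sub>C x) $ i = c *\<^sub>C (x $ i)"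
  by (simp add: scaleC_vec_def)

lemma scaleC_Pair [simp]: "c *\<^sub>C (x, y) = (c *\<^sub>C x, c *\<^sub>C y)"
  by (simp add: scaleC_prod_def)

lemma cinner_Pair [simp]: "cinner (x, y) (x', y') = cinner x x' + cinner y y'"
  by (simp add: cinner_prod_def)

lemma norm_vec_sq: "(norm (x :: 'a::complex_inner ^ 'd))\<^sup>2 = (\<Sum>i\<in>UNIV. (norm (x $ i))\<^sup>2)"
  by (simp add: norm_vec_def L2_set_def sum_nonneg)

lemma bclin_fst: "bounded_clinear_op (fst :: 'a::complex_inner \<times> 'b::complex_inner \<Rightarrow> 'a)"
  by (rule bclinI[where K=1]) (auto simp: scaleC_prod_def norm_fst_le)

lemma bclin_snd: "bounded_clinear_op (snd :: 'a::complex_inner \<times> 'b::complex_inner \<Rightarrow> 'b)"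
  by (rule bclinI[where K=1]) (auto simp: scaleC_prod_def norm_snd_le)

lemma bclin_nth: "bounded_clinear_op (\<lambda>x :: 'a::complex_inner ^ 'd. x $ i)"
  by (rule bclinI[where K=1]) (auto simp: Finite_Cartesian_Product.norm_nth_le)

lemma bclin_vec:
  assumes A: "\<And>i. bounded_clinear_op (A i)"
  shows "bounded_clinear_op (\<lambda>x. (\<chi> i. A i x) :: 'a::complex_inner ^ 'd)"
proof -
  have "\<exists>K. \<forall>x. norm (A i x) \<le> K * norm x" for i using bclinD(3)[OF A] .
  then obtain K where K: "\<And>i x. norm (A i x) \<le> K i * norm x" by metis
  have "norm ((\<chi> i. A i x) :: 'a ^ 'd) \<le> (\<Sum>i\<in>UNIV. K i) * norm x" for x
    using order_trans[OF norm_le_l1_cart sum_mono] K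
    by (simp add: sum_distrib_right norm_vec_def order_trans[OF L2_set_le_sum sum_mono])
  then show ?thesis
    by (intro bclinI[where K="\<Sum>i\<in>UNIV. K i"])
       (auto simp: vec_eq_iff bclinD(1,2)[OF A])
qed

lemma closed_csubspace_Times:
  "closed_csubspace L \<Longrightarrow> closed_csubspace M \<Longrightarrow> closed_csubspace (L \<times> M)"
  by (auto simp: closed_csubspace_def csubspace_def closed_Times zero_prod_def)

lemma closed_csubspace_vec:
  assumes "closed_csubspace L"
  shows "closed_csubspace {x :: 'a::complex_inner ^ 'd. \<forall>i. x $ i \<in> L}"
proof -
  have "{x :: 'a ^ 'd. \<forall>i. x $ i \<in> L} = \<Inter>((\<lambda>i. {x. x $ i \<in> L}) ` UNIV)" by auto
  then show ?thesis
    by (simp only:) (rule closed_csubspace_Inter,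
        auto intro: closed_csubspace_vimage[OF bclin_nth assms])
qed

section \<open>Unitaries from equal Gram matrices\<close>

definition unitary_on :: "'a::complex_inner set \<Rightarrow> 'b::complex_inner set \<Rightarrow> ('a \<Rightarrow> 'b) \<Rightarrow> bool" where
  "unitary_on V1 V2 W \<longleftrightarrow> (\<forall>x\<in>V1. \<forall>y\<in>V1. W (x + y) = W x + W y) \<and>
    (\<forall>c. \<forall>x\<in>V1. W (c *\<^sub>C x) = c *\<^sub>C W x) \<and> (\<forall>x\<in>V1. \<forall>y\<in>V1. cinner (W x) (W y) = cinner x y) \<and> W ` V1 = V2"

lemma unitary_onD:
  assumes "unitary_on V1 V2 W"
  shows "x \<in> V1 \<Longrightarrow> y \<in> V1 \<Longrightarrow> W (x + y) = W x + W y" "x \<in> V1 \<Longrightarrow> W (c *\<^sub>C x) = c *\<^sub>C W x"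
    "x \<in> V1 \<Longrightarrow> y \<in> V1 \<Longrightarrow> cinner (W x) (W y) = cinner x y" "W ` V1 = V2"
  using assms by (auto simp: unitary_on_def)

text \<open>The graph of the unitary is the closed linear span of the pairs \<open>(g i, h i)\<close>.\<close>

lemma unitary_of_gram:
  fixes g :: "'i \<Rightarrow> 'a::chilbert_space" and h :: "'i \<Rightarrow> 'b::chilbert_space"
  assumes V1: "closed_csubspace V1" and V2: "closed_csubspace V2"
    and g: "\<And>i. i \<in> I \<Longrightarrow> g i \<in> V1" and h: "\<And>i. i \<in> I \<Longrightarrow> h i \<in> V2"
    and gram: "\<And>i j. i \<in> I \<Longrightarrow> j \<in> I \<Longrightarrow> cinner (g i) (g j) = cinner (h i) (h j)"
    and tot1: "\<And>x. x \<in> V1 \<Longrightarrow> (\<And>i. i \<in> I \<Longrightarrow> cinner x (g i) = 0) \<Longrightarrow> x = 0"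
    and tot2: "\<And>x. x \<in> V2 \<Longrightarrow> (\<And>i. i \<in> I \<Longrightarrow> cinner x (h i) = 0) \<Longrightarrow> x = 0"
  shows "\<exists>W. (\<forall>i\<in>I. W (g i) = h i) \<and> unitary_on V1 V2 W"
proof -
  define G where "G = ccspan ((\<lambda>i. (g i, h i)) ` I)"
  have G: "closed_csubspace G" unfolding G_def by (rule closed_csubspace_ccspan)
  have gen: "(g i, h i) \<in> G" if "i \<in> I" for i
    using ccspan_superset that unfolding G_def by fast
  have G1: "cinner (fst p) (g j) = cinner (snd p) (h j)" if "p \<in> G" "j \<in> I" for p j
  proof -
    have "G \<subseteq> {p. \<forall>q\<in>{(g j, - h j)}. cinner p q = 0}"
      unfolding G_def by (rule ccspan_least[OF closed_csubspace_orth])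
        (use gram that in \<open>auto simp: cinner_minus_right\<close>)
    then have "cinner p (g j, - h j) = 0" using that by auto
    then show ?thesis by (simp add: cinner_prod_def cinner_minus_right)
  qed
  have G2: "cinner (fst p) (fst q) = cinner (snd p) (snd q)" if "p \<in> G" "q \<in> G" for p q
  proof -
    have "cinner (g j) (fst q) = cinner (h j) (snd q)" if "j \<in> I" for j
      using G1[OF \<open>q \<in> G\<close> that] cinner_commute by metis
    then have "G \<subseteq> {p. \<forall>q\<in>{(fst q, - snd q)}. cinner p q = 0}"
      unfolding G_def by (intro ccspan_least[OF closed_csubspace_orth]) (auto simp: cinner_minus_right)
    then have "cinner p (fst q, - snd q) = 0" using that by auto
    then show ?thesis by (simp add: cinner_prod_def cinner_minus_right)
  qed
  have nrm: "norm (fst p) = norm (snd p)" if "p \<in> G" for p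
    using G2[OF that that] by (simp add: norm_eq_sqrt_cinner)
  have GV: "G \<subseteq> V1 \<times> V2"
    unfolding G_def by (rule ccspan_least[OF closed_csubspace_Times[OF V1 V2]]) (use g h in auto)
  have sq: "(norm p)\<^sup>2 = (norm (fst p))\<^sup>2 + (norm (snd p))\<^sup>2" for p :: "'a \<times> 'b"
    by (simp add: norm_prod_def)
  have low: "1 / 2 * norm p \<le> norm (fst p) \<and> 1 / 2 * norm p \<le> norm (snd p)" if "p \<in> G" for p
  proof -
    have "(norm p)\<^sup>2 \<le> (2 * norm (fst p))\<^sup>2"
      using sq[of p] nrm[OF that] by (simp add: power_mult_distrib)
    then have "norm p \<le> 2 * norm (fst p)" by (rule power2_le_imp_le) simp
    then show ?thesis using nrm[OF that] by simp
  qed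
  have F: "closed_csubspace (fst ` G)" "closed_csubspace (snd ` G)"
    using low by (auto intro!: closed_csubspace_image[where e="1/2", OF _ G]
        bclin_fst bclin_snd)
  have f1: "fst ` G = V1"
  proof (rule closed_csubspace_eq_total[OF F(1) closed_csubspaceD(1)[OF V1]])
    show "x = 0" if "x \<in> V1" "\<And>q. q \<in> fst ` G \<Longrightarrow> cinner q x = 0" for x
      by (rule tot1[OF that(1)]) (metis that(2) cinner_eq_0_commute gen fst_conv image_eqI)
  qed (use GV in auto)
  have f2: "snd ` G = V2"
  proof (rule closed_csubspace_eq_total[OF F(2) closed_csubspaceD(1)[OF V2]])
    show "x = 0" if "x \<in> V2" "\<And>q. q \<in> snd ` G \<Longrightarrow> cinner q x = 0" for x
      by (rule tot2[OF that(1)]) (metis that(2) cinner_eq_0_commute gen snd_conv image_eqI)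
  qed (use GV in auto)
  note Gs = csubspaceD[OF closed_csubspaceD(1)[OF G]]
  have uniq: "w = w'" if "(x, w) \<in> G" "(x, w') \<in> G" for x w w'
    using nrm[OF csubspace_diff[OF closed_csubspaceD(1)[OF G] that]] by simp
  define W where "W x = (THE w. (x, w) \<in> G)" for x
  have W_eq: "W x = w" if "(x, w) \<in> G" for x w
    unfolding W_def using that uniq by blast
  have W_in: "(x, W x) \<in> G" if x: "x \<in> V1" for x
  proof -
    obtain w where "(x, w) \<in> G" using x f1 by force
    then show ?thesis using W_eq by auto
  qed
  have "W (x + y) = W x + W y" if "x \<in> V1" "y \<in> V1" for x y
    using Gs(2)[OF W_in[OF that(1)] W_in[OF that(2)]] by (auto intro: W_eq)
  moreover have "W (c *\<^sub>C x) = c *\<^sub>C W x" if "x \<in> V1" for c x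
    using Gs(3)[OF W_in[OF that], of c] by (auto intro: W_eq)
  moreover have "cinner (W x) (W y) = cinner x y" if "x \<in> V1" "y \<in> V1" for x y
    using G2[OF W_in[OF that(1)] W_in[OF that(2)]] by simp
  moreover have "W ` V1 = V2"
  proof (intro set_eqI iffI)
    fix w assume "w \<in> W ` V1"
    then show "w \<in> V2" using W_in GV by auto
  next
    fix w assume "w \<in> V2"
    then obtain x where "(x, w) \<in> G" using f2 by force
    then show "w \<in> W ` V1" using W_eq f1 by force
  qed
  ultimately have "unitary_on V1 V2 W" by (simp add: unitary_on_def)
  then show ?thesis using W_eq gen by blast
qed

section \<open>Square roots\<close>

text \<open>The coefficients of \<open>1 - (1 - t)\<^bsup>1/2\<^esup>\<close>, read off from \<open>2 c = t + c\<^sup>2\<close>.\<close>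

fun sqrt_coeff :: "nat \<Rightarrow> real" where
  "sqrt_coeff n = ((if n = 1 then 1 else 0) + (\<Sum>i\<in>{1..<n}. sqrt_coeff i * sqrt_coeff (n - i))) / 2"

declare sqrt_coeff.simps [simp del]

lemma sqrt_coeff_0 [simp]: "sqrt_coeff 0 = 0"
  by (subst sqrt_coeff.simps) simp

lemma sqrt_coeff_nonneg: "0 \<le> sqrt_coeff n"
proof (induction n rule: less_induct)
  case (less n)
  then show ?case
    by (subst sqrt_coeff.simps) (auto intro!: sum_nonneg add_nonneg_nonneg mult_nonneg_nonneg)
qed

lemma sqrt_coeff_conv:
  "(\<Sum>i\<le>n. sqrt_coeff i * sqrt_coeff (n - i)) = 2 * sqrt_coeff n - (if n = 1 then 1 else 0)"
proof -
  have "(\<Sum>i\<le>n. sqrt_coeff i * sqrt_coeff (n - i)) = (\<Sum>i\<in>{1..<n}. sqrt_coeff i * sqrt_coeff (n - i))"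
  proof (rule sum.mono_neutral_right)
    show "\<forall>i\<in>{..n} - {1..<n}. sqrt_coeff i * sqrt_coeff (n - i) = 0"
    proof
      fix i assume "i \<in> {..n} - {1..<n}"
      then have "i = 0 \<or> i = n" by auto
      then show "sqrt_coeff i * sqrt_coeff (n - i) = 0" by auto
    qed
  qed auto
  also have "\<dots> = 2 * sqrt_coeff n - (if n = 1 then 1 else 0)"
    by (subst (3) sqrt_coeff.simps) simp
  finally show ?thesis .
qed

lemma sqrt_coeff_triangle:
  "(\<Sum>(i,j)\<in>{(i,j). i + j < n}. (sqrt_coeff i * sqrt_coeff j) *\<^sub>R f (i + j)) =
    (\<Sum>k<n. (2 * sqrt_coeff k - (if k = 1 then 1 else 0)) *\<^sub>R (f k :: 'a::real_vector))"
proof -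
  have "(\<Sum>(i,j)\<in>{(i,j). i + j < n}. (sqrt_coeff i * sqrt_coeff j) *\<^sub>R f (i + j)) =
     (\<Sum>k<n. \<Sum>i\<le>k. (sqrt_coeff i * sqrt_coeff (k - i)) *\<^sub>R f (i + (k - i)))"
    by (rule sum.triangle_reindex)
  also have "\<dots> = (\<Sum>k<n. (\<Sum>i\<le>k. sqrt_coeff i * sqrt_coeff (k - i)) *\<^sub>R f k)"
    by (intro sum.cong refl) (simp add: scaleR_sum_left)
  finally show ?thesis unfolding sqrt_coeff_conv .
qed

lemma finite_triangle: "finite {(i,j). i + j < (n::nat)}"
  by (rule finite_subset[of _ "{..<n} \<times> {..<n}"]) auto

lemma sqrt_coeff_sum_le: "(\<Sum>n<N. sqrt_coeff n) \<le> 1"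
proof (induction N)
  case (Suc N)
  let ?s = "\<Sum>n<N. sqrt_coeff n"
  have s0: "0 \<le> ?s" by (intro sum_nonneg sqrt_coeff_nonneg)
  have "2 * (\<Sum>n<Suc N. sqrt_coeff n) - 1 \<le> (\<Sum>k<Suc N. 2 * sqrt_coeff k - (if k = 1 then 1 else 0))"
    by (simp add: sum_subtractf sum_distrib_left)
  also have "\<dots> = (\<Sum>(i,j)\<in>{(i,j). i + j < Suc N}. sqrt_coeff i * sqrt_coeff j)"
    using sqrt_coeff_triangle[of "\<lambda>_. 1::real" "Suc N"] by simp
  also have "\<dots> = (\<Sum>(i,j)\<in>{(i,j). i + j < Suc N} \<inter> {..<N} \<times> {..<N}. sqrt_coeff i * sqrt_coeff j)"
  proof (rule sum.mono_neutral_right[OF finite_triangle])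
    show "\<forall>p\<in>{(i,j). i + j < Suc N} - {(i,j). i + j < Suc N} \<inter> {..<N} \<times> {..<N}.
        (case p of (i, j) \<Rightarrow> sqrt_coeff i * sqrt_coeff j) = 0"
    proof
      fix p assume "p \<in> {(i,j). i + j < Suc N} - {(i,j). i + j < Suc N} \<inter> {..<N} \<times> {..<N}"
      then have "fst p = 0 \<or> snd p = 0" by (cases p) auto
      then show "(case p of (i, j) \<Rightarrow> sqrt_coeff i * sqrt_coeff j) = 0" by (cases p) auto
    qed
  qed auto
  also have "\<dots> \<le> (\<Sum>(i,j)\<in>{..<N} \<times> {..<N}. sqrt_coeff i * sqrt_coeff j)"
    by (rule sum_mono2) (auto simp: sqrt_coeff_nonneg)
  also have "\<dots> = ?s * ?s" by (simp add: sum_product sum.cartesian_product)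
  also have "\<dots> \<le> 1" using Suc s0 mult_mono[of ?s 1 ?s 1] by simp
  finally show ?case by simp
qed simp

lemma sqrt_coeff_sums: "sqrt_coeff sums 1"
proof -
  have sm: "summable sqrt_coeff"
    by (rule summableI_nonneg_bounded[where x=1]) (auto simp: sqrt_coeff_nonneg sqrt_coeff_sum_le)
  let ?s = "suminf sqrt_coeff"
  have "(\<lambda>k. \<Sum>i\<le>k. sqrt_coeff i * sqrt_coeff (k - i)) sums (?s * ?s)"
    by (rule Cauchy_product_sums) (use sm in \<open>auto simp: sqrt_coeff_nonneg\<close>)
  moreover have "(\<lambda>k. 2 * sqrt_coeff k - (if k = 1 then 1 else 0)) sums (2 * ?s - 1)"
    by (intro sums_diff sums_mult summable_sums sm sums_single)
  ultimately have "?s * ?s = 2 * ?s - 1"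
    unfolding sqrt_coeff_conv using sums_unique2 by blast
  then have "(?s - 1)\<^sup>2 = 0" by (simp add: power2_eq_square algebra_simps)
  then show ?thesis using summable_sums[OF sm] by simp
qed

lemma bclin_funpow:
  "bounded_clinear_op A \<Longrightarrow> bounded_clinear_op (A ^^ n)" for A :: "'a::complex_inner \<Rightarrow> 'a"
proof (induction n)
  case (Suc n)
  then show ?case using bclin_compose[of A "A ^^ n"] by (simp add: comp_def)
qed (simp add: bclin_id id_def)

text \<open>For a selfadjoint contraction \<open>C\<close> this is the positive square root of \<open>I - C\<close>.\<close>

definition sqrt_one_minus :: "('a::chilbert_space \<Rightarrow> 'a) \<Rightarrow> 'a \<Rightarrow> 'a" where
  "sqrt_one_minus C x = x - (\<Sum>n. sqrt_coeff n *\<^sub>R (C ^^ n) x)"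

context
  fixes C :: "'a::chilbert_space \<Rightarrow> 'a"
  assumes C: "bounded_clinear_op C" and contr: "\<And>x. norm (C x) \<le> norm x"
begin

lemma norm_funpow_le: "norm ((C ^^ n) x) \<le> norm x"
  by (induction n) (auto intro: order_trans[OF contr])

lemma sqrt_series_summable: "summable (\<lambda>n. sqrt_coeff n *\<^sub>R (C ^^ n) x)"
proof (rule summable_comparison_test)
  show "\<exists>N. \<forall>n\<ge>N. norm (sqrt_coeff n *\<^sub>R (C ^^ n) x) \<le> sqrt_coeff n * norm x"
    by (intro exI[of _ 0] allI impI) (simp add: sqrt_coeff_nonneg mult_left_mono norm_funpow_le)
  show "summable (\<lambda>n. sqrt_coeff n * norm x)"
    using sqrt_coeff_sums by (intro summable_mult2) (rule sums_summable)
qed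

lemma sqrt_series_sums: "(\<lambda>n. sqrt_coeff n *\<^sub>R (C ^^ n) x) sums (x - sqrt_one_minus C x)"
  using summable_sums[OF sqrt_series_summable[of x]] by (simp add: sqrt_one_minus_def)

lemma sqrt_partial_norm_le: "norm (\<Sum>n<N. sqrt_coeff n *\<^sub>R (C ^^ n) x) \<le> norm x"
proof -
  have "norm (\<Sum>n<N. sqrt_coeff n *\<^sub>R (C ^^ n) x) \<le> (\<Sum>n<N. sqrt_coeff n * norm x)"
    by (rule sum_norm_le) (simp add: sqrt_coeff_nonneg mult_left_mono norm_funpow_le)
  also have "\<dots> \<le> norm x"
    using mult_right_mono[OF sqrt_coeff_sum_le[of N] norm_ge_zero[of x]]
    by (simp add: sum_distrib_right)
  finally show ?thesis .
qed

lemma sqrt_series_norm_le: "norm (x - sqrt_one_minus C x) \<le> norm x"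
proof (rule LIMSEQ_le_const2)
  show "(\<lambda>N. norm (\<Sum>n<N. sqrt_coeff n *\<^sub>R (C ^^ n) x)) \<longlonglongrightarrow> norm (x - sqrt_one_minus C x)"
    using sqrt_series_sums by (intro tendsto_norm) (simp add: sums_def)
qed (simp add: sqrt_partial_norm_le)

lemma bclin_sqrt_one_minus: "bounded_clinear_op (sqrt_one_minus C)"
proof -
  define Y where "Y x = x - sqrt_one_minus C x" for x
  note Cn = bclin_funpow[OF C]
  have Y: "(\<lambda>n. sqrt_coeff n *\<^sub>R (C ^^ n) x) sums Y x" for x
    unfolding Y_def by (rule sqrt_series_sums)
  have "bounded_clinear_op Y"
  proof (rule bclinI[where K=1])
    show "Y (x + y) = Y x + Y y" for x y
      using sums_unique2[OF Y[of "x + y"]] sums_add[OF Y[of x] Y[of y]]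
      by (simp add: bclinD(1)[OF Cn] scaleR_add_right)
    show "Y (c *\<^sub>C x) = c *\<^sub>C Y x" for c x
    proof -
      have "(\<lambda>n. c *\<^sub>C (sqrt_coeff n *\<^sub>R (C ^^ n) x)) sums (c *\<^sub>C Y x)"
        by (rule bounded_linear.sums[OF bclin_bounded_linear[OF
              bclin_scaleC[OF bclin_id]] Y])
      then show ?thesis
        using sums_unique2[OF Y[of "c *\<^sub>C x"]]
        by (simp add: bclinD(2)[OF Cn] scaleR_scaleC scaleC_scaleC mult.commute)
    qed
    show "norm (Y x) \<le> 1 * norm x" for x
      using sqrt_series_norm_le[of x] by (simp add: Y_def)
  qed
  from bclin_minus[OF bclin_id this] show ?thesis
    by (simp add: Y_def)
qed

lemma sqrt_one_minus_square: "sqrt_one_minus C (sqrt_one_minus C x) = x - C x"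
proof -
  define Y where "Y x = x - sqrt_one_minus C x" for x
  define P where "P N x = (\<Sum>n<N. sqrt_coeff n *\<^sub>R (C ^^ n) x)" for N x
  note Cn = bclin_funpow[OF C]
  have lin: "bounded_clinear_op (P N)" for N
    unfolding P_def scaleR_scaleC
    by (intro bclin_sum_fun bclin_scaleC Cn)
  have PY: "(\<lambda>N. P N x) \<longlonglongrightarrow> Y x" for x
    using sqrt_series_sums unfolding P_def Y_def sums_def .
  have PN: "norm (P N x) \<le> norm x" for N x
    unfolding P_def by (rule sqrt_partial_norm_le)
  have "(\<lambda>N. P N (P N x - Y x)) \<longlonglongrightarrow> 0"
  proof (rule Lim_null_comparison)
    show "\<forall>\<^sub>F N in sequentially. norm (P N (P N x - Y x)) \<le> norm (P N x - Y x)"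
      by (simp add: PN)
    show "(\<lambda>N. norm (P N x - Y x)) \<longlonglongrightarrow> 0"
      using PY LIM_zero tendsto_norm_zero by blast
  qed
  from tendsto_add[OF this PY[of "Y x"]]
  have lim1: "(\<lambda>N. P N (P N x)) \<longlonglongrightarrow> Y (Y x)"
    by (simp add: bclin_diff[OF lin])
  have est: "norm (P N (P N x) - (2 *\<^sub>R P N x - C x)) \<le> (1 - (\<Sum>n<N. sqrt_coeff n))\<^sup>2 * norm x"
    if N: "N \<ge> 2" for N
  proof -
    let ?T = "{(i,j). i + j < N}" and ?Q = "{..<N} \<times> {..<N}"
    let ?f = "\<lambda>(i,j). (sqrt_coeff i * sqrt_coeff j) *\<^sub>R (C ^^ (i + j)) x"
    let ?g = "\<lambda>(i,j). sqrt_coeff i * sqrt_coeff j"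
    have sub: "?T \<subseteq> ?Q" by auto
    have "P N (P N x) = (\<Sum>i<N. \<Sum>j<N. (sqrt_coeff i * sqrt_coeff j) *\<^sub>R (C ^^ (i + j)) x)"
      unfolding P_def
      by (simp add: bclin_sum[OF Cn] scaleR_sum_right funpow_add
          bclinD(2)[OF Cn] scaleR_scaleC scaleC_scaleC scaleC_sum_right)
    also have "\<dots> = sum ?f ?Q" by (simp add: sum.cartesian_product)
    finally have 1: "P N (P N x) = sum ?f ?Q" .
    have single: "(\<Sum>k<N. (if k = 1 then 1 else 0) *\<^sub>R h k) = h 1" for h :: "nat \<Rightarrow> 'b::real_vector"
    proof -
      have "(\<Sum>k<N. (if k = 1 then 1 else 0) *\<^sub>R h k) = (\<Sum>k\<in>{1}. (if k = 1 then 1 else 0) *\<^sub>R h k)"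
        by (rule sum.mono_neutral_right) (use N in auto)
      then show ?thesis by simp
    qed
    have 2: "2 *\<^sub>R P N x - C x = sum ?f ?T"
      unfolding sqrt_coeff_triangle[of "\<lambda>k. (C ^^ k) x"] P_def
      by (simp add: scaleR_diff_left sum_subtractf single[unfolded One_nat_def] scaleR_sum_right)
    have 3: "2 * (\<Sum>n<N. sqrt_coeff n) - 1 = sum ?g ?T"
      using sqrt_coeff_triangle[of "\<lambda>_. 1::real" N] single[of "\<lambda>_. 1::real"]
      by (simp add: sum_subtractf sum_distrib_left)
    have 4: "(\<Sum>n<N. sqrt_coeff n)\<^sup>2 = sum ?g ?Q"
      by (simp add: sum_product sum.cartesian_product power2_eq_square)
    have "norm (P N (P N x) - (2 *\<^sub>R P N x - C x)) = norm (sum ?f (?Q - ?T))"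
      unfolding 1 2 by (subst sum_diff[OF _ sub]) auto
    also have "\<dots> \<le> (\<Sum>p\<in>?Q - ?T. ?g p * norm x)"
    proof (rule sum_norm_le)
      fix p assume "p \<in> ?Q - ?T"
      show "norm (?f p) \<le> ?g p * norm x"
        by (cases p) (simp add: sqrt_coeff_nonneg mult_left_mono norm_funpow_le)
    qed
    also have "\<dots> = (sum ?g ?Q - sum ?g ?T) * norm x"
      by (subst sum_diff[OF _ sub, symmetric]) (auto simp: sum_distrib_right)
    also have "\<dots> = (1 - (\<Sum>n<N. sqrt_coeff n))\<^sup>2 * norm x"
      unfolding 3[symmetric] 4[symmetric] by (simp add: power2_eq_square algebra_simps)
    finally show ?thesis .
  qed
  have "(\<lambda>N. P N (P N x) - (2 *\<^sub>R P N x - C x)) \<longlonglongrightarrow> 0"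
  proof (rule Lim_null_comparison)
    show "\<forall>\<^sub>F N in sequentially. norm (P N (P N x) - (2 *\<^sub>R P N x - C x)) \<le> (1 - (\<Sum>n<N. sqrt_coeff n))\<^sup>2 * norm x"
      using est eventually_ge_at_top[of 2] by (rule eventually_mono[rotated])
    have "(\<lambda>N. (1 - (\<Sum>n<N. sqrt_coeff n))\<^sup>2 * norm x) \<longlonglongrightarrow> (1 - 1)\<^sup>2 * norm x"
      using sqrt_coeff_sums by (intro tendsto_intros) (simp add: sums_def)
    then show "(\<lambda>N. (1 - (\<Sum>n<N. sqrt_coeff n))\<^sup>2 * norm x) \<longlonglongrightarrow> 0" by simp
  qed
  moreover have "(\<lambda>N. P N (P N x) - (2 *\<^sub>R P N x - C x)) \<longlonglongrightarrow> Y (Y x) - (2 *\<^sub>R Y x - C x)"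
    by (intro tendsto_intros lim1 PY)
  ultimately have "Y (Y x) = 2 *\<^sub>R Y x - C x"
    using LIMSEQ_unique by fastforce
  then show ?thesis
    by (simp add: Y_def bclin_diff[OF bclin_sqrt_one_minus] scaleR_2 algebra_simps)
qed

lemma sqrt_one_minus_selfadjoint:
  assumes sa: "\<And>x y. cinner (C x) y = cinner x (C y)"
  shows "cinner (sqrt_one_minus C x) y = cinner x (sqrt_one_minus C y)"
proof -
  have "cinner ((C ^^ n) x) y = cinner x ((C ^^ n) y)" for n
    by (induction n arbitrary: x y) (auto simp: sa funpow_swap1)
  then have eq: "cinner (sqrt_coeff n *\<^sub>R (C ^^ n) x) y = cinner x (sqrt_coeff n *\<^sub>R (C ^^ n) y)" for n
    by (simp add: scaleR_scaleC cinner_scaleC_left cinner_scaleC_right)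
  have "(\<lambda>n. cinner (sqrt_coeff n *\<^sub>R (C ^^ n) x) y) sums cinner (x - sqrt_one_minus C x) y"
    by (rule bounded_linear.sums[OF bounded_bilinear.bounded_linear_left[OF bounded_bilinear_cinner] sqrt_series_sums])
  moreover have "(\<lambda>n. cinner x (sqrt_coeff n *\<^sub>R (C ^^ n) y)) sums cinner x (y - sqrt_one_minus C y)"
    by (rule bounded_linear.sums[OF bounded_bilinear.bounded_linear_right[OF bounded_bilinear_cinner] sqrt_series_sums])
  ultimately have "cinner (x - sqrt_one_minus C x) y = cinner x (y - sqrt_one_minus C y)"
    unfolding eq by (rule sums_unique2)
  then show ?thesis by (simp add: cinner_diff_left cinner_diff_right)
qed

lemma sqrt_one_minus_nonneg: "0 \<le> Re (cinner (sqrt_one_minus C x) x)"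
proof -
  have "norm (x - sqrt_one_minus C x) * norm x \<le> norm x * norm x"
    by (intro mult_right_mono sqrt_series_norm_le) simp
  moreover have "Re (cinner (x - sqrt_one_minus C x) x) \<le> norm (x - sqrt_one_minus C x) * norm x"
    using Cauchy_Schwarz_cinner complex_Re_le_cmod order_trans by blast
  moreover have "Re (cinner x x) = norm x * norm x"
    using norm_sq_cinner[of x] by (simp add: power2_eq_square)
  ultimately show ?thesis by (simp add: cinner_diff_left)
qed

lemma sqrt_one_minus_invariant:
  assumes L: "closed_csubspace L" and inv: "\<And>x. x \<in> L \<Longrightarrow> C x \<in> L" and x: "x \<in> L"
  shows "sqrt_one_minus C x \<in> L"
proof -
  note S = closed_csubspaceD(1)[OF L]
  have "(C ^^ n) x \<in> L" for n by (induction n) (auto simp: x inv)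
  then have "(\<Sum>n<N. sqrt_coeff n *\<^sub>R (C ^^ n) x) \<in> L" for N
    by (intro csubspace_sum S) (simp add: scaleR_scaleC csubspaceD(3)[OF S])
  then have "x - sqrt_one_minus C x \<in> L"
    using closed_sequentially[OF closed_csubspaceD(2)[OF L] _ sqrt_series_sums[of x, unfolded sums_def]]
    by blast
  from csubspace_diff[OF S x this] show ?thesis by simp
qed

end

lemma sqrt_one_minus_intertwine:
  assumes C: "bounded_clinear_op C" "\<And>x. norm (C x) \<le> norm x"
    and C': "bounded_clinear_op C'" "\<And>x. norm (C' x) \<le> norm x"
    and A: "bounded_clinear_op A" and AC: "\<And>x. A (C x) = C' (A x)"
  shows "A (sqrt_one_minus C x) = sqrt_one_minus C' (A x)"
proof -
  have "A ((C ^^ n) x) = (C' ^^ n) (A x)" for n by (induction n) (auto simp: AC)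
  then have eq: "A (sqrt_coeff n *\<^sub>R (C ^^ n) x) = sqrt_coeff n *\<^sub>R (C' ^^ n) (A x)" for n
    by (simp add: scaleR_scaleC bclinD(2)[OF A])
  have "(\<lambda>n. A (sqrt_coeff n *\<^sub>R (C ^^ n) x)) sums A (x - sqrt_one_minus C x)"
    by (rule bounded_linear.sums[OF bclin_bounded_linear[OF A] sqrt_series_sums[OF C]])
  from sums_unique2[OF this[unfolded eq] sqrt_series_sums[OF C']]
  show ?thesis by (simp add: bclin_diff[OF A])
qed

section \<open>Reproducing kernel spaces from features\<close>

context
  fixes \<Omega> :: "'x set" and K :: "'x \<Rightarrow> 'x \<Rightarrow> 'v \<Rightarrow> 'v::complex_inner"
    and \<gamma> :: "'x \<Rightarrow> 'v \<Rightarrow> 'a::chilbert_space" and ev :: "'a \<Rightarrow> 'x \<Rightarrow> 'v" and X :: "'a set"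
  assumes X: "closed_csubspace X"
    and feat: "\<And>z y. z \<in> \<Omega> \<Longrightarrow> \<gamma> z y \<in> X"
    and ev: "\<And>x z y. z \<in> \<Omega> \<Longrightarrow> x \<in> X \<Longrightarrow> cinner (ev x z) y = cinner x (\<gamma> z y)"
    and ev_off: "\<And>x z. z \<notin> \<Omega> \<Longrightarrow> ev x z = 0"
    and tot: "\<And>x. x \<in> X \<Longrightarrow> (\<And>z y. z \<in> \<Omega> \<Longrightarrow> cinner x (\<gamma> z y) = 0) \<Longrightarrow> x = 0"
    and kern: "\<And>z w y y'. z \<in> \<Omega> \<Longrightarrow> w \<in> \<Omega> \<Longrightarrow> cinner (K z w y) y' = cinner (\<gamma> w y) (\<gamma> z y')"
begin

lemma feature_scale:
  assumes z: "z \<in> \<Omega>" shows "\<gamma> z (c *\<^sub>C y) = c *\<^sub>C \<gamma> z y"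
proof -
  let ?d = "\<gamma> z (c *\<^sub>C y) - c *\<^sub>C \<gamma> z y"
  have d: "?d \<in> X"
    using feat[OF z] closed_csubspaceD(1)[OF X] by (simp add: csubspace_diff csubspaceD)
  have "cinner ?d ?d = 0"
    using ev[OF z d, of "c *\<^sub>C y"] ev[OF z d, of y]
    by (simp add: cinner_diff_right cinner_scaleC_right)
  then show ?thesis by (simp add: cinner_eq_zero_iff)
qed

lemma ev_inj:
  assumes "x \<in> X" "x' \<in> X" "ev x = ev x'" shows "x = x'"
proof -
  have "x - x' = 0"
  proof (rule tot)
    show "cinner (x - x') (\<gamma> z y) = 0" if "z \<in> \<Omega>" for z y
      using ev[OF that assms(1), of y] ev[OF that assms(2), of y] assms(3) by (simp add: cinner_diff_left)
  qed (use assms csubspace_diff[OF closed_csubspaceD(1)[OF X]] in auto)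
  then show ?thesis by simp
qed

lemma ev_linear:
  assumes "x \<in> X" "x' \<in> X"
  shows "ev (x + x') = ev x + ev x'" "ev (c *\<^sub>C x) = fscale c (ev x)"
proof -
  note S = csubspaceD[OF closed_csubspaceD(1)[OF X]]
  show "ev (x + x') = ev x + ev x'"
  proof
    fix z
    show "ev (x + x') z = (ev x + ev x') z"
    proof (cases "z \<in> \<Omega>")
      case True
      show ?thesis
        by (rule cinner_extI) (simp add: ev True assms S cinner_add_left)
    qed (simp add: ev_off)
  qed
  show "ev (c *\<^sub>C x) = fscale c (ev x)"
  proof
    fix z
    show "ev (c *\<^sub>C x) z = fscale c (ev x) z"
    proof (cases "z \<in> \<Omega>")
      case True
      show ?thesis
        by (rule cinner_extI) (simp add: ev True assms S cinner_scaleC_left fscale_def)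
    qed (simp add: ev_off fscale_def)
  qed
qed

lemma gram_family:
  assumes "\<forall>i<(n::nat). zs i \<in> \<Omega>"
  shows "Re (\<Sum>i<n. \<Sum>j<n. cinner (K (zs i) (zs j) (ys j)) (ys i)) = (norm (\<Sum>i<n. \<gamma> (zs i) (ys i)))\<^sup>2"
proof -
  have "(\<Sum>i<n. \<Sum>j<n. cinner (K (zs i) (zs j) (ys j)) (ys i)) =
      (\<Sum>i<n. \<Sum>j<n. cinner (\<gamma> (zs j) (ys j)) (\<gamma> (zs i) (ys i)))"
    using assms by (intro sum.cong refl) (auto simp: kern)
  also have "\<dots> = cinner (\<Sum>i<n. \<gamma> (zs i) (ys i)) (\<Sum>i<n. \<gamma> (zs i) (ys i))"
    by (simp add: cinner_sum_left cinner_sum_right)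
  finally show ?thesis by (simp add: norm_sq_cinner)
qed

lemma rk_norm_ev_le:
  assumes x: "x \<in> X" shows "rk_norm \<Omega> K (ev x) \<le> ereal (norm x)"
  unfolding rk_norm_def
proof (rule SUP_least, clarify)
  fix n :: nat and zs ys
  assume zs: "\<forall>i<n. zs i \<in> \<Omega>" and le: "Re (\<Sum>i<n. \<Sum>j<n. cinner (K (zs i) (zs j) (ys j)) (ys i)) \<le> 1"
  let ?p = "\<Sum>i<n. \<gamma> (zs i) (ys i)"
  have "(norm ?p)\<^sup>2 \<le> 1" using le unfolding gram_family[OF zs] .
  then have p: "norm ?p \<le> 1" by (simp add: power_le_one_iff)
  have "(\<Sum>i<n. cinner (ev x (zs i)) (ys i)) = cinner x ?p"
    using zs x by (simp add: ev cinner_sum_right)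
  also have "cmod \<dots> \<le> norm x * norm ?p" by (rule Cauchy_Schwarz_cinner)
  also have "\<dots> \<le> norm x" using mult_left_mono[OF p norm_ge_zero[of x]] by simp
  finally show "ereal (cmod (\<Sum>i<n. cinner (ev x (zs i)) (ys i))) \<le> ereal (norm x)" by simp
qed

lemma sum_lessThan_concat:
  "(\<Sum>i<n + m. f (if i < n then a i else a' (i - n)) (if i < n then b i else b' (i - n))) =
    (\<Sum>i<n. f (a i) (b i)) + (\<Sum>i<m. f (a' i) (b' i) :: 'c::comm_monoid_add)" for n m :: nat
  by (induction m) (auto simp: add.assoc[symmetric])

lemma rk_norm_le_imp_ev:
  assumes off: "\<And>z. z \<notin> \<Omega> \<Longrightarrow> f z = 0" and bd: "rk_norm \<Omega> K f \<le> ereal M"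
  shows "\<exists>x\<in>X. ev x = f \<and> norm x \<le> M"
proof -
  define R where "R = {(\<Sum>i<n. \<gamma> (zs i) (ys i), cnj (\<Sum>i<n. cinner (f (zs i)) (ys i))) | n zs ys.
     \<forall>i<(n::nat). zs i \<in> \<Omega>}"
  have RI: "(\<Sum>i<n. \<gamma> (zs i) (ys i), cnj (\<Sum>i<n. cinner (f (zs i)) (ys i))) \<in> R"
    if "\<forall>i<n. zs i \<in> \<Omega>" for n :: nat and zs ys
    using that unfolding R_def by blast
  have fam: "cmod (\<Sum>i<n. cinner (f (zs i)) (ys i)) \<le> M"
    if "\<forall>i<n. zs i \<in> \<Omega>" "norm (\<Sum>i<n. \<gamma> (zs i) (ys i)) \<le> 1" for n :: nat and zs ys
  proof -
    have "Re (\<Sum>i<n. \<Sum>j<n. cinner (K (zs i) (zs j) (ys j)) (ys i)) \<le> 1"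
      unfolding gram_family[OF that(1)] using that(2) by (simp add: power_le_one)
    then have "ereal (cmod (\<Sum>i<n. cinner (f (zs i)) (ys i))) \<le> rk_norm \<Omega> K f"
      unfolding rk_norm_def using that(1)
      by (intro SUP_upper2[where i="(n, zs, ys)"]) auto
    then show ?thesis using bd order_trans by fastforce
  qed
  have M0: "0 \<le> M" using fam[of 0] by simp
  have scaled: "cmod c * cmod (\<Sum>i<n. cinner (f (zs i)) (ys i)) \<le> M"
    if "\<forall>i<n. zs i \<in> \<Omega>" "cmod c * norm (\<Sum>i<n. \<gamma> (zs i) (ys i)) \<le> 1" for n :: nat and zs ys c
  proof -
    have "(\<Sum>i<n. \<gamma> (zs i) (c *\<^sub>C ys i)) = c *\<^sub>C (\<Sum>i<n. \<gamma> (zs i) (ys i))"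
      using that(1) by (simp add: feature_scale scaleC_sum_right)
    then have "cmod (\<Sum>i<n. cinner (f (zs i)) (c *\<^sub>C ys i)) \<le> M"
      using that by (intro fam) (auto simp: norm_scaleC)
    then show ?thesis by (simp add: cinner_scaleC_right sum_distrib_left[symmetric] norm_mult)
  qed
  have R_bd: "cmod a \<le> M * norm p" if pa: "(p, a) \<in> R" for p a
  proof -
    obtain n :: nat and zs ys where zs: "\<forall>i<n. zs i \<in> \<Omega>" and p: "p = (\<Sum>i<n. \<gamma> (zs i) (ys i))"
      and a: "a = cnj (\<Sum>i<n. cinner (f (zs i)) (ys i))"
      using pa unfolding R_def by blast
    have ca: "cmod c * cmod a \<le> M" if "cmod c * norm p \<le> 1" for c
      unfolding a complex_mod_cnj using scaled[OF zs, of c ys] that p by simp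
    show ?thesis
    proof (cases "p = 0")
      case True
      have "cmod a = 0"
      proof (rule ccontr)
        assume "cmod a \<noteq> 0"
        then show False
          using ca[of "complex_of_real ((M + 1) / cmod a)"] True M0 by (simp add: norm_divide)
      qed
      then show ?thesis using M0 by simp
    next
      case False
      then show ?thesis
        using ca[of "complex_of_real (1 / norm p)"] by (simp add: norm_divide field_simps)
    qed
  qed
  have R_add: "(p + q, a + b) \<in> R" if pa: "(p, a) \<in> R" and qb: "(q, b) \<in> R" for p q a b
  proof -
    obtain n :: nat and zs ys where 1: "\<forall>i<n. zs i \<in> \<Omega>" "p = (\<Sum>i<n. \<gamma> (zs i) (ys i))"
      "a = cnj (\<Sum>i<n. cinner (f (zs i)) (ys i))"
      using pa unfolding R_def by blast
    obtain m :: nat and zs' ys' where 2: "\<forall>i<m. zs' i \<in> \<Omega>" "q = (\<Sum>i<m. \<gamma> (zs' i) (ys' i))"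
      "b = cnj (\<Sum>i<m. cinner (f (zs' i)) (ys' i))"
      using qb unfolding R_def by blast
    let ?z = "\<lambda>i. if i < n then zs i else zs' (i - n)" and ?y = "\<lambda>i. if i < n then ys i else ys' (i - n)"
    have "p + q = (\<Sum>i<n + m. \<gamma> (?z i) (?y i))"
      unfolding 1 2 by (rule sum_lessThan_concat[symmetric])
    moreover have "a + b = cnj (\<Sum>i<n + m. cinner (f (?z i)) (?y i))"
      unfolding 1 2 sum_lessThan_concat[of "\<lambda>z y. cinner (f z) y"] by simp
    moreover have "\<forall>i<n + m. ?z i \<in> \<Omega>" using 1 2 by auto
    ultimately show ?thesis using RI[of "n + m" ?z ?y] by simp
  qed
  have R_scale: "(c *\<^sub>C p, c * a) \<in> R" if pa: "(p, a) \<in> R" for p a c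
  proof -
    obtain n :: nat and zs ys where 1: "\<forall>i<n. zs i \<in> \<Omega>" "p = (\<Sum>i<n. \<gamma> (zs i) (ys i))"
      "a = cnj (\<Sum>i<n. cinner (f (zs i)) (ys i))"
      using pa unfolding R_def by blast
    have "c *\<^sub>C p = (\<Sum>i<n. \<gamma> (zs i) (c *\<^sub>C ys i))"
      using 1 by (simp add: feature_scale scaleC_sum_right)
    moreover have "c * a = cnj (\<Sum>i<n. cinner (f (zs i)) (c *\<^sub>C ys i))"
      by (simp add: 1 cinner_scaleC_right sum_distrib_left[symmetric])
    ultimately show ?thesis using RI[OF 1(1), of "\<lambda>i. c *\<^sub>C ys i"] by simp
  qed
  have R_0: "(0, 0) \<in> R" using RI[of 0] by simp
  have uniq: "a = b" if "(p, a) \<in> R" "(p, b) \<in> R" for p a b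
    using R_bd[OF R_add[OF that(1) R_scale[OF that(2), of "-1"]]] by (simp add: scaleC_minus_one)
  define F where "F p = (THE a. (p, a) \<in> R)" for p
  have F_eq: "F p = a" if "(p, a) \<in> R" for p a
    unfolding F_def using that uniq by blast
  define L where "L = fst ` R"
  have LI: "p \<in> L" if "(p, a) \<in> R" for p a using that unfolding L_def by force
  have L_in: "(p, F p) \<in> R" if "p \<in> L" for p using that F_eq unfolding L_def by force
  have "\<exists>x\<in>closure L. \<forall>q\<in>L. cinner q x = F q"
  proof (rule riesz_subspace[where M=M])
    show "csubspace L"
      unfolding csubspace_def using LI[OF R_0] LI[OF R_add[OF L_in L_in]] LI[OF R_scale[OF L_in]] by blast
    show "F (p + q) = F p + F q" if "p \<in> L" "q \<in> L" for p q
      using F_eq R_add[OF L_in[OF that(1)] L_in[OF that(2)]] by blast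
    show "F (c *\<^sub>C q) = c * F q" if "q \<in> L" for c q
      using F_eq R_scale[OF L_in[OF that(1)]] by blast
    show "cmod (F q) \<le> M * norm q" if "q \<in> L" for q using R_bd[OF L_in[OF that]] .
  qed
  then obtain x where x: "x \<in> closure L" "\<And>q. q \<in> L \<Longrightarrow> cinner q x = F q" by blast
  have LX: "L \<subseteq> X"
    unfolding L_def R_def using feat by (auto intro!: csubspace_sum[OF closed_csubspaceD(1)[OF X]])
  have xX: "x \<in> X" using x(1) LX closed_csubspaceD(2)[OF X] closure_minimal by blast
  have "ev x z = f z" for z
  proof (cases "z \<in> \<Omega>")
    case True
    show ?thesis
    proof (rule cinner_extI)
      fix y
      have "(\<gamma> z y, cnj (cinner (f z) y)) \<in> R"
        using RI[of 1 "\<lambda>_. z" "\<lambda>_. y"] True by simp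
      then have "cinner (\<gamma> z y) x = cnj (cinner (f z) y)"
        using x(2)[OF LI] F_eq by metis
      then show "cinner (ev x z) y = cinner (f z) y"
        unfolding ev[OF True xX] by (metis cinner_commute complex_cnj_cnj)
    qed
  qed (simp add: off ev_off)
  moreover have "norm x \<le> M"
  proof -
    obtain q where q: "\<And>n. q n \<in> L" "q \<longlonglongrightarrow> x" using x(1) closure_sequential by blast
    have "cmod (cinner x x) \<le> M * norm x"
    proof (rule LIMSEQ_le)
      show "(\<lambda>n. cmod (cinner (q n) x)) \<longlonglongrightarrow> cmod (cinner x x)"
        by (intro tendsto_norm tendsto_cinner q tendsto_const)
      show "(\<lambda>n. M * norm (q n)) \<longlonglongrightarrow> M * norm x" by (intro tendsto_intros q)
      show "\<exists>N. \<forall>n\<ge>N. cmod (cinner (q n) x) \<le> M * norm (q n)"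
        using R_bd[OF L_in[OF q(1)]] x(2)[OF q(1)] by auto
    qed
    then have "norm x * norm x \<le> M * norm x" by (simp add: cinner_self power2_eq_square norm_mult)
    then show ?thesis using M0 by (cases "norm x = 0") (auto simp: mult_le_cancel_right)
  qed
  ultimately show ?thesis using xX by (intro bexI[of _ x]) auto
qed

lemma rk_norm_ev: "x \<in> X \<Longrightarrow> rk_norm \<Omega> K (ev x) = ereal (norm x)"
proof (rule antisym)
  assume x: "x \<in> X"
  then show le: "rk_norm \<Omega> K (ev x) \<le> ereal (norm x)" by (rule rk_norm_ev_le)
  have "0 \<le> rk_norm \<Omega> K (ev x)"
    unfolding rk_norm_def by (rule SUP_upper2[where i="(0, undefined, undefined)"]) auto
  then obtain M where M: "rk_norm \<Omega> K (ev x) = ereal M"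
    using le by (cases "rk_norm \<Omega> K (ev x)") auto
  then obtain x' where "x' \<in> X" "ev x' = ev x" "norm x' \<le> M"
    using rk_norm_le_imp_ev[of "ev x" M] ev_off by auto
  then show "ereal (norm x) \<le> rk_norm \<Omega> K (ev x)" using ev_inj[of x' x] x M by simp
qed

lemma rkhs_eq_ev: "rkhs \<Omega> K = ev ` X"
proof (intro equalityI subsetI)
  fix f assume f: "f \<in> rkhs \<Omega> K"
  then have lt: "rk_norm \<Omega> K f < \<infinity>" and off: "\<And>z. z \<notin> \<Omega> \<Longrightarrow> f z = 0" by (auto simp: rkhs_def)
  obtain M where "rk_norm \<Omega> K f \<le> ereal M"
    using lt by (cases "rk_norm \<Omega> K f") auto
  then show "f \<in> ev ` X" using rk_norm_le_imp_ev[of f M] off by blast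
next
  fix f assume "f \<in> ev ` X"
  then show "f \<in> rkhs \<Omega> K" by (auto simp: rkhs_def ev_off rk_norm_ev)
qed

lemma rk_nrm_ev: "x \<in> X \<Longrightarrow> rk_nrm \<Omega> K (ev x) = norm x"
  by (simp add: rk_nrm_def rk_norm_ev)

lemma rk_inner_ev:
  assumes x: "x \<in> X" and y: "y \<in> X" shows "rk_inner \<Omega> K (ev x) (ev y) = cinner x y"
proof -
  note S = csubspaceD[OF closed_csubspaceD(1)[OF X]]
  have "rk_nrm \<Omega> K (ev x + fscale c (ev y)) = norm (x + c *\<^sub>C y)" for c
  proof -
    have "ev x + fscale c (ev y) = ev (x + c *\<^sub>C y)"
      using x y S by (simp add: ev_linear)
    then show ?thesis using x y S by (simp add: rk_nrm_ev)
  qed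
  then have "rk_inner \<Omega> K (ev x) (ev y) =
     (\<Sum>k<4. \<i> ^ k * complex_of_real ((norm (x + (\<i> ^ k) *\<^sub>C y))\<^sup>2)) / 4"
    by (simp add: rk_inner_def)
  also have "\<dots> = cinner x y"
  proof -
    have 4: "{..<4::nat} = {0, 1, 2, 3}" by auto
    have i3: "\<i> ^ 3 = - \<i>" by (simp add: eval_nat_numeral)
    show ?thesis
      unfolding 4 by (simp add: i3 norm_add_sq norm_scaleC cinner_scaleC_right complex_eq_iff)
  qed
  finally show ?thesis .
qed

end

section \<open>Square summable families\<close>

typedef (overloaded) ('i, 'a::complex_inner) ell2 = "{x :: 'i \<Rightarrow> 'a. (\<lambda>i. (norm (x i))\<^sup>2) summable_on UNIV}"
  morphisms ell2_nth Abs_ell2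
  by (rule exI[of _ "\<lambda>_. 0"]) simp

setup_lifting type_definition_ell2

lemma norm_add_sq_le: "(norm (x + y))\<^sup>2 \<le> 2 * (norm x)\<^sup>2 + 2 * (norm (y::'a::real_normed_vector))\<^sup>2"
proof -
  have "(norm (x + y))\<^sup>2 \<le> (norm x + norm y)\<^sup>2" by (intro power_mono norm_triangle_ineq) auto
  also have "\<dots> \<le> 2 * (norm x)\<^sup>2 + 2 * (norm y)\<^sup>2"
    using zero_le_power2[of "norm x - norm y"] by (simp add: power2_eq_square algebra_simps)
  finally show ?thesis .
qed

lemma sq_summable_add:
  assumes "(\<lambda>i. (norm (x i))\<^sup>2) summable_on UNIV" "(\<lambda>i. (norm (y i))\<^sup>2) summable_on UNIV"
  shows "(\<lambda>i. (norm (x i + y i :: 'a::real_normed_vector))\<^sup>2) summable_on UNIV"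
proof (rule summable_on_comparison_test)
  show "(\<lambda>i. 2 * (norm (x i))\<^sup>2 + 2 * (norm (y i))\<^sup>2) summable_on UNIV"
    by (intro summable_on_add summable_on_cmult_right assms)
qed (auto simp: norm_add_sq_le)

lemma sq_summable_scaleC:
  assumes "(\<lambda>i. (norm (x i))\<^sup>2) summable_on UNIV"
  shows "(\<lambda>i. (norm (c *\<^sub>C (x i :: 'a::complex_inner)))\<^sup>2) summable_on UNIV"
  using summable_on_cmult_right[OF assms, of "(cmod c)\<^sup>2"] by (simp add: norm_scaleC power_mult_distrib)

lemma sq_summable_cinner:
  assumes "(\<lambda>i. (norm (x i))\<^sup>2) summable_on UNIV" "(\<lambda>i. (norm (y i))\<^sup>2) summable_on UNIV"
  shows "(\<lambda>i. cinner (x i) (y i)) summable_on UNIV"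
proof (rule abs_summable_summable, rule summable_on_comparison_test)
  show "(\<lambda>i. (norm (x i))\<^sup>2 + (norm (y i))\<^sup>2) summable_on UNIV"
    by (intro summable_on_add assms)
  fix i
  have "2 * (norm (x i) * norm (y i)) \<le> (norm (x i))\<^sup>2 + (norm (y i))\<^sup>2"
    using zero_le_power2[of "norm (x i) - norm (y i)"] by (simp add: power2_eq_square algebra_simps)
  moreover have "0 \<le> norm (x i) * norm (y i)" by simp
  ultimately have "norm (x i) * norm (y i) \<le> (norm (x i))\<^sup>2 + (norm (y i))\<^sup>2" by linarith
  then show "norm (cinner (x i) (y i)) \<le> (norm (x i))\<^sup>2 + (norm (y i))\<^sup>2"
    using Cauchy_Schwarz_cinner[of "x i" "y i"] by linarith
qed auto

instantiation ell2 :: (type, complex_inner) complex_vector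
begin

lift_definition zero_ell2 :: "('a, 'b) ell2" is "\<lambda>_. 0" by simp

lift_definition plus_ell2 :: "('a, 'b) ell2 \<Rightarrow> ('a, 'b) ell2 \<Rightarrow> ('a, 'b) ell2" is "\<lambda>x y i. x i + y i"
  by (simp add: sq_summable_add)

lift_definition uminus_ell2 :: "('a, 'b) ell2 \<Rightarrow> ('a, 'b) ell2" is "\<lambda>x i. - x i" by simp

lift_definition minus_ell2 :: "('a, 'b) ell2 \<Rightarrow> ('a, 'b) ell2 \<Rightarrow> ('a, 'b) ell2" is "\<lambda>x y i. x i - y i"
  using sq_summable_add[where y="\<lambda>i. - y i" for y] by fastforce

lift_definition scaleC_ell2 :: "complex \<Rightarrow> ('a, 'b) ell2 \<Rightarrow> ('a, 'b) ell2" is "\<lambda>c x i. c *\<^sub>C x i"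
  by (simp add: sq_summable_scaleC)

definition scaleR_ell2 :: "real \<Rightarrow> ('a, 'b) ell2 \<Rightarrow> ('a, 'b) ell2" where
  "scaleR_ell2 r x = complex_of_real r *\<^sub>C x"

lemma ell2_eqI: "(\<And>i. ell2_nth x i = ell2_nth y i) \<Longrightarrow> x = y"
  by (metis ell2_nth_inject ext)

lemma ell2_nth_simps [simp]:
  "ell2_nth 0 i = 0" "ell2_nth (x + y) i = ell2_nth x i + ell2_nth y i"
  "ell2_nth (x - y) i = ell2_nth x i - ell2_nth y i" "ell2_nth (- x) i = - ell2_nth x i"
  "ell2_nth (c *\<^sub>C x) i = c *\<^sub>C ell2_nth x i"
  by (transfer, simp)+

instance
  by standard (auto intro!: ell2_eqI simp: scaleR_ell2_def scaleC_add_right scaleC_add_left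
      scaleC_scaleC scaleC_one)

end

lemma ell2_nth_scaleR [simp]: "ell2_nth (r *\<^sub>R x) i = r *\<^sub>R ell2_nth x i"
  by (simp add: scaleR_ell2_def scaleR_scaleC)

lemma ell2_nth_summable: "(\<lambda>i. (norm (ell2_nth x i))\<^sup>2) summable_on UNIV"
  using ell2_nth[of x] by simp

lemma L2_set_bounded_imp_summable:
  assumes B: "\<And>F. finite F \<Longrightarrow> L2_set (\<lambda>i. norm (f i)) F \<le> B"
  shows "(\<lambda>i. (norm (f i))\<^sup>2) summable_on UNIV" "sqrt (\<Sum>\<^sub>\<infinity>i. (norm (f i))\<^sup>2) \<le> B"
proof -
  have B0: "0 \<le> B" using B[of "{}"] by simp
  have le: "(\<Sum>i\<in>F. (norm (f i))\<^sup>2) \<le> B\<^sup>2" if "finite F" for F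
    using B[OF that] sqrt_le_D unfolding L2_set_def by blast
  show sm: "(\<lambda>i. (norm (f i))\<^sup>2) summable_on UNIV"
    by (rule nonneg_bdd_above_summable_on) (use le in \<open>auto simp: bdd_above_def\<close>)
  have "(\<Sum>\<^sub>\<infinity>i. (norm (f i))\<^sup>2) \<le> B\<^sup>2" by (rule infsum_le_finite_sums[OF sm le])
  then show "sqrt (\<Sum>\<^sub>\<infinity>i. (norm (f i))\<^sup>2) \<le> B" using B0 by (simp add: real_le_lsqrt)
qed

instantiation ell2 :: (type, complex_inner) complex_inner
begin

definition norm_ell2 :: "('a, 'b) ell2 \<Rightarrow> real" where
  "norm_ell2 x = sqrt (\<Sum>\<^sub>\<infinity>i. (norm (ell2_nth x i))\<^sup>2)"

definition dist_ell2 :: "('a, 'b) ell2 \<Rightarrow> ('a, 'b) ell2 \<Rightarrow> real" where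
  "dist_ell2 x y = norm (x - y)"

definition sgn_ell2 :: "('a, 'b) ell2 \<Rightarrow> ('a, 'b) ell2" where
  "sgn_ell2 x = x /\<^sub>R norm x"

definition uniformity_ell2 :: "(('a, 'b) ell2 \<times> ('a, 'b) ell2) filter" where
  "uniformity_ell2 = (INF e\<in>{0<..}. principal {(x, y). dist x y < e})"

definition open_ell2 :: "('a, 'b) ell2 set \<Rightarrow> bool" where
  "open_ell2 U = (\<forall>x\<in>U. eventually (\<lambda>(x', y). x' = x \<longrightarrow> y \<in> U) uniformity)"

definition cinner_ell2 :: "('a, 'b) ell2 \<Rightarrow> ('a, 'b) ell2 \<Rightarrow> complex" where
  "cinner_ell2 x y = (\<Sum>\<^sub>\<infinity>i. cinner (ell2_nth x i) (ell2_nth y i))"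

instance
proof
  fix x y z :: "('a, 'b) ell2" and r :: complex and a :: real
  show "dist x y = norm (x - y)" by (rule dist_ell2_def)
  show "sgn x = x /\<^sub>R norm x" by (rule sgn_ell2_def)
  show "(uniformity :: (('a, 'b) ell2 \<times> ('a, 'b) ell2) filter) = (INF e\<in>{0<..}. principal {(x, y). dist x y < e})"
    by (rule uniformity_ell2_def)
  show "open U = (\<forall>x\<in>U. eventually (\<lambda>(x', y). x' = x \<longrightarrow> y \<in> U) uniformity)" for U :: "('a, 'b) ell2 set"
    by (rule open_ell2_def)
  have L2: "L2_set (\<lambda>i. norm (ell2_nth x i)) F \<le> norm x" if "finite F" for F and x :: "('a, 'b) ell2"
    unfolding L2_set_def norm_ell2_def
    by (intro real_sqrt_le_mono finite_sum_le_infsum ell2_nth_summable that) auto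
  have nn: "0 \<le> (\<Sum>\<^sub>\<infinity>i. (norm (ell2_nth x i))\<^sup>2)" by (rule infsum_nonneg) simp
  show "norm x = 0 \<longleftrightarrow> x = 0"
  proof
    assume "norm x = 0"
    then have "(\<Sum>\<^sub>\<infinity>i. (norm (ell2_nth x i))\<^sup>2) \<le> 0" by (simp add: norm_ell2_def)
    then have "(norm (ell2_nth x i))\<^sup>2 = 0" for i
      by (rule nonneg_infsum_le_0D) (auto simp: ell2_nth_summable)
    then show "x = 0" by (intro ell2_eqI) simp
  qed (simp add: norm_ell2_def)
  show "norm (x + y) \<le> norm x + norm y"
    unfolding norm_ell2_def[of "x + y"]
  proof (rule L2_set_bounded_imp_summable(2))
    fix F :: "'a set" assume F: "finite F"
    have "L2_set (\<lambda>i. norm (ell2_nth (x + y) i)) F \<le> L2_set (\<lambda>i. norm (ell2_nth x i) + norm (ell2_nth y i)) F"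
      by (rule L2_set_mono) (auto simp: norm_triangle_ineq)
    also have "\<dots> \<le> L2_set (\<lambda>i. norm (ell2_nth x i)) F + L2_set (\<lambda>i. norm (ell2_nth y i)) F"
      by (rule L2_set_triangle_ineq)
    also have "\<dots> \<le> norm x + norm y" by (intro add_mono L2 F)
    finally show "L2_set (\<lambda>i. norm (ell2_nth (x + y) i)) F \<le> norm x + norm y" .
  qed
  show "norm (a *\<^sub>R x) = \<bar>a\<bar> * norm x"
    by (simp add: norm_ell2_def power_mult_distrib infsum_cmult_right' real_sqrt_mult)
  show "cinner x y = cnj (cinner y x)"
    unfolding cinner_ell2_def infsum_cnj[symmetric] cinner_commute[symmetric] ..
  show "cinner (x + y) z = cinner x z + cinner y z"
    by (simp add: cinner_ell2_def cinner_add_left infsum_add sq_summable_cinner ell2_nth_summable)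
  show "cinner (r *\<^sub>C x) y = r * cinner x y"
    by (simp add: cinner_ell2_def cinner_scaleC_left infsum_cmult_right')
  have *: "cinner x x = complex_of_real (\<Sum>\<^sub>\<infinity>i. (norm (ell2_nth x i))\<^sup>2)"
    unfolding cinner_ell2_def cinner_self
    by (rule infsumI, rule has_sum_of_real) (simp add: ell2_nth_summable)
  show "0 \<le> Re (cinner x x)" unfolding * using nn by simp
  show "cinner x x = 0 \<longleftrightarrow> x = 0"
    unfolding * of_real_eq_0_iff using \<open>norm x = 0 \<longleftrightarrow> x = 0\<close> by (simp add: norm_ell2_def)
  show "norm x = sqrt (Re (cinner x x))"
    unfolding * by (simp add: norm_ell2_def)
qed

end

lemma L2_set_ell2_le: "finite F \<Longrightarrow> L2_set (\<lambda>i. norm (ell2_nth x i)) F \<le> norm x"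
  unfolding L2_set_def norm_ell2_def
  by (intro real_sqrt_le_mono finite_sum_le_infsum ell2_nth_summable) auto

lemma norm_ell2_nth_le: "norm (ell2_nth x i) \<le> norm x"
  using L2_set_ell2_le[of "{i}" x] by simp

lemma norm_ell2_sq: "(norm x)\<^sup>2 = (\<Sum>\<^sub>\<infinity>i. (norm (ell2_nth x i))\<^sup>2)"
  by (simp add: norm_ell2_def infsum_nonneg)

instance ell2 :: (type, chilbert_space) chilbert_space
proof
  fix X :: "nat \<Rightarrow> ('a, 'b) ell2"
  assume "Cauchy X"
  then have C: "\<exists>N. \<forall>m\<ge>N. \<forall>n\<ge>N. norm (X m - X n) < e" if "e > 0" for e
    using that unfolding Cauchy_def dist_norm by blast
  have "Cauchy (\<lambda>n. ell2_nth (X n) i)" for i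
  proof (rule metric_CauchyI)
    fix e :: real assume "e > 0"
    then obtain N where N: "\<And>m n. m \<ge> N \<Longrightarrow> n \<ge> N \<Longrightarrow> norm (X m - X n) < e" using C by meson
    have "dist (ell2_nth (X m) i) (ell2_nth (X n) i) < e" if "m \<ge> N" "n \<ge> N" for m n
      using le_less_trans[OF norm_ell2_nth_le N[OF that], of i] by (simp add: dist_norm)
    then show "\<exists>N. \<forall>m\<ge>N. \<forall>n\<ge>N. dist (ell2_nth (X m) i) (ell2_nth (X n) i) < e" by blast
  qed
  then have "\<exists>l. (\<lambda>n. ell2_nth (X n) i) \<longlonglongrightarrow> l" for i
    using Cauchy_convergent convergent_def by blast
  then obtain l where l: "\<And>i. (\<lambda>n. ell2_nth (X n) i) \<longlonglongrightarrow> l i" by metis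
  have close: "L2_set (\<lambda>i. norm (ell2_nth (X n) i - l i)) F \<le> e"
    if N: "\<And>m n. m \<ge> N \<Longrightarrow> n \<ge> N \<Longrightarrow> norm (X m - X n) < e" and n: "n \<ge> N" for e N n F
  proof (rule LIMSEQ_le_const2)
    show "(\<lambda>m. L2_set (\<lambda>i. norm (ell2_nth (X n) i - ell2_nth (X m) i)) F)
        \<longlonglongrightarrow> L2_set (\<lambda>i. norm (ell2_nth (X n) i - l i)) F"
      unfolding L2_set_def by (intro tendsto_intros l)
    show "\<exists>M. \<forall>m\<ge>M. L2_set (\<lambda>i. norm (ell2_nth (X n) i - ell2_nth (X m) i)) F \<le> e"
    proof (intro exI[of _ N] allI impI)
      fix m assume m: "m \<ge> N"
      show "L2_set (\<lambda>i. norm (ell2_nth (X n) i - ell2_nth (X m) i)) F \<le> e"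
      proof (cases "finite F")
        case True
        then show ?thesis using L2_set_ell2_le[of F "X n - X m"] N[OF n m] by simp
      next
        case False
        have "0 \<le> e" using N[OF n n] by simp
        then show ?thesis using False by simp
      qed
    qed
  qed
  obtain N1 where "\<And>m n. m \<ge> N1 \<Longrightarrow> n \<ge> N1 \<Longrightarrow> norm (X m - X n) < 1" using C[of 1] by auto
  from L2_set_bounded_imp_summable(1)[OF close[OF this order_refl]]
  have sm: "(\<lambda>i. (norm (ell2_nth (X N1) i - l i))\<^sup>2) summable_on UNIV" by blast
  have "(\<lambda>i. (norm (- (ell2_nth (X N1) i - l i) + ell2_nth (X N1) i))\<^sup>2) summable_on UNIV"
    by (rule sq_summable_add) (use sm ell2_nth_summable in \<open>simp_all only: norm_minus_cancel\<close>)
  then have "(\<lambda>i. (norm (l i))\<^sup>2) summable_on UNIV" by simp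
  then have Al: "ell2_nth (Abs_ell2 l) = l" by (simp add: Abs_ell2_inverse)
  have "X \<longlonglongrightarrow> Abs_ell2 l"
  proof (rule LIMSEQ_I)
    fix e :: real assume e: "0 < e"
    then obtain N where N: "\<And>m n. m \<ge> N \<Longrightarrow> n \<ge> N \<Longrightarrow> norm (X m - X n) < e / 2"
      using C[of "e / 2"] by auto
    have "norm (X n - Abs_ell2 l) < e" if "n \<ge> N" for n
    proof -
      have "norm (X n - Abs_ell2 l) \<le> e / 2"
        unfolding norm_ell2_def ell2_nth_simps Al
        by (rule L2_set_bounded_imp_summable(2)[OF close[OF N that]])
      then show ?thesis using e by simp
    qed
    then show "\<exists>N. \<forall>n\<ge>N. norm (X n - Abs_ell2 l) < e" by blast
  qed
  then show "convergent X" by (rule convergentI)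
qed

section \<open>The Fock space over words\<close>

text \<open>The vectors \<open>fock_ker z y = (w \<mapsto> cnj (z\<^sup>w) y)\<close> below have the Drury--Arveson kernel as their
  Gram matrix, so their closed span is \<open>H(k\<^sub>d)\<close>; they are eigenvectors of the backward shifts.\<close>

lemma infsum_list_split:
  fixes g :: "'d::finite list \<Rightarrow> 'b::banach"
  assumes g: "g summable_on UNIV"
  shows "infsum g UNIV = g [] + (\<Sum>j\<in>UNIV. \<Sum>\<^sub>\<infinity>w. g (j # w))"
proof -
  let ?h = "\<lambda>(j, w). j # w :: 'd list"
  have inj: "inj_on ?h (UNIV \<times> UNIV)" by (auto simp: inj_on_def)
  have U: "(UNIV :: 'd list set) = {[]} \<union> ?h ` (UNIV \<times> UNIV)"
  proof -
    have "w \<in> {[]} \<union> ?h ` (UNIV \<times> UNIV)" for w by (cases w) (auto intro: image_eqI[where x="(hd w, tl w)"])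
    then show ?thesis by blast
  qed
  have sm: "g summable_on ?h ` (UNIV \<times> UNIV)" by (rule summable_on_subset_banach[OF g]) simp
  have "infsum g UNIV = infsum g {[]} + infsum g (?h ` (UNIV \<times> UNIV))"
    by (subst U, rule infsum_Un_disjoint) (use sm in auto)
  also have "infsum g (?h ` (UNIV \<times> UNIV)) = infsum (g \<circ> ?h) (UNIV \<times> UNIV)"
    by (rule infsum_reindex[OF inj])
  also have "\<dots> = infsum (\<lambda>j. \<Sum>\<^sub>\<infinity>w. (g \<circ> ?h) (j, w)) UNIV"
    by (rule infsum_Sigma_banach[symmetric]) (use sm summable_on_reindex[OF inj, of g] in simp)
  finally show ?thesis by simp
qed

lemma sq_summable_Cons:
  fixes x :: "'d list \<Rightarrow> 'y::complex_inner"
  assumes "(\<lambda>i. (norm (x i))\<^sup>2) summable_on UNIV"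
  shows "(\<lambda>w. (norm (x (j # w)))\<^sup>2) summable_on UNIV"
proof -
  have "(\<lambda>i. (norm (x i))\<^sup>2) summable_on (Cons j ` UNIV)"
    using assms summable_on_subset_banach by blast
  then show ?thesis
    using summable_on_reindex[of "Cons j" UNIV "\<lambda>i. (norm (x i))\<^sup>2"] by (simp add: comp_def)
qed

lift_definition shift :: "'d \<Rightarrow> ('d list, 'y::complex_inner) ell2 \<Rightarrow> ('d list, 'y) ell2" is
  "\<lambda>j x w. x (j # w)"
  by (simp add: sq_summable_Cons)

definition vacuum :: "('d list, 'y::complex_inner) ell2 \<Rightarrow> 'y" where
  "vacuum x = ell2_nth x []"

lemma ell2_nth_shift [simp]: "ell2_nth (shift j x) w = ell2_nth x (j # w)"
  by transfer simp

lemma fock_split: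
  fixes x y :: "('d::finite list, 'y::complex_inner) ell2"
  shows "cinner x y = cinner (vacuum x) (vacuum y) + (\<Sum>j\<in>UNIV. cinner (shift j x) (shift j y))"
  unfolding cinner_ell2_def vacuum_def
  by (subst infsum_list_split) (auto simp: sq_summable_cinner ell2_nth_summable)

lemma fock_norm_split:
  fixes x :: "('d::finite list, 'y::complex_inner) ell2"
  shows "(norm x)\<^sup>2 = (norm (vacuum x))\<^sup>2 + (\<Sum>j\<in>UNIV. (norm (shift j x))\<^sup>2)"
  unfolding norm_sq_cinner by (subst fock_split) simp

lemma bclin_shift:
  "bounded_clinear_op (shift j :: ('d::finite list, 'y::complex_inner) ell2 \<Rightarrow> _)"
proof (rule bclinI[where K=1])
  fix x :: "('d list, 'y) ell2"
  have "(norm (shift j x))\<^sup>2 \<le> (\<Sum>j\<in>UNIV. (norm (shift j x))\<^sup>2)" by (rule member_le_sum) auto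
  also have "\<dots> \<le> (norm x)\<^sup>2" using fock_norm_split[of x] by simp
  finally show "norm (shift j x) \<le> 1 * norm x" using power2_le_imp_le[of _ "norm x"] by simp
qed (auto intro!: ell2_eqI)

lemma finite_words: "finite {w :: 'd::finite list. length w < N}"
  using finite_lists_length_le[of "UNIV :: 'd set" N] by (rule finite_subset[rotated]) auto

lemma list_le_Suc:
  "{w :: 'd::finite list. length w < Suc N} = insert [] ((\<lambda>(j, w). j # w) ` (UNIV \<times> {w. length w < N}))"
proof -
  have "length w < Suc N \<longleftrightarrow> w \<in> insert [] ((\<lambda>(j, w). j # w) ` (UNIV \<times> {w. length w < N}))" for w :: "'d list"
    by (cases w) auto
  then show ?thesis by blast
qed

lemma sum_list_split:
  fixes g :: "'d::finite list \<Rightarrow> 'b::comm_monoid_add"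
  shows "(\<Sum>w | length w < Suc N. g w) = g [] + (\<Sum>j\<in>UNIV. \<Sum>w | length w < N. g (j # w))"
proof -
  have inj: "inj_on (\<lambda>(j, w). j # w :: 'd list) A" for A by (auto simp: inj_on_def)
  show ?thesis
    unfolding list_le_Suc
    by (subst sum.insert) (use finite_words[where 'd='d and N=N] in \<open>auto simp: sum.reindex[OF inj] sum.cartesian_product intro!: sum.cong arg_cong2[where f="(+)"]\<close>)
qed

definition wpow :: "('d \<Rightarrow> complex) \<Rightarrow> 'd list \<Rightarrow> complex" where
  "wpow z w = (\<Prod>j\<leftarrow>w. z j)"

lemma wpow_simps [simp]: "wpow z [] = 1" "wpow z (j # w) = z j * wpow z w"
  by (auto simp: wpow_def)

lemma dinner_self: "Re (dinner z z) = (\<Sum>j\<in>UNIV. (cmod (z j))\<^sup>2)"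
  by (simp add: dinner_def complex_norm_square[symmetric])

lemma Ball_d_iff: "z \<in> Ball_d \<longleftrightarrow> (\<Sum>j\<in>UNIV. (cmod (z j))\<^sup>2) < 1"
  by (simp add: Ball_d_def dinner_self)

lemma zero_in_Ball_d: "0 \<in> Ball_d"
  by (simp add: Ball_d_iff)

lemma norm_dinner_less_1:
  assumes "z \<in> Ball_d" "w \<in> Ball_d" shows "cmod (dinner z w) < 1"
proof -
  have *: "L2_set (\<lambda>j. cmod (z j)) UNIV < 1" if "z \<in> Ball_d" for z :: "'a \<Rightarrow> complex"
    using that by (simp add: Ball_d_iff L2_set_def)
  have "cmod (dinner z w) \<le> (\<Sum>j\<in>UNIV. \<bar>cmod (z j)\<bar> * \<bar>cmod (w j)\<bar>)"
    unfolding dinner_def by (rule order_trans[OF norm_sum]) (simp add: norm_mult)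
  also have "\<dots> \<le> L2_set (\<lambda>j. cmod (z j)) UNIV * L2_set (\<lambda>j. cmod (w j)) UNIV"
    by (rule L2_set_mult_ineq)
  also have "\<dots> < 1"
    using mult_strict_mono'[OF *[OF assms(1)] *[OF assms(2)]] by (simp add: L2_set_nonneg)
  finally show ?thesis .
qed

lemma wpow_summable:
  assumes z: "z \<in> Ball_d"
  shows "(\<lambda>w. (norm (cnj (wpow z w) *\<^sub>C (y::'y::complex_inner)))\<^sup>2) summable_on UNIV"
proof -
  define r where "r = (\<Sum>j\<in>UNIV. (cmod (z j))\<^sup>2)"
  have r: "0 \<le> r" "r < 1" using z by (auto simp: Ball_d_iff r_def sum_nonneg)
  have bd: "(\<Sum>w | length w < N. (cmod (wpow z w))\<^sup>2) \<le> 1 / (1 - r)" for N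
  proof (induction N)
    case (Suc N)
    have "(\<Sum>w | length w < Suc N. (cmod (wpow z w))\<^sup>2) =
       1 + r * (\<Sum>w | length w < N. (cmod (wpow z w))\<^sup>2)"
      unfolding sum_list_split
      by (simp add: r_def norm_mult power_mult_distrib sum_distrib_left[symmetric] sum_distrib_right)
    also have "\<dots> \<le> 1 + r * (1 / (1 - r))" using Suc r by (intro add_left_mono mult_left_mono)
    also have "\<dots> = 1 / (1 - r)" using r by (simp add: field_simps)
    finally show ?case .
  qed (use r in simp)
  have "(\<lambda>w. (cmod (wpow z w))\<^sup>2) summable_on UNIV"
  proof (rule nonneg_bdd_above_summable_on)
    have "sum (\<lambda>w. (cmod (wpow z w))\<^sup>2) F \<le> 1 / (1 - r)" if F: "finite F" for F
    proof -
      have sub: "F \<subseteq> {w. length w < Suc (Max (length ` F))}"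
        using F by (auto simp: less_Suc_eq_le)
      have "sum (\<lambda>w. (cmod (wpow z w))\<^sup>2) F \<le> (\<Sum>w | length w < Suc (Max (length ` F)). (cmod (wpow z w))\<^sup>2)"
        by (rule sum_mono2[OF finite_words sub]) simp
      then show ?thesis using bd order_trans by blast
    qed
    then show "bdd_above (sum (\<lambda>w. (cmod (wpow z w))\<^sup>2) ` {F. F \<subseteq> UNIV \<and> finite F})"
      by (auto simp: bdd_above_def)
  qed simp
  from summable_on_cmult_right[OF this, of "(norm y)\<^sup>2"] show ?thesis
    by (simp add: norm_scaleC power_mult_distrib mult.commute)
qed

definition fock_ker :: "('d::finite \<Rightarrow> complex) \<Rightarrow> 'y::complex_inner \<Rightarrow> ('d list, 'y) ell2" where
  "fock_ker z y = Abs_ell2 (\<lambda>w. if z \<in> Ball_d then cnj (wpow z w) *\<^sub>C y else 0)"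

lemma ell2_nth_fock_ker:
  "z \<in> Ball_d \<Longrightarrow> ell2_nth (fock_ker z y) w = cnj (wpow z w) *\<^sub>C y"
  by (simp add: fock_ker_def Abs_ell2_inverse wpow_summable)

lemma vacuum_fock_ker: "z \<in> Ball_d \<Longrightarrow> vacuum (fock_ker z y) = y"
  by (simp add: vacuum_def ell2_nth_fock_ker scaleC_one)

lemma shift_fock_ker: "z \<in> Ball_d \<Longrightarrow> shift j (fock_ker z y) = cnj (z j) *\<^sub>C fock_ker z y"
  by (rule ell2_eqI) (simp add: ell2_nth_fock_ker scaleC_scaleC)

lemma cinner_fock_ker:
  assumes z: "z \<in> Ball_d" and w: "w \<in> Ball_d"
  shows "cinner (fock_ker w y) (fock_ker z y') = 1 / (1 - dinner z w) * cinner y y'"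
proof -
  let ?s = "cinner (fock_ker w y) (fock_ker z y')"
  have "?s = cinner (vacuum (fock_ker w y)) (vacuum (fock_ker z y')) +
      (\<Sum>j\<in>UNIV. cinner (shift j (fock_ker w y)) (shift j (fock_ker z y')))"
    by (rule fock_split)
  also have "\<dots> = cinner y y' + (\<Sum>j\<in>UNIV. z j * (cnj (w j) * ?s))"
    by (simp add: vacuum_fock_ker shift_fock_ker z w cinner_scaleC_left cinner_scaleC_right)
  also have "(\<Sum>j\<in>UNIV. z j * (cnj (w j) * ?s)) = dinner z w * ?s"
    by (simp add: dinner_def sum_distrib_right mult.assoc)
  finally have "?s - dinner z w * ?s = cinner y y'" unfolding diff_eq_eq .
  then have "(1 - dinner z w) * ?s = cinner y y'" by (simp add: left_diff_distrib)
  moreover have "dinner z w \<noteq> 1" using norm_dinner_less_1[OF z w] by auto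
  ultimately show ?thesis by (simp add: field_simps)
qed

lemma bclin_fock_ker:
  assumes z: "z \<in> Ball_d" shows "bounded_clinear_op (fock_ker z :: 'y::complex_inner \<Rightarrow> _)"
proof (rule bclinI[where K="sqrt (Re (1 / (1 - dinner z z)))"])
  fix x y :: 'y and c
  show "fock_ker z (x + y) = fock_ker z x + fock_ker z y"
    by (rule ell2_eqI) (simp add: ell2_nth_fock_ker z scaleC_add_right)
  show "fock_ker z (c *\<^sub>C x) = c *\<^sub>C fock_ker z x"
    by (rule ell2_eqI) (simp add: ell2_nth_fock_ker z scaleC_scaleC mult.commute)
  have "Re (cinner (fock_ker z x) (fock_ker z x)) = Re (1 / (1 - dinner z z)) * (norm x)\<^sup>2"
    by (subst cinner_fock_ker[OF z z]) (simp only: cinner_self times_complex.sel Re_complex_of_real Im_complex_of_real mult_zero_right diff_zero)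
  then show "norm (fock_ker z x) \<le> sqrt (Re (1 / (1 - dinner z z))) * norm x"
    unfolding norm_eq_sqrt_cinner[of "fock_ker z x"] by (simp only: real_sqrt_mult real_sqrt_abs abs_norm_cancel order_refl)
qed

definition fock_eval :: "('d::finite list, 'y::chilbert_space) ell2 \<Rightarrow> ('d \<Rightarrow> complex) \<Rightarrow> 'y" where
  "fock_eval x z = (if z \<in> Ball_d then cadj (fock_ker z) x else 0)"

lemma cinner_fock_eval: "z \<in> Ball_d \<Longrightarrow> cinner (fock_eval x z) y = cinner x (fock_ker z y)"
  by (simp add: fock_eval_def cinner_cadj_left[OF bclin_fock_ker])

lemma bclin_fock_eval: "bounded_clinear_op (\<lambda>x. fock_eval x z)"
proof (cases "z \<in> Ball_d")
  case True
  then show ?thesis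
    using bclin_cadj[OF bclin_fock_ker[OF True]] by (simp add: fock_eval_def)
qed (auto simp: fock_eval_def bounded_clinear_op_def intro: exI[of _ 0])

lemma fock_eval_0: "fock_eval (x :: ('d::finite list, 'y::chilbert_space) ell2) 0 = vacuum x"
proof (rule cinner_extI)
  fix y :: 'y
  have "shift j (fock_ker 0 y) = 0" for j :: 'd by (simp add: shift_fock_ker zero_in_Ball_d)
  then show "cinner (fock_eval x 0) y = cinner (vacuum x) y"
    unfolding cinner_fock_eval[OF zero_in_Ball_d]
    by (subst fock_split) (simp add: vacuum_fock_ker zero_in_Ball_d)
qed

lemma fock_eval_shift:
  assumes z: "z \<in> Ball_d"
  shows "fock_eval x z = vacuum x + (\<Sum>j\<in>UNIV. z j *\<^sub>C fock_eval (shift j x) z)"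
proof (rule cinner_extI)
  fix y
  show "cinner (fock_eval x z) y = cinner (vacuum x + (\<Sum>j\<in>UNIV. z j *\<^sub>C fock_eval (shift j x) z)) y"
    unfolding cinner_fock_eval[OF z]
    by (subst fock_split) (simp add: vacuum_fock_ker shift_fock_ker z cinner_scaleC_right cinner_add_left
        cinner_sum_left cinner_scaleC_left cinner_fock_eval)
qed

definition sym_fock :: "('d::finite list, 'y::chilbert_space) ell2 set" where
  "sym_fock = ccspan {fock_ker z y | z y. z \<in> Ball_d}"

lemma closed_csubspace_sym_fock: "closed_csubspace sym_fock"
  unfolding sym_fock_def by (rule closed_csubspace_ccspan)

lemmas csubspace_sym_fock = closed_csubspaceD(1)[OF closed_csubspace_sym_fock]

lemma fock_ker_in_sym_fock: "z \<in> Ball_d \<Longrightarrow> fock_ker z y \<in> sym_fock"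
  unfolding sym_fock_def by (rule subsetD[OF ccspan_superset]) auto

lemma sym_fock_induct:
  assumes "closed_csubspace L" "\<And>z y. z \<in> Ball_d \<Longrightarrow> fock_ker z y \<in> L" "x \<in> sym_fock"
  shows "x \<in> L"
proof -
  have "sym_fock \<subseteq> L"
    unfolding sym_fock_def by (rule ccspan_least[OF assms(1)]) (use assms(2) in auto)
  then show ?thesis using assms(3) by (rule subsetD)
qed

lemma sym_fock_total:
  assumes "x \<in> sym_fock" "\<And>z y. z \<in> Ball_d \<Longrightarrow> cinner x (fock_ker z y) = 0"
  shows "x = 0"
  by (rule ccspan_total[OF assms(1)[unfolded sym_fock_def]]) (use assms(2) in auto)

lemma shift_sym_fock: "x \<in> sym_fock \<Longrightarrow> shift j x \<in> sym_fock"
  using sym_fock_induct[OF closed_csubspace_vimage[OF bclin_shift closed_csubspace_sym_fock, of j]]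
  by (simp add: shift_fock_ker csubspaceD(3)[OF csubspace_sym_fock] fock_ker_in_sym_fock)

lemma shift_commute:
  assumes "x \<in> sym_fock" shows "shift i (shift j x) = shift j (shift i x)"
  using sym_fock_induct[OF closed_csubspace_eq[OF
      bclin_compose[OF bclin_shift bclin_shift]
      bclin_compose[OF bclin_shift bclin_shift]], of i j j i, OF _ assms]
  by (simp add: shift_fock_ker bclinD(2)[OF bclin_shift] scaleC_scaleC mult.commute)

lemma cinner_kd_kernel:
  "z \<in> Ball_d \<Longrightarrow> w \<in> Ball_d \<Longrightarrow> cinner (kd_kernel z w y) y' = cinner (fock_ker w y) (fock_ker z y')"
  by (simp add: kd_kernel_def cinner_fock_ker cinner_scaleC_left)

lemma fock_eval_off: "z \<notin> Ball_d \<Longrightarrow> fock_eval x z = 0"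
  by (simp add: fock_eval_def)

lemma HDA_eq: "HDA = fock_eval ` sym_fock"
  unfolding HDA_def
  by (rule rkhs_eq_ev[where \<gamma>=fock_ker])
     (auto simp: closed_csubspace_sym_fock fock_ker_in_sym_fock cinner_fock_eval cinner_kd_kernel fock_eval_off
       intro: sym_fock_total)

lemma hda_norm_eval: "x \<in> sym_fock \<Longrightarrow> hda_norm (fock_eval x) = norm x"
  unfolding hda_norm_def
  by (rule rk_nrm_ev[where \<gamma>=fock_ker and X=sym_fock])
     (auto simp: closed_csubspace_sym_fock fock_ker_in_sym_fock cinner_fock_eval cinner_kd_kernel fock_eval_off
       intro: sym_fock_total)

lemma hda_inner_eval:
  "x \<in> sym_fock \<Longrightarrow> y \<in> sym_fock \<Longrightarrow> hda_inner (fock_eval x) (fock_eval y) = cinner x y"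
  unfolding hda_inner_def
  by (rule rk_inner_ev[where \<gamma>=fock_ker and X=sym_fock])
     (auto simp: closed_csubspace_sym_fock fock_ker_in_sym_fock cinner_fock_eval cinner_kd_kernel fock_eval_off
       intro: sym_fock_total)

lemma fock_eval_inj: "x \<in> sym_fock \<Longrightarrow> y \<in> sym_fock \<Longrightarrow> fock_eval x = fock_eval y \<Longrightarrow> x = y"
proof -
  assume "x \<in> sym_fock" "y \<in> sym_fock" "fock_eval x = fock_eval y"
  then have "x - y = 0"
    by (intro sym_fock_total)
       (auto simp: csubspace_diff[OF csubspace_sym_fock] cinner_diff_left
         cinner_fock_eval[symmetric])
  then show "x = y" by simp
qed

lemma fock_eval_add: "fock_eval (x + y) = fock_eval x + fock_eval y"
  by (rule ext) (simp add: bclinD(1)[OF bclin_fock_eval])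

lemma fock_eval_scale: "fock_eval (c *\<^sub>C x) = fscale c (fock_eval x)"
  by (rule ext) (simp add: bclinD(2)[OF bclin_fock_eval] fscale_def)

lemma fock_eval_diff: "fock_eval (x - y) = fock_eval x - fock_eval y"
  by (rule ext) (simp add: bclin_diff[OF bclin_fock_eval])

lemma fock_eval_zero: "fock_eval 0 = 0"
  by (rule ext) (simp add: bclin_zero[OF bclin_fock_eval])

lemma fock_eval_sum: "fock_eval (\<Sum>i\<in>I. f i) = (\<Sum>i\<in>I. fock_eval (f i))"
  by (induction I rule: infinite_finite_induct)
     (auto simp: fock_eval_add bclin_zero[OF bclin_fock_eval] fun_eq_iff)

section \<open>The model space of an inner function\<close>

lemma fock_eval_fock_ker:
  assumes "z \<in> Ball_d" "w \<in> Ball_d"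
  shows "fock_eval (fock_ker z y) w = kd_kernel w z y"
  by (rule cinner_extI) (simp add: cinner_fock_eval cinner_kd_kernel assms)

definition coord_mult :: "'d \<Rightarrow> ('d::finite list, 'v::chilbert_space) ell2 \<Rightarrow> ('d list, 'v) ell2" where
  "coord_mult j h = proj sym_fock (cadj (shift j) h)"

lemma coord_mult_in: "coord_mult j h \<in> sym_fock"
  unfolding coord_mult_def by (rule proj_works(1)[OF closed_csubspace_sym_fock])

lemma cinner_coord_mult: "x \<in> sym_fock \<Longrightarrow> cinner x (coord_mult j h) = cinner (shift j x) h"
  by (simp add: coord_mult_def proj_works(2)[OF closed_csubspace_sym_fock] cinner_cadj[OF bclin_shift])

lemma fock_eval_coord_mult:
  assumes z: "z \<in> Ball_d" shows "fock_eval (coord_mult j h) z = z j *\<^sub>C fock_eval h z"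
proof (rule cinner_extI)
  fix y
  have "cinner (fock_eval (coord_mult j h) z) y = cnj (cinner (fock_ker z y) (coord_mult j h))"
    unfolding cinner_fock_eval[OF z] by (rule cinner_commute)
  also have "\<dots> = cnj (cnj (z j) * cinner (fock_ker z y) h)"
    by (simp add: cinner_coord_mult fock_ker_in_sym_fock z shift_fock_ker cinner_scaleC_left)
  also have "\<dots> = z j * cinner h (fock_ker z y)"
    by (simp add: cinner_commute[symmetric])
  finally show "cinner (fock_eval (coord_mult j h) z) y = cinner (z j *\<^sub>C fock_eval h z) y"
    by (simp add: cinner_scaleC_left cinner_fock_eval z)
qed

locale inner_pure =
  fixes S :: "('d::{finite,linorder} \<Rightarrow> complex) \<Rightarrow> 'u::chilbert_space \<Rightarrow> 'y::chilbert_space"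
  assumes schur: "schur_class S" and inn: "inner_schur S" and pur: "pure_schur S"
begin

lemma S_op: "z \<in> Ball_d \<Longrightarrow> bounded_clinear_op (S z)"
  using schur by (simp add: schur_class_def)

lemma cinner_S: "z \<in> Ball_d \<Longrightarrow> cinner (S z u) y = cinner u (cadj (S z) y)"
  by (rule cinner_cadj[OF S_op])

definition mul_S :: "('d list, 'u) ell2 \<Rightarrow> ('d list, 'y) ell2" where
  "mul_S h = (SOME m. m \<in> sym_fock \<and> fock_eval m = mult_op S (fock_eval h))"

lemma mul_S:
  assumes h: "h \<in> sym_fock"
  shows mul_S_in: "mul_S h \<in> sym_fock" and eval_mul_S: "fock_eval (mul_S h) = mult_op S (fock_eval h)"
proof -
  have "mult_op S (fock_eval h) \<in> HDA"
    using schur h unfolding schur_class_def HDA_eq by blast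
  then have "\<exists>m. m \<in> sym_fock \<and> fock_eval m = mult_op S (fock_eval h)"
    unfolding HDA_eq by force
  from someI_ex[OF this] show "mul_S h \<in> sym_fock" "fock_eval (mul_S h) = mult_op S (fock_eval h)"
    unfolding mul_S_def by blast+
qed

lemma eval_mul_S_at: "h \<in> sym_fock \<Longrightarrow> z \<in> Ball_d \<Longrightarrow> fock_eval (mul_S h) z = S z (fock_eval h z)"
  by (simp add: eval_mul_S mult_op_def)

lemma mul_S_eqI:
  assumes "h \<in> sym_fock" "m \<in> sym_fock" "\<And>z. z \<in> Ball_d \<Longrightarrow> fock_eval m z = S z (fock_eval h z)"
  shows "mul_S h = m"
proof (rule fock_eval_inj[OF mul_S_in[OF assms(1)] assms(2)])
  show "fock_eval (mul_S h) = fock_eval m"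
  proof
    fix z show "fock_eval (mul_S h) z = fock_eval m z"
      by (cases "z \<in> Ball_d") (simp_all add: eval_mul_S_at assms fock_eval_off)
  qed
qed

lemma norm_mul_S_le:
  assumes h: "h \<in> sym_fock" shows "norm (mul_S h) \<le> norm h"
proof -
  have "hda_norm (mult_op S (fock_eval h)) \<le> hda_norm (fock_eval h)"
    using schur h unfolding schur_class_def HDA_eq by blast
  then show ?thesis
    using mul_S_in[OF h] by (simp add: eval_mul_S[OF h, symmetric] hda_norm_eval h)
qed

lemmas sym_sub = csubspaceD[OF csubspace_sym_fock]

lemma mul_S_add_scale:
  assumes "k \<in> sym_fock" "h \<in> sym_fock"
  shows "mul_S (k + c *\<^sub>C h) = mul_S k + c *\<^sub>C mul_S h"
  by (rule mul_S_eqI)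
     (auto simp: sym_sub assms mul_S_in fock_eval_add fock_eval_scale fscale_def eval_mul_S_at
       bclinD(1,2)[OF S_op])

lemma mul_S_isometric_at:
  assumes k: "k \<in> sym_fock" and h: "h \<in> sym_fock" and iso: "norm (mul_S k) = norm k"
  shows "cinner (mul_S k) (mul_S h) = cinner k h"
proof (rule ccontr)
  define \<delta> where "\<delta> = cinner (mul_S k) (mul_S h) - cinner k h"
  assume "cinner (mul_S k) (mul_S h) \<noteq> cinner k h"
  then have d: "0 < (cmod \<delta>)\<^sup>2" by (simp add: \<delta>_def)
  define B where "B = (norm h)\<^sup>2"
  define t where "t = 1 / (B + 1)"
  have B: "0 \<le> B" by (simp add: B_def)
  have t: "0 < t" "t * B < 2" using B by (auto simp: t_def field_simps)
  define c where "c = complex_of_real t * \<delta>"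
  have "norm (mul_S (k + c *\<^sub>C h)) \<le> norm (k + c *\<^sub>C h)"
    by (rule norm_mul_S_le) (simp add: sym_sub k h)
  then have "(norm (mul_S k + c *\<^sub>C mul_S h))\<^sup>2 \<le> (norm (k + c *\<^sub>C h))\<^sup>2"
    unfolding mul_S_add_scale[OF k h] by (rule power_mono) simp
  then have "(norm (c *\<^sub>C mul_S h))\<^sup>2 + 2 * Re (cnj c * cinner (mul_S k) (mul_S h))
      \<le> (norm (c *\<^sub>C h))\<^sup>2 + 2 * Re (cnj c * cinner k h)"
    by (simp add: norm_add_sq iso cinner_scaleC_right)
  then have "2 * Re (cnj c * \<delta>) \<le> (norm (c *\<^sub>C h))\<^sup>2"
    using zero_le_power2[of "norm (c *\<^sub>C mul_S h)"] unfolding \<delta>_def right_diff_distrib minus_complex.sel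
    by linarith
  also have "(norm (c *\<^sub>C h))\<^sup>2 = t * (t * B) * (cmod \<delta>)\<^sup>2"
    by (simp add: norm_scaleC c_def B_def norm_mult power_mult_distrib power2_eq_square)
  also have "cnj c * \<delta> = complex_of_real (t * (cmod \<delta>)\<^sup>2)"
    unfolding c_def by (simp add: complex_norm_square mult_ac del: of_real_power)
  finally have "(cmod \<delta>)\<^sup>2 * (2 * t) \<le> (cmod \<delta>)\<^sup>2 * (t * (t * B))"
    by (simp add: mult_ac)
  then have "2 * t \<le> t * (t * B)" using d by simp
  then show False using t by (simp add: mult.commute)
qed

definition S_ker :: "('d \<Rightarrow> complex) \<Rightarrow> 'y \<Rightarrow> ('d list, 'u) ell2" where
  "S_ker z y = fock_ker z (cadj (S z) y)"

lemma S_ker_in: "z \<in> Ball_d \<Longrightarrow> S_ker z y \<in> sym_fock"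
  by (simp add: S_ker_def fock_ker_in_sym_fock)

lemma cinner_S_ker:
  assumes z: "z \<in> Ball_d" shows "cinner h (S_ker z y) = cinner (S z (fock_eval h z)) y"
  by (simp add: S_ker_def cinner_fock_eval[symmetric] z cinner_S)

lemma norm_mul_S_ker:
  assumes z: "z \<in> Ball_d" shows "norm (mul_S (S_ker z y)) = norm (S_ker z y)"
proof -
  note k = S_ker_in[OF z, of y]
  have "hda_inner (fock_eval (S_ker z y)) g = 0" if g: "g \<in> HDA" "mult_op S g = 0" for g
  proof -
    obtain h where h: "h \<in> sym_fock" "g = fock_eval h" using g(1) unfolding HDA_eq by blast
    have "S z (fock_eval h z) = 0"
      using fun_cong[OF g(2), of z] z h by (simp add: mult_op_def)
    then have "cinner h (S_ker z y) = 0" by (simp add: cinner_S_ker z)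
    then show ?thesis using h k by (simp add: hda_inner_eval cinner_eq_0_commute)
  qed
  then have "hda_norm (mult_op S (fock_eval (S_ker z y))) = hda_norm (fock_eval (S_ker z y))"
    using inn k unfolding inner_schur_def HDA_eq by blast
  then show ?thesis
    using mul_S_in[OF k] k by (simp add: eval_mul_S[OF k, symmetric] hda_norm_eval)
qed

definition model :: "('d list, 'y) ell2 set" where
  "model = {x \<in> sym_fock. \<forall>h\<in>sym_fock. cinner x (mul_S h) = 0}"

lemma closed_csubspace_model: "closed_csubspace model"
proof -
  have "model = sym_fock \<inter> {x. \<forall>g\<in>mul_S ` sym_fock. cinner x g = 0}" by (auto simp: model_def)
  then show ?thesis
    by (simp only:) (rule closed_csubspace_Int[OF closed_csubspace_sym_fock closed_csubspace_orth])
qed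

lemmas csubspace_model = closed_csubspaceD(1)[OF closed_csubspace_model]
lemmas model_sub = csubspaceD[OF csubspace_model]

lemma model_in_sym_fock: "x \<in> model \<Longrightarrow> x \<in> sym_fock" by (simp add: model_def)

definition model_ker :: "('d \<Rightarrow> complex) \<Rightarrow> 'y \<Rightarrow> ('d list, 'y) ell2" where
  "model_ker z y = fock_ker z y - mul_S (S_ker z y)"

lemma model_ker_in:
  assumes z: "z \<in> Ball_d" shows "model_ker z y \<in> model"
proof -
  have "cinner (model_ker z y) (mul_S h) = 0" if h: "h \<in> sym_fock" for h
  proof -
    have "cinner (fock_ker z y) (mul_S h) = cnj (cinner (mul_S h) (fock_ker z y))" by (rule cinner_commute)
    also have "\<dots> = cnj (cinner h (S_ker z y))"
      by (simp add: cinner_fock_eval[symmetric] z eval_mul_S_at h cinner_S_ker)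
    also have "\<dots> = cinner (S_ker z y) h" by (simp add: cinner_commute[symmetric])
    finally show ?thesis
      by (simp add: model_ker_def cinner_diff_left mul_S_isometric_at[OF S_ker_in h norm_mul_S_ker] z)
  qed
  moreover have "model_ker z y \<in> sym_fock"
    unfolding model_ker_def
    by (intro csubspace_diff csubspace_sym_fock fock_ker_in_sym_fock mul_S_in S_ker_in z)
  ultimately show ?thesis by (simp add: model_def)
qed

lemma cinner_model_ker:
  "z \<in> Ball_d \<Longrightarrow> x \<in> model \<Longrightarrow> cinner (fock_eval x z) y = cinner x (model_ker z y)"
  by (simp add: model_ker_def cinner_diff_right model_def S_ker_in cinner_fock_eval)

lemma eval_model_ker:
  assumes z: "z \<in> Ball_d" and w: "w \<in> Ball_d"
  shows "fock_eval (model_ker z y) w = KS S w z y"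
  by (simp add: model_ker_def fock_eval_diff eval_mul_S_at S_ker_in z w)
     (simp add: S_ker_def fock_eval_fock_ker z w kd_kernel_def KS_def scaleC_diff_right bclinD(2)[OF S_op])

lemma cinner_KS:
  assumes "z \<in> Ball_d" "w \<in> Ball_d"
  shows "cinner (KS S z w y) y' = cinner (model_ker w y) (model_ker z y')"
  by (simp add: eval_model_ker[symmetric] cinner_model_ker assms model_ker_in)

lemma model_total:
  assumes x: "x \<in> model" and "\<And>z y. z \<in> Ball_d \<Longrightarrow> cinner x (model_ker z y) = 0"
  shows "x = 0"
  by (rule sym_fock_total[OF model_in_sym_fock[OF x]])
     (use assms in \<open>simp add: cinner_fock_eval[symmetric] cinner_model_ker\<close>)

lemma HKS_eq: "HKS S = fock_eval ` model"
  unfolding HKS_def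
  by (rule rkhs_eq_ev[where \<gamma>=model_ker])
     (auto simp: closed_csubspace_model model_ker_in cinner_model_ker cinner_KS fock_eval_off
       intro: model_total)

lemma rk_inner_KS_eval:
  "x \<in> model \<Longrightarrow> y \<in> model \<Longrightarrow> rk_inner Ball_d (KS S) (fock_eval x) (fock_eval y) = cinner x y"
  by (rule rk_inner_ev[where \<gamma>=model_ker and X=model])
     (auto simp: closed_csubspace_model model_ker_in cinner_model_ker cinner_KS fock_eval_off
       intro: model_total)

lemma kfun_KS: "z \<in> Ball_d \<Longrightarrow> kfun Ball_d (KS S) z y = fock_eval (model_ker z y)"
  by (rule ext) (simp add: kfun_def eval_model_ker fock_eval_off)

lemma model_ker_0_eq_0:
  assumes "model_ker 0 y = 0" shows "y = 0"
proof -
  note Z = zero_in_Ball_d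
  define u where "u = cadj (S 0) y"
  have "KS S 0 0 y = 0"
    using eval_model_ker[OF Z Z, of y] assms bclin_zero[OF bclin_fock_eval] by metis
  then have y: "y = S 0 u" by (simp add: KS_def dinner_def scaleC_one u_def)
  have "cinner y y = cinner u u" using cinner_S[OF Z, of u y] by (simp add: y[symmetric] u_def[symmetric])
  then have "norm (S 0 u) = norm u" by (simp add: y[symmetric] norm_eq_sqrt_cinner)
  then have "u = 0" using pur by (simp add: pure_schur_def)
  then show ?thesis using y bclin_zero[OF S_op[OF Z]] by simp
qed

lemma shift_model:
  assumes x: "x \<in> model" shows "shift j x \<in> model"
proof -
  have "cinner (shift j x) (mul_S h) = 0" if h: "h \<in> sym_fock" for h
  proof -
    have "mul_S (coord_mult j h) = coord_mult j (mul_S h)"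
      by (rule mul_S_eqI)
         (auto simp: coord_mult_in fock_eval_coord_mult eval_mul_S_at h bclinD(2)[OF S_op])
    then have "cinner x (coord_mult j (mul_S h)) = 0"
      using x coord_mult_in[of j h] unfolding model_def by force
    then show ?thesis by (simp add: cinner_coord_mult model_in_sym_fock x)
  qed
  then show ?thesis using x by (simp add: model_def shift_sym_fock)
qed

section \<open>The row contraction on the model space\<close>

definition T_op :: "'d \<Rightarrow> ('d list, 'y) ell2 \<Rightarrow> ('d list, 'y) ell2" where
  "T_op j x = proj model (cadj (shift j) x)"

definition T_row :: "(('d list, 'y) ell2, 'd) vec \<Rightarrow> ('d list, 'y) ell2" where
  "T_row xs = (\<Sum>j\<in>UNIV. T_op j (xs $ j))"

definition T_col :: "('d list, 'y) ell2 \<Rightarrow> (('d list, 'y) ell2, 'd) vec" where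
  "T_col x = (\<chi> j. shift j (proj model x))"

abbreviation "model_d \<equiv> {xs :: (('d list, 'y) ell2, 'd) vec. \<forall>j. xs $ j \<in> model}"

lemma closed_csubspace_model_d: "closed_csubspace model_d"
  by (rule closed_csubspace_vec[OF closed_csubspace_model])

lemmas csubspace_model_d = closed_csubspaceD(1)[OF closed_csubspace_model_d]

lemma T_op_in: "T_op j x \<in> model"
  unfolding T_op_def by (rule proj_works(1)[OF closed_csubspace_model])

lemma bclin_T_op: "bounded_clinear_op (T_op j)"
  unfolding T_op_def
  by (rule bclin_compose[OF bclin_proj[OF closed_csubspace_model]
        bclin_cadj[OF bclin_shift]])

lemma cinner_T_op: "cinner (T_op j x) x' = cinner x (shift j (proj model x'))"
  by (simp add: T_op_def proj_selfadjoint[OF closed_csubspace_model] cinner_cadj_left[OF bclin_shift])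

lemma bclin_T_row: "bounded_clinear_op T_row"
  unfolding T_row_def
  by (intro bclin_sum_fun bclin_compose[OF bclin_T_op bclin_nth])

lemma bclin_T_col: "bounded_clinear_op T_col"
  unfolding T_col_def
  by (intro bclin_vec bclin_compose[OF bclin_shift]
        bclin_proj closed_csubspace_model)

lemma T_row_in: "T_row xs \<in> model"
  unfolding T_row_def by (intro csubspace_sum csubspace_model T_op_in)

lemma T_col_in: "T_col x \<in> model_d"
  by (simp add: T_col_def shift_model proj_works(1)[OF closed_csubspace_model])

lemma cinner_T_row: "cinner (T_row xs) x = cinner xs (T_col x)"
  by (simp add: T_row_def T_col_def cinner_vec_def cinner_sum_left cinner_T_op)

lemma cinner_T_col: "cinner (T_col x) xs = cinner x (T_row xs)"
  using cinner_T_row cinner_commute by metis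

lemma T_col_model: "x \<in> model \<Longrightarrow> T_col x $ j = shift j x"
  by (simp add: T_col_def proj_id[OF closed_csubspace_model])

lemma cinner_T_col_model:
  assumes "x \<in> model" "x' \<in> model"
  shows "cinner (T_col x) (T_col x') = cinner x x' - cinner (vacuum x) (vacuum x')"
  using fock_split[of x x'] by (simp add: cinner_vec_def T_col_model assms)

lemma norm_T_col_le: "norm (T_col x) \<le> norm x"
proof -
  let ?p = "proj model x"
  have "(norm (T_col x))\<^sup>2 = (\<Sum>j\<in>UNIV. (norm (shift j ?p))\<^sup>2)"
    by (simp add: norm_vec_sq T_col_def)
  also have "\<dots> \<le> (norm ?p)\<^sup>2" using fock_norm_split[of ?p] by simp
  also have "\<dots> \<le> (norm x)\<^sup>2" by (intro power_mono norm_proj_le[OF closed_csubspace_model]) simp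
  finally show ?thesis by (rule power2_le_imp_le) simp
qed

lemma norm_T_row_le: "norm (T_row xs) \<le> norm xs"
proof -
  have "(norm (T_row xs))\<^sup>2 = Re (cinner xs (T_col (T_row xs)))"
    by (simp add: norm_sq_cinner cinner_T_row)
  also have "\<dots> \<le> norm xs * norm (T_col (T_row xs))"
    using Cauchy_Schwarz_cinner complex_Re_le_cmod order_trans by blast
  also have "\<dots> \<le> norm xs * norm (T_row xs)" by (intro mult_left_mono norm_T_col_le) simp
  finally have "norm (T_row xs) * norm (T_row xs) \<le> norm xs * norm (T_row xs)"
    by (simp add: power2_eq_square)
  then show ?thesis by (cases "norm (T_row xs) = 0") (auto simp: mult_le_cancel_right)
qed

definition D_T :: "(('d list, 'y) ell2, 'd) vec \<Rightarrow> (('d list, 'y) ell2, 'd) vec" where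
  "D_T = sqrt_one_minus (\<lambda>xs. T_col (T_row xs))"

definition D_Ts :: "('d list, 'y) ell2 \<Rightarrow> ('d list, 'y) ell2" where
  "D_Ts = sqrt_one_minus (\<lambda>x. T_row (T_col x))"

lemma T_col_row:
  "bounded_clinear_op (\<lambda>xs. T_col (T_row xs))" "norm (T_col (T_row xs)) \<le> norm xs"
  by (auto intro: bclin_compose[OF bclin_T_col bclin_T_row]
      order_trans[OF norm_T_col_le norm_T_row_le])

lemma T_row_col:
  "bounded_clinear_op (\<lambda>x. T_row (T_col x))" "norm (T_row (T_col x)) \<le> norm x"
  by (auto intro: bclin_compose[OF bclin_T_row bclin_T_col]
      order_trans[OF norm_T_row_le norm_T_col_le])

lemma bclin_D_T: "bounded_clinear_op D_T"
  unfolding D_T_def by (rule bclin_sqrt_one_minus[OF T_col_row])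

lemma bclin_D_Ts: "bounded_clinear_op D_Ts"
  unfolding D_Ts_def by (rule bclin_sqrt_one_minus[OF T_row_col])

lemma D_T_square: "D_T (D_T xs) = xs - T_col (T_row xs)"
  unfolding D_T_def by (rule sqrt_one_minus_square[OF T_col_row])

lemma D_Ts_square: "D_Ts (D_Ts x) = x - T_row (T_col x)"
  unfolding D_Ts_def by (rule sqrt_one_minus_square[OF T_row_col])

lemma D_T_selfadjoint: "cinner (D_T xs) ys = cinner xs (D_T ys)"
  unfolding D_T_def by (rule sqrt_one_minus_selfadjoint[OF T_col_row]) (simp add: cinner_T_col cinner_T_row)

lemma D_Ts_selfadjoint: "cinner (D_Ts x) y = cinner x (D_Ts y)"
  unfolding D_Ts_def by (rule sqrt_one_minus_selfadjoint[OF T_row_col]) (simp add: cinner_T_col cinner_T_row)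

lemma D_T_nonneg: "0 \<le> Re (cinner (D_T xs) xs)"
  unfolding D_T_def by (rule sqrt_one_minus_nonneg[OF T_col_row])

lemma D_Ts_nonneg: "0 \<le> Re (cinner (D_Ts x) x)"
  unfolding D_Ts_def by (rule sqrt_one_minus_nonneg[OF T_row_col])

lemma D_T_in: "xs \<in> model_d \<Longrightarrow> D_T xs \<in> model_d"
  unfolding D_T_def by (rule sqrt_one_minus_invariant[OF T_col_row closed_csubspace_model_d T_col_in])

lemma D_Ts_in: "x \<in> model \<Longrightarrow> D_Ts x \<in> model"
  unfolding D_Ts_def by (rule sqrt_one_minus_invariant[OF T_row_col closed_csubspace_model T_row_in])

lemma T_row_D_T: "T_row (D_T xs) = D_Ts (T_row xs)"
  unfolding D_T_def D_Ts_def
  by (rule sqrt_one_minus_intertwine[OF T_col_row T_row_col bclin_T_row refl])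

lemma cinner_D_T: "cinner (D_T xs) (D_T ys) = cinner xs ys - cinner (T_row xs) (T_row ys)"
  by (simp add: D_T_selfadjoint D_T_square cinner_diff_right cinner_T_row)

lemma cinner_D_Ts:
  assumes "x \<in> model" "y \<in> model"
  shows "cinner (D_Ts x) (D_Ts y) = cinner (vacuum x) (vacuum y)"
  using cinner_T_col_model[OF assms] by (simp add: D_Ts_selfadjoint D_Ts_square cinner_diff_right cinner_T_col[symmetric])

end

context inner_pure
begin

section \<open>The unitary colligation\<close>

definition tuple_eval :: "(('d list, 'y) ell2, 'd) vec \<Rightarrow> 'd \<Rightarrow> ('d \<Rightarrow> complex) \<Rightarrow> 'y" where
  "tuple_eval xs = (\<lambda>j. fock_eval (xs $ j))"

definition ker_tuple :: "('d \<Rightarrow> complex) \<Rightarrow> 'y \<Rightarrow> (('d list, 'y) ell2, 'd) vec" where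
  "ker_tuple z y = (\<chi> j. cnj (z j) *\<^sub>C model_ker z y)"

lemma ker_tuple_in: "z \<in> Ball_d \<Longrightarrow> ker_tuple z y \<in> model_d"
  by (simp add: ker_tuple_def model_sub model_ker_in)

lemma tuple_eval_ker_tuple: "z \<in> Ball_d \<Longrightarrow> tuple_eval (ker_tuple z y) = Dgen S z y"
  by (rule ext) (simp add: tuple_eval_def ker_tuple_def Dgen_def fock_eval_scale kfun_KS)

lemma tup_inner_tuple_eval:
  "xs \<in> model_d \<Longrightarrow> ys \<in> model_d \<Longrightarrow> tup_inner S (tuple_eval xs) (tuple_eval ys) = cinner xs ys"
  by (simp add: tup_inner_def tuple_eval_def rk_inner_KS_eval cinner_vec_def)

lemma tuple_eval_eq_0:
  assumes xs: "xs \<in> model_d" and eq: "tuple_eval xs = 0" shows "xs = 0"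
proof -
  have "xs $ j = 0" for j
  proof (rule fock_eval_inj)
    have "fock_eval (xs $ j) = 0" using fun_cong[OF eq, of j] by (simp add: tuple_eval_def)
    then show "fock_eval (xs $ j) = fock_eval 0"
      by (simp add: fock_eval_zero)
  qed (use xs model_in_sym_fock sym_sub(1) in auto)
  then show ?thesis by (simp add: vec_eq_iff)
qed

lemma Dperp_eq:
  "Dperp S = tuple_eval ` {xs \<in> model_d. \<forall>z\<in>Ball_d. \<forall>y. cinner xs (ker_tuple z y) = 0}"
proof (intro equalityI subsetI)
  fix F assume F: "F \<in> Dperp S"
  then have "\<forall>j. \<exists>x\<in>model. F j = fock_eval x" unfolding Dperp_def HKS_eq by blast
  then obtain x where x: "\<And>j. x j \<in> model" "\<And>j. F j = fock_eval (x j)" by metis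
  define xs where "xs = (\<chi> j. x j)"
  have xs: "xs \<in> model_d" "F = tuple_eval xs" by (auto simp: xs_def x tuple_eval_def fun_eq_iff)
  have "cinner xs (ker_tuple z y) = 0" if "z \<in> Ball_d" for z y
  proof -
    have "tup_inner S F (Dgen S z y) = 0" using F that by (simp add: Dperp_def)
    then show ?thesis
      using tup_inner_tuple_eval[OF xs(1) ker_tuple_in[OF that], of y]
      by (simp add: xs(2) tuple_eval_ker_tuple[OF that])
  qed
  then show "F \<in> tuple_eval ` {xs \<in> model_d. \<forall>z\<in>Ball_d. \<forall>y. cinner xs (ker_tuple z y) = 0}"
    using xs by blast
next
  fix F assume "F \<in> tuple_eval ` {xs \<in> model_d. \<forall>z\<in>Ball_d. \<forall>y. cinner xs (ker_tuple z y) = 0}"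
  then obtain xs where xs: "xs \<in> model_d" "F = tuple_eval xs"
    "\<And>z y. z \<in> Ball_d \<Longrightarrow> cinner xs (ker_tuple z y) = 0" by blast
  have "tup_inner S F (Dgen S z y) = 0" if "z \<in> Ball_d" for z y
    using tup_inner_tuple_eval[OF xs(1) ker_tuple_in[OF that], of y] xs(3)[OF that]
    by (simp add: xs(2) tuple_eval_ker_tuple[OF that])
  then show "F \<in> Dperp S" using xs(1) by (auto simp: Dperp_def xs(2) HKS_eq tuple_eval_def)
qed

lemma cinner_ker_tuple:
  assumes "z \<in> Ball_d" "xs \<in> model_d"
  shows "cinner xs (ker_tuple z y) = cinner (\<Sum>j\<in>UNIV. z j *\<^sub>C fock_eval (xs $ j) z) y"
  using assms by (simp add: cinner_vec_def ker_tuple_def cinner_scaleC_right cinner_sum_left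
      cinner_scaleC_left cinner_model_ker)

lemma cinner_ker_tuple_ker_tuple:
  "cinner (ker_tuple z y) (ker_tuple w y') = dinner w z * cinner (model_ker z y) (model_ker w y')"
  by (simp add: cinner_vec_def ker_tuple_def cinner_scaleC_right cinner_scaleC_left dinner_def
      sum_distrib_right mult.assoc)

lemma cinner_model_ker_model_ker:
  assumes z: "z \<in> Ball_d" and w: "w \<in> Ball_d"
  shows "dinner w z * cinner (model_ker z y) (model_ker w y') + cinner y y' =
    cinner (model_ker z y) (model_ker w y') + cinner (cadj (S z) y) (cadj (S w) y')"
proof -
  define k where "k = cinner (model_ker z y) (model_ker w y')"
  have "k = 1 / (1 - dinner w z) * (cinner y y' - cinner (cadj (S z) y) (cadj (S w) y'))"
    unfolding k_def cinner_KS[OF w z, symmetric]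
    by (simp add: KS_def cinner_scaleC_left cinner_diff_left cinner_S[OF w])
  moreover have "dinner w z \<noteq> 1" using norm_dinner_less_1[OF w z] by auto
  ultimately have "k * (1 - dinner w z) = cinner y y' - cinner (cadj (S z) y) (cadj (S w) y')"
    by simp
  then show ?thesis unfolding k_def[symmetric] by (simp add: algebra_simps)
qed

lemma T_col_vacuum_ker_tuple:
  assumes x: "x \<in> model" and z: "z \<in> Ball_d"
  shows "cinner (T_col x) (ker_tuple z y) + cinner (vacuum x) y = cinner x (model_ker z y)"
proof -
  have "cinner (T_col x) (ker_tuple z y) = cinner (\<Sum>j\<in>UNIV. z j *\<^sub>C fock_eval (shift j x) z) y"
    using cinner_ker_tuple[OF z T_col_in, of x y] by (simp add: T_col_model x)
  then have "cinner (T_col x) (ker_tuple z y) + cinner (vacuum x) y = cinner (fock_eval x z) y"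
    by (simp add: fock_eval_shift[OF z, of x] cinner_add_left)
  then show ?thesis by (simp add: cinner_model_ker z x)
qed

lemma fock_eval_ker_0: "z \<in> Ball_d \<Longrightarrow> fock_eval (fock_ker 0 u) z = u"
  by (simp add: fock_eval_fock_ker zero_in_Ball_d kd_kernel_def dinner_def scaleC_one)

lemma model_eval_eq_S_imp_0:
  assumes x: "x \<in> model" and eq: "\<And>z. z \<in> Ball_d \<Longrightarrow> fock_eval x z = S z u"
  shows "x = 0"
proof -
  note k = fock_ker_in_sym_fock[OF zero_in_Ball_d, of u]
  have "mul_S (fock_ker 0 u) = x"
    by (rule mul_S_eqI[OF k model_in_sym_fock[OF x]]) (simp add: eq fock_eval_ker_0)
  then have "cinner x x = 0" using x k unfolding model_def by force
  then show ?thesis by (simp add: cinner_eq_zero_iff)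
qed

text \<open>\<open>(T, B)\<close> is the first column of the unitary \<open>X\<^sup>d \<oplus> Y \<rightarrow> X \<oplus> U\<close>. The complements of
  the spans of the two families with equal Gram matrices are \<open>D\<^sup>\<bottom>\<close> and \<open>U\<^sub>S\<^sup>0\<close>.\<close>

lemma colligation:
  assumes dim: "same_hdim (tup_inner S) (Dperp S) cinner (US0 S)"
  obtains B where
    "\<And>xs ys. xs \<in> model_d \<Longrightarrow> ys \<in> model_d \<Longrightarrow> cinner (B xs) (B ys) = cinner xs ys - cinner (T_row xs) (T_row ys)"
    "\<And>xs z. xs \<in> model_d \<Longrightarrow> z \<in> Ball_d \<Longrightarrow>
      S z (B xs) = (\<Sum>j\<in>UNIV. z j *\<^sub>C fock_eval (xs $ j) z) - fock_eval (T_row xs) z"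
    "\<And>u. (\<And>xs. xs \<in> model_d \<Longrightarrow> cinner u (B xs) = 0) \<Longrightarrow> u = 0"
proof -
  obtain B1 B2 f where onb: "is_onb (tup_inner S) (Dperp S) B1" "is_onb cinner (US0 S) B2"
    and f: "bij_betw f B1 B2"
    using dim unfolding same_hdim_def by blast
  have onb1: "\<And>b. b \<in> B1 \<Longrightarrow> tup_inner S b b = 1"
    "\<And>b c. b \<in> B1 \<Longrightarrow> c \<in> B1 \<Longrightarrow> b \<noteq> c \<Longrightarrow> tup_inner S b c = 0"
    "\<And>F. F \<in> Dperp S \<Longrightarrow> (\<And>b. b \<in> B1 \<Longrightarrow> tup_inner S F b = 0) \<Longrightarrow> F = 0" "B1 \<subseteq> Dperp S"
    using onb(1) by (simp_all add: is_onb_def)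
  have onb2: "\<And>b. b \<in> B2 \<Longrightarrow> cinner b b = 1"
    "\<And>b c. b \<in> B2 \<Longrightarrow> c \<in> B2 \<Longrightarrow> b \<noteq> c \<Longrightarrow> cinner b c = 0"
    "\<And>u. u \<in> US0 S \<Longrightarrow> (\<And>b. b \<in> B2 \<Longrightarrow> cinner u b = 0) \<Longrightarrow> u = 0" "B2 \<subseteq> US0 S"
    using onb(2) by (simp_all add: is_onb_def)
  have "\<forall>b\<in>B1. \<exists>xs. xs \<in> model_d \<and> (\<forall>z\<in>Ball_d. \<forall>y. cinner xs (ker_tuple z y) = 0) \<and> b = tuple_eval xs"
  proof
    fix b assume "b \<in> B1"
    then have "b \<in> Dperp S" using onb1(4) by (rule subsetD[rotated])
    then show "\<exists>xs. xs \<in> model_d \<and> (\<forall>z\<in>Ball_d. \<forall>y. cinner xs (ker_tuple z y) = 0) \<and> b = tuple_eval xs"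
      unfolding Dperp_eq by auto
  qed
  from bchoice[OF this] obtain p where "\<forall>b\<in>B1. p b \<in> model_d \<and>
      (\<forall>z\<in>Ball_d. \<forall>y. cinner (p b) (ker_tuple z y) = 0) \<and> b = tuple_eval (p b)" by blast
  then have p: "\<And>b. b \<in> B1 \<Longrightarrow> p b \<in> model_d"
    "\<And>b z y. b \<in> B1 \<Longrightarrow> z \<in> Ball_d \<Longrightarrow> cinner (p b) (ker_tuple z y) = 0"
    "\<And>b. b \<in> B1 \<Longrightarrow> tuple_eval (p b) = b" by auto
  have p_ip: "cinner xs (p b) = tup_inner S (tuple_eval xs) b" if "b \<in> B1" "xs \<in> model_d" for xs b
    using tup_inner_tuple_eval[OF that(2) p(1)[OF that(1)]] p(3)[OF that(1)] by simp
  have fB: "f b \<in> B2" if "b \<in> B1" for b using f that by (auto simp: bij_betw_def)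
  have fU: "S z (f b) = 0" if "b \<in> B1" "z \<in> Ball_d" for b z
    using onb2(4) fB[OF that(1)] that(2) by (auto simp: US0_def)
  have delta: "cinner (p b) (p c) = cinner (f b) (f c)" if "b \<in> B1" "c \<in> B1" for b c
  proof (cases "b = c")
    case True
    then show ?thesis
      using onb1(1) onb2(1)[OF fB] that p_ip[OF that(2) p(1)[OF that(1)]] p(3)[OF that(1)] by simp
  next
    case False
    then have "f b \<noteq> f c" using f that by (auto simp: bij_betw_def inj_on_def)
    then show ?thesis
      using onb1(2) onb2(2)[OF fB fB] that False p_ip[OF that(2) p(1)[OF that(1)]] p(3)[OF that(1)] by simp
  qed
  define I where "I = Inl ` ((Ball_d :: ('d \<Rightarrow> complex) set) \<times> (UNIV :: 'y set)) \<union> Inr ` B1"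
  define g where "g = case_sum (\<lambda>(z, y). (ker_tuple z y, y)) (\<lambda>b. (p b, 0))"
  define h where "h = case_sum (\<lambda>(z, y). (model_ker z y, cadj (S z) y)) (\<lambda>b. (0, f b))"
  let ?V1 = "model_d \<times> (UNIV :: 'y set)" and ?V2 = "model \<times> (UNIV :: 'u set)"
  have V1: "closed_csubspace ?V1"
    by (rule closed_csubspace_Times[OF closed_csubspace_model_d closed_csubspace_UNIV])
  have V2: "closed_csubspace ?V2"
    by (rule closed_csubspace_Times[OF closed_csubspace_model closed_csubspace_UNIV])
  have gV: "g i \<in> ?V1" if "i \<in> I" for i
    using that ker_tuple_in p(1) by (auto simp: I_def g_def)
  have hV: "h i \<in> ?V2" if "i \<in> I" for i
    using that model_ker_in model_sub(1) by (auto simp: I_def h_def)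
  have fU': "cinner (cadj (S z) y) (f b) = 0" if "b \<in> B1" "z \<in> Ball_d" for b z y
    using cinner_S[OF that(2), of "f b" y] fU[OF that] by (simp add: cinner_eq_0_commute[of "cadj (S z) y"])
  have gram: "cinner (g i) (g j) = cinner (h i) (h j)" if ij: "i \<in> I" "j \<in> I" for i j
  proof -
    consider (a) z y w y' where "i = Inl (z, y)" "j = Inl (w, y')" "z \<in> Ball_d" "w \<in> Ball_d"
      | (b) z y b where "i = Inl (z, y)" "j = Inr b" "z \<in> Ball_d" "b \<in> B1"
      | (c) z y b where "i = Inr b" "j = Inl (z, y)" "z \<in> Ball_d" "b \<in> B1"
      | (d) b c where "i = Inr b" "j = Inr c" "b \<in> B1" "c \<in> B1"
      using ij unfolding I_def by blast
    then show ?thesis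
    proof cases
      case a
      then show ?thesis
        by (simp add: g_def h_def cinner_ker_tuple_ker_tuple cinner_model_ker_model_ker)
    next
      case b
      then show ?thesis using p(2)[of b z y] fU'[of b z y]
        by (simp add: g_def h_def cinner_eq_0_commute[of "ker_tuple z y"])
    next
      case c
      then show ?thesis using p(2)[of b z y] fU'[of b z y]
        by (simp add: g_def h_def cinner_eq_0_commute[of "f b"])
    next
      case d
      then show ?thesis by (simp add: g_def h_def delta)
    qed
  qed
  have tot1: "q = 0" if q: "q \<in> ?V1" "\<And>i. i \<in> I \<Longrightarrow> cinner q (g i) = 0" for q
  proof -
    obtain xs y' where q_eq: "q = (xs, y')" and xs: "xs \<in> model_d" using q(1) by auto
    have L: "cinner xs (ker_tuple z y) + cinner y' y = 0" if "z \<in> Ball_d" for z y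
      using q(2)[of "Inl (z, y)"] that by (simp add: I_def g_def q_eq)
    have "cinner y' y = 0" for y
      using L[OF zero_in_Ball_d, of y] cinner_ker_tuple[OF zero_in_Ball_d xs] by simp
    then have y': "y' = 0" using cinner_eq_zero_iff by blast
    have "tuple_eval xs \<in> Dperp S" unfolding Dperp_eq using xs L y' by auto
    moreover have "tup_inner S (tuple_eval xs) b = 0" if "b \<in> B1" for b
      using q(2)[of "Inr b"] that p_ip[OF that xs] by (simp add: I_def g_def q_eq)
    ultimately have "tuple_eval xs = 0" by (rule onb1(3))
    then show ?thesis using tuple_eval_eq_0[OF xs] y' by (simp add: q_eq zero_prod_def)
  qed
  have tot2: "q = 0" if q: "q \<in> ?V2" "\<And>i. i \<in> I \<Longrightarrow> cinner q (h i) = 0" for q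
  proof -
    obtain x u where q_eq: "q = (x, u)" and x: "x \<in> model" using q(1) by auto
    have "fock_eval x z = S z (- u)" if z: "z \<in> Ball_d" for z
    proof (rule cinner_extI)
      fix y
      have "cinner x (model_ker z y) + cinner u (cadj (S z) y) = 0"
        using q(2)[of "Inl (z, y)"] z by (simp add: I_def h_def q_eq)
      then show "cinner (fock_eval x z) y = cinner (S z (- u)) y"
        by (simp add: cinner_model_ker z x cinner_S cinner_minus_left add_eq_0_iff2)
    qed
    note ev = this
    have x0: "x = 0" by (rule model_eval_eq_S_imp_0[OF x ev])
    have "S z u = 0" if "z \<in> Ball_d" for z
      using ev[OF that] x0 bclin_uminus[OF S_op[OF that]] by (simp add: fock_eval_zero)
    then have "u \<in> US0 S" by (simp add: US0_def)
    moreover have "cinner u c = 0" if c: "c \<in> B2" for c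
    proof -
      obtain b where b: "b \<in> B1" "c = f b" using f c by (auto simp: bij_betw_def)
      then show ?thesis using q(2)[of "Inr b"] by (simp add: I_def h_def q_eq)
    qed
    ultimately have "u = 0" by (rule onb2(3))
    then show ?thesis by (simp add: q_eq x0 zero_prod_def)
  qed
  have "\<exists>W. (\<forall>i\<in>I. W (g i) = h i) \<and> unitary_on ?V1 ?V2 W"
    by (rule unitary_of_gram[OF V1 V2]) (fact gV, fact hV, fact gram, fact tot1, fact tot2)
  then obtain W where W0: "\<forall>i\<in>I. W (g i) = h i" and U: "unitary_on ?V1 ?V2 W" by (elim exE conjE)
  have W: "W (g i) = h i" if "i \<in> I" for i using W0 that by (rule bspec)
  note W2 = unitary_onD(3)[OF U] and W3 = unitary_onD(4)[OF U]
  have W_ker: "W (ker_tuple z y, y) = (model_ker z y, cadj (S z) y)" if "z \<in> Ball_d" for z y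
    using W[of "Inl (z, y)"] that by (simp add: I_def g_def h_def)
  have W_col: "W (T_col x, vacuum x) = (x, 0)" if x: "x \<in> model" for x
  proof -
    have in1: "(T_col x, vacuum x) \<in> ?V1" using T_col_in by simp
    have "W (T_col x, vacuum x) - (x, 0) = 0"
    proof (rule tot2)
      show "W (T_col x, vacuum x) - (x, 0) \<in> ?V2"
        using W3 in1 x by (intro csubspace_diff[OF closed_csubspaceD(1)[OF V2]]) auto
      fix i assume i: "i \<in> I"
      have "cinner (W (T_col x, vacuum x)) (h i) = cinner (T_col x, vacuum x) (g i)"
        using W[OF i] W2[OF in1 gV[OF i]] by simp
      also have "\<dots> = cinner (x, 0) (h i)"
      proof -
        consider (a) z y where "i = Inl (z, y)" "z \<in> Ball_d" | (b) b where "i = Inr b" "b \<in> B1"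
          using i unfolding I_def by blast
        then show ?thesis
        proof cases
          case a
          then show ?thesis by (simp add: g_def h_def T_col_vacuum_ker_tuple x)
        next
          case b
          define s where "s = (\<Sum>j\<in>UNIV. coord_mult j (p b $ j))"
          have sin: "s \<in> sym_fock"
            unfolding s_def
            by (intro csubspace_sum csubspace_sym_fock coord_mult_in)
          have "s = 0"
          proof (rule sym_fock_total[OF sin])
            fix z y assume z: "(z :: 'd \<Rightarrow> complex) \<in> Ball_d"
            show "cinner s (fock_ker z y) = 0"
              using p(2)[OF b(2) z, of y] cinner_ker_tuple[OF z p(1)[OF b(2)], of y]
              by (simp add: s_def cinner_fock_eval[OF z, symmetric] fock_eval_coord_mult[OF z]
                  bclin_sum[OF bclin_fock_eval])
          qed
          then have "cinner x s = 0" by simp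
          then have "cinner (T_col x) (p b) = 0"
            using x by (simp add: s_def cinner_sum_right cinner_coord_mult model_in_sym_fock cinner_vec_def T_col_model)
          then show ?thesis using b by (simp add: g_def h_def)
        qed
      qed
      finally show "cinner (W (T_col x, vacuum x) - (x, 0)) (h i) = 0" by (simp add: cinner_diff_left)
    qed
    then show ?thesis by simp
  qed
  have fstW: "fst (W (xs, 0)) = T_row xs" if xs: "xs \<in> model_d" for xs
  proof -
    have in1: "(xs, 0) \<in> ?V1" using xs by simp
    have "W (xs, 0) \<in> ?V2" using imageI[OF in1, of W] unfolding W3 .
    then have fin: "fst (W (xs, 0)) \<in> model" by (simp add: mem_Times_iff)
    have "cinner (fst (W (xs, 0))) x = cinner (T_row xs) x" if x: "x \<in> model" for x
    proof -
      have "cinner (fst (W (xs, 0))) x = cinner (W (xs, 0)) (x, 0)" by (simp add: cinner_prod_def)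
      also have "\<dots> = cinner (W (xs, 0)) (W (T_col x, vacuum x))" by (simp add: W_col x)
      also have "\<dots> = cinner xs (T_col x)" using W2[OF in1, of "(T_col x, vacuum x)"] T_col_in by simp
      finally show ?thesis by (simp add: cinner_T_row)
    qed
    from this[of "fst (W (xs, 0)) - T_row xs"]
    have "cinner (fst (W (xs, 0)) - T_row xs) (fst (W (xs, 0)) - T_row xs) = 0"
      using csubspace_diff[OF csubspace_model fin T_row_in[of xs]] by (simp add: cinner_diff_left)
    then show ?thesis by (simp add: cinner_eq_zero_iff)
  qed
  define B where "B xs = snd (W (xs, 0))" for xs
  have WB: "W (xs, 0) = (T_row xs, B xs)" if "xs \<in> model_d" for xs
    using fstW[OF that] by (simp add: B_def prod_eq_iff)
  show ?thesis
  proof (rule that[of B])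
    fix xs ys assume xs: "xs \<in> model_d" and ys: "ys \<in> model_d"
    then show "cinner (B xs) (B ys) = cinner xs ys - cinner (T_row xs) (T_row ys)"
      using W2[of "(xs, 0)" "(ys, 0)"] by (simp add: WB[OF xs] WB[OF ys] algebra_simps)
  next
    fix xs and z :: "'d \<Rightarrow> complex" assume xs: "xs \<in> model_d" and z: "z \<in> Ball_d"
    show "S z (B xs) = (\<Sum>j\<in>UNIV. z j *\<^sub>C fock_eval (xs $ j) z) - fock_eval (T_row xs) z"
    proof (rule cinner_extI)
      fix y
      have "cinner (W (xs, 0)) (W (ker_tuple z y, y)) = cinner (xs, 0) (ker_tuple z y, y)"
        using xs ker_tuple_in[OF z] by (intro W2) auto
      then have "cinner (T_row xs) (model_ker z y) + cinner (B xs) (cadj (S z) y) = cinner xs (ker_tuple z y)"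
        by (simp add: WB[OF xs] W_ker[OF z])
      then show "cinner (S z (B xs)) y =
          cinner ((\<Sum>j\<in>UNIV. z j *\<^sub>C fock_eval (xs $ j) z) - fock_eval (T_row xs) z) y"
        unfolding cinner_diff_left cinner_ker_tuple[OF z xs, symmetric]
        by (simp add: cinner_S z cinner_model_ker T_row_in algebra_simps)
    qed
  next
    fix u assume u: "\<And>xs. xs \<in> model_d \<Longrightarrow> cinner u (B xs) = 0"
    have "(0, u) \<in> W ` ?V1" using W3 model_sub(1) by simp
    then obtain xs y where xs: "xs \<in> model_d" and Wu: "W (xs, y) = (0, u)" by auto
    have "cinner (xs, y) (xs, 0) = cinner (0, u) (T_row xs, B xs)"
      using W2[of "(xs, y)" "(xs, 0)"] xs by (simp add: Wu WB[OF xs])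
    then have "cinner xs xs = 0" using u[OF xs] by simp
    then have "xs = 0" by (simp add: cinner_eq_zero_iff)
    moreover have "ker_tuple 0 y = 0" by (simp add: ker_tuple_def vec_eq_iff)
    ultimately have *: "(0, u) = (model_ker 0 y, cadj (S 0) y)"
      using W_ker[OF zero_in_Ball_d, of y] Wu by simp
    then have "y = 0" using model_ker_0_eq_0[of y] by simp
    then show "u = 0" using * bclin_zero[OF bclin_cadj[OF S_op[OF zero_in_Ball_d]]]
      by simp
  qed
qed

section \<open>The characteristic function\<close>

definition shift_comb :: "('d \<Rightarrow> complex) \<Rightarrow> ('d list, 'y) ell2 \<Rightarrow> ('d list, 'y) ell2" where
  "shift_comb z x = (\<Sum>j\<in>UNIV. z j *\<^sub>C shift j x)"

lemma bclin_shift_comb: "bounded_clinear_op (shift_comb z)"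
  unfolding shift_comb_def
  by (intro bclin_sum_fun bclin_scaleC bclin_shift)

lemma shift_comb_model: "x \<in> model \<Longrightarrow> shift_comb z x \<in> model"
  unfolding shift_comb_def by (intro csubspace_sum csubspace_model model_sub(3) shift_model)

lemma norm_shift_comb_le:
  "norm (shift_comb z x) \<le> L2_set (\<lambda>j. cmod (z j)) UNIV * norm x"
proof -
  have "norm (shift_comb z x) \<le> (\<Sum>j\<in>UNIV. \<bar>cmod (z j)\<bar> * \<bar>norm (shift j x)\<bar>)"
    unfolding shift_comb_def by (rule order_trans[OF norm_sum]) (simp add: norm_scaleC)
  also have "\<dots> \<le> L2_set (\<lambda>j. cmod (z j)) UNIV * L2_set (\<lambda>j. norm (shift j x)) UNIV"
    by (rule L2_set_mult_ineq)
  also have "L2_set (\<lambda>j. norm (shift j x)) UNIV \<le> norm x"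
    unfolding L2_set_def using fock_norm_split[of x] by (intro real_le_lsqrt) (auto simp: sum_nonneg)
  finally show ?thesis by (simp add: mult_left_mono L2_set_nonneg)
qed

definition res :: "('d \<Rightarrow> complex) \<Rightarrow> ('d list, 'y) ell2 \<Rightarrow> ('d list, 'y) ell2" where
  "res z x = (THE f. f \<in> model \<and> f - shift_comb z f = x)"

lemma ball_L2_less_1: "z \<in> Ball_d \<Longrightarrow> L2_set (\<lambda>j. cmod (z j)) UNIV < 1"
  by (simp add: Ball_d_iff L2_set_def)

lemma res_unique:
  assumes z: "z \<in> Ball_d" and x: "x \<in> model"
  shows "\<exists>!f. f \<in> model \<and> f - shift_comb z f = x"
proof -
  let ?r = "L2_set (\<lambda>j. cmod (z j)) UNIV"
  have "\<exists>!f\<in>model. x + shift_comb z f = f"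
  proof (rule Banach_fix[where c="?r"])
    show "complete model" using closed_csubspace_model by (simp add: complete_eq_closed closed_csubspaceD)
    show "model \<noteq> {}" using model_sub(1) by blast
    show "(\<lambda>f. x + shift_comb z f) ` model \<subseteq> model" using x by (auto simp: model_sub shift_comb_model)
    show "dist (x + shift_comb z f) (x + shift_comb z g) \<le> ?r * dist f g" for f g
      using norm_shift_comb_le[of z "f - g"]
      by (simp add: dist_norm bclin_diff[OF bclin_shift_comb])
  qed (use ball_L2_less_1[OF z] in \<open>auto simp: L2_set_nonneg\<close>)
  moreover have "x + shift_comb z f = f \<longleftrightarrow> f - shift_comb z f = x" for f
    by (auto simp: algebra_simps)
  ultimately show ?thesis by simp
qed

lemma res:
  assumes "z \<in> Ball_d" "x \<in> model"
  shows "res z x \<in> model" "res z x - shift_comb z (res z x) = x"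
  using theI'[OF res_unique[OF assms]] unfolding res_def by blast+

lemma res_eqI:
  assumes "z \<in> Ball_d" "f \<in> model" "f - shift_comb z f = x" shows "res z x = f"
proof -
  have "x \<in> model" using assms shift_comb_model csubspace_diff[OF csubspace_model] by blast
  then show ?thesis using res_unique[OF assms(1)] res[OF assms(1)] assms by blast
qed

lemma res_diff:
  assumes "z \<in> Ball_d" "x \<in> model" "y \<in> model" shows "res z (x - y) = res z x - res z y"
proof (rule res_eqI[OF assms(1)])
  show "res z x - res z y \<in> model" by (intro csubspace_diff csubspace_model res assms)
  show "res z x - res z y - shift_comb z (res z x - res z y) = x - y"
    using arg_cong2[where f="(-)", OF res(2)[OF assms(1,2)] res(2)[OF assms(1,3)]]
    by (simp only: bclin_diff[OF bclin_shift_comb]) (simp add: algebra_simps)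
qed

lemma norm_res_le:
  assumes z: "z \<in> Ball_d" and x: "x \<in> model"
  shows "norm (res z x) \<le> norm x / (1 - L2_set (\<lambda>j. cmod (z j)) UNIV)"
proof -
  have "norm (res z x) \<le> norm x + norm (shift_comb z (res z x))"
    using norm_triangle_ineq[of x "shift_comb z (res z x)"] res(2)[OF z x] by (simp add: algebra_simps)
  then have "norm (res z x) * (1 - L2_set (\<lambda>j. cmod (z j)) UNIV) \<le> norm x"
    using norm_shift_comb_le[of z "res z x"] by (simp add: algebra_simps)
  then show ?thesis using ball_L2_less_1[OF z] by (simp add: field_simps)
qed

lemma res_tendsto:
  assumes z: "z \<in> Ball_d" and f: "\<And>n. f n \<in> model" "x \<in> model" "f \<longlonglongrightarrow> x"
  shows "(\<lambda>n. res z (f n)) \<longlonglongrightarrow> res z x"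
proof -
  have "(\<lambda>n. res z (f n) - res z x) \<longlonglongrightarrow> 0"
  proof (rule Lim_null_comparison)
    show "\<forall>\<^sub>F n in sequentially. norm (res z (f n) - res z x) \<le>
        norm (f n - x) / (1 - L2_set (\<lambda>j. cmod (z j)) UNIV)"
      using norm_res_le[OF z csubspace_diff[OF csubspace_model f(1) f(2)]]
      by (simp add: res_diff z f(1,2))
    have "(\<lambda>n. norm (f n - x) / (1 - L2_set (\<lambda>j. cmod (z j)) UNIV)) \<longlonglongrightarrow> 0 / (1 - L2_set (\<lambda>j. cmod (z j)) UNIV)"
      using ball_L2_less_1[OF z] f(3) by (intro tendsto_divide tendsto_norm_zero LIM_zero tendsto_const) auto
    then show "(\<lambda>n. norm (f n - x) / (1 - L2_set (\<lambda>j. cmod (z j)) UNIV)) \<longlonglongrightarrow> 0" by simp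
  qed
  then show ?thesis by (rule LIM_zero_cancel)
qed

lemma vacuum_res:
  assumes z: "z \<in> Ball_d" and x: "x \<in> model" shows "vacuum (res z x) = fock_eval x z"
proof -
  let ?f = "res z x"
  have "fock_eval x z = fock_eval ?f z - (\<Sum>j\<in>UNIV. z j *\<^sub>C fock_eval (shift j ?f) z)"
    by (subst res(2)[OF z x, symmetric])
       (simp add: shift_comb_def fock_eval_diff bclin_sum[OF bclin_fock_eval]
         fock_eval_scale fscale_def bclinD(2)[OF bclin_fock_eval])
  then show ?thesis using fock_eval_shift[OF z, of ?f] by simp
qed

definition char_fun :: "('d \<Rightarrow> complex) \<Rightarrow> (('d list, 'y) ell2, 'd) vec \<Rightarrow> ('d list, 'y) ell2" where
  "char_fun z xs = - T_row xs + D_Ts (res z (\<Sum>j\<in>UNIV. z j *\<^sub>C (D_T xs $ j)))"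

lemma comb_in_model: "xs \<in> model_d \<Longrightarrow> (\<Sum>j\<in>UNIV. z j *\<^sub>C (xs $ j)) \<in> model"
  by (intro csubspace_sum csubspace_model model_sub(3)) auto

lemma char_fun_D_T:
  assumes z: "z \<in> Ball_d" and xs: "xs \<in> model_d"
  shows "char_fun z (D_T xs) = D_Ts (res z ((\<Sum>j\<in>UNIV. z j *\<^sub>C (xs $ j)) - T_row xs))"
proof -
  let ?a = "\<Sum>j\<in>UNIV. z j *\<^sub>C (xs $ j)" and ?t = "T_row xs"
  have a: "?a \<in> model" by (rule comb_in_model[OF xs])
  have t: "?t \<in> model" by (rule T_row_in)
  have "(\<Sum>j\<in>UNIV. z j *\<^sub>C (D_T (D_T xs) $ j)) = (?a - ?t) - (shift_comb z ?t - ?t)"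
    by (simp add: D_T_square T_col_model t scaleC_diff_right sum_subtractf shift_comb_def)
  also have "res z \<dots> = res z (?a - ?t) - res z (shift_comb z ?t - ?t)"
    by (intro res_diff z csubspace_diff csubspace_model a t shift_comb_model)
  also have "res z (shift_comb z ?t - ?t) = - ?t"
    by (rule res_eqI[OF z]) (use t in \<open>auto simp: csubspace_uminus[OF csubspace_model]
         bclin_uminus[OF bclin_shift_comb]\<close>)
  finally have "res z (\<Sum>j\<in>UNIV. z j *\<^sub>C (D_T (D_T xs) $ j)) = res z (?a - ?t) + ?t" by simp
  then show ?thesis
    by (simp add: char_fun_def T_row_D_T bclinD(1)[OF bclin_D_Ts])
qed

lemma char_fun_coincides:
  assumes dim: "same_hdim (tup_inner S) (Dperp S) cinner (US0 S)"
  defines "E \<equiv> closure (D_T ` model_d)" and "Es \<equiv> closure (D_Ts ` model)"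
  obtains \<alpha> \<beta> where "unitary_on Es UNIV \<alpha>" "unitary_on E UNIV \<beta>"
    "\<And>z xs. z \<in> Ball_d \<Longrightarrow> xs \<in> E \<Longrightarrow> char_fun z xs \<in> Es \<and> S z (\<beta> xs) = \<alpha> (char_fun z xs)"
proof -
  obtain B where B: "\<And>xs ys. xs \<in> model_d \<Longrightarrow> ys \<in> model_d \<Longrightarrow> cinner (B xs) (B ys) = cinner xs ys - cinner (T_row xs) (T_row ys)"
    "\<And>xs z. xs \<in> model_d \<Longrightarrow> z \<in> Ball_d \<Longrightarrow>
      S z (B xs) = (\<Sum>j\<in>UNIV. z j *\<^sub>C fock_eval (xs $ j) z) - fock_eval (T_row xs) z"
    "\<And>u. (\<And>xs. xs \<in> model_d \<Longrightarrow> cinner u (B xs) = 0) \<Longrightarrow> u = 0"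
    using colligation[OF dim] by blast
  have E: "closed_csubspace E" unfolding E_def
    by (intro closed_csubspace_closure csubspace_image[OF bclin_D_T]
        csubspace_model_d)
  have Es: "closed_csubspace Es" unfolding Es_def
    by (intro closed_csubspace_closure csubspace_image[OF bclin_D_Ts] csubspace_model)
  have inE: "D_T xs \<in> E" if "xs \<in> model_d" for xs
    unfolding E_def by (rule subsetD[OF closure_subset imageI[OF that]])
  have inEs: "D_Ts x \<in> Es" if "x \<in> model" for x
    unfolding Es_def by (rule subsetD[OF closure_subset imageI[OF that]])
  have "\<exists>\<alpha>. (\<forall>x\<in>model. \<alpha> (D_Ts x) = vacuum x) \<and> unitary_on Es UNIV \<alpha>"
  proof (rule unitary_of_gram[OF Es closed_csubspace_UNIV])
    show "x = 0" if "x \<in> Es" "\<And>i. i \<in> model \<Longrightarrow> cinner x (D_Ts i) = 0" for x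
      using that unfolding Es_def by (intro closure_orth_eq_0[of x "D_Ts ` model"]) auto
    show "y = 0" if "\<And>i. i \<in> model \<Longrightarrow> cinner y (vacuum i) = 0" for y
    proof (rule model_ker_0_eq_0)
      have "cinner (vacuum i) y = 0" if "i \<in> model" for i
        using \<open>\<And>i. i \<in> model \<Longrightarrow> cinner y (vacuum i) = 0\<close>[OF that] by (simp add: cinner_eq_0_commute)
      then have "cinner i (model_ker 0 y) = 0" if "i \<in> model" for i
        using that by (simp add: cinner_model_ker[OF zero_in_Ball_d, symmetric] fock_eval_0)
      from this[OF model_ker_in[OF zero_in_Ball_d, of y]] show "model_ker 0 y = 0"
        by (simp add: cinner_eq_zero_iff)
    qed
  qed (auto simp: inEs cinner_D_Ts)
  then obtain \<alpha> where \<alpha>: "\<And>x. x \<in> model \<Longrightarrow> \<alpha> (D_Ts x) = vacuum x" and ua: "unitary_on Es UNIV \<alpha>"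
    by blast
  have "\<exists>\<beta>. (\<forall>x\<in>model_d. \<beta> (D_T x) = B x) \<and> unitary_on E UNIV \<beta>"
  proof (rule unitary_of_gram[OF E closed_csubspace_UNIV])
    show "x = 0" if "x \<in> E" "\<And>i. i \<in> model_d \<Longrightarrow> cinner x (D_T i) = 0" for x
      using that unfolding E_def by (intro closure_orth_eq_0[of x "D_T ` model_d"]) auto
    show "u = 0" if "\<And>i. i \<in> model_d \<Longrightarrow> cinner u (B i) = 0" for u
      using B(3) that by blast
    show "cinner (D_T i) (D_T j) = cinner (B i) (B j)" if "i \<in> model_d" "j \<in> model_d" for i j
      using that by (simp only: cinner_D_T B(1))
  qed (auto simp: inE)
  then obtain \<beta> where \<beta>: "\<And>x. x \<in> model_d \<Longrightarrow> \<beta> (D_T x) = B x" and ub: "unitary_on E UNIV \<beta>"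
    by blast
  have main: "char_fun z xs \<in> Es \<and> S z (\<beta> xs) = \<alpha> (char_fun z xs)" if z: "z \<in> Ball_d" and xs: "xs \<in> E" for z xs
  proof -
    obtain q where q: "\<And>n. q n \<in> D_T ` model_d" "q \<longlonglongrightarrow> xs"
      using xs unfolding E_def closure_sequential by metis
    then have "\<forall>n. \<exists>p. p \<in> model_d \<and> q n = D_T p" by blast
    then obtain p where p: "\<And>n. p n \<in> model_d" "\<And>n. q n = D_T (p n)" by metis
    have lim: "(\<lambda>n. D_T (p n)) \<longlonglongrightarrow> xs" using q(2) unfolding p(2)[symmetric] .
    let ?g = "\<lambda>n. (\<Sum>j\<in>UNIV. z j *\<^sub>C (p n $ j)) - T_row (p n)"
    have g_in: "?g n \<in> model" for n
      by (intro csubspace_diff csubspace_model comb_in_model T_row_in p)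
    have cf: "char_fun z (D_T (p n)) = D_Ts (res z (?g n))" for n
      by (rule char_fun_D_T[OF z p(1)])
    have cf_in: "char_fun z (D_T (p n)) \<in> Es" for n
      unfolding cf by (intro inEs res z g_in)
    have eq: "S z (\<beta> (D_T (p n))) = \<alpha> (char_fun z (D_T (p n)))" for n
    proof -
      have "\<alpha> (char_fun z (D_T (p n))) = fock_eval (?g n) z"
        unfolding cf by (simp only: \<alpha>[OF res(1)[OF z g_in]] vacuum_res[OF z g_in])
      also have "\<dots> = (\<Sum>j\<in>UNIV. z j *\<^sub>C fock_eval (p n $ j) z) - fock_eval (T_row (p n)) z"
        by (simp add: bclin_diff[OF bclin_fock_eval]
            bclin_sum[OF bclin_fock_eval]
            bclinD(2)[OF bclin_fock_eval])
      finally show ?thesis by (simp only: \<beta>[OF p(1)] B(2)[OF p(1) z])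
    qed
    have xsd: "xs \<in> model_d"
      using closed_sequentially[OF closed_csubspaceD(2)[OF closed_csubspace_model_d] D_T_in[OF p(1)] lim] .
    have cf_lim: "(\<lambda>n. char_fun z (D_T (p n))) \<longlonglongrightarrow> char_fun z xs"
      unfolding char_fun_def
    proof (intro tendsto_add tendsto_minus bclin_tendsto[OF bclin_T_row lim]
        bclin_tendsto[OF bclin_D_Ts] res_tendsto z comb_in_model D_T_in p xsd)
      show "(\<lambda>n. \<Sum>j\<in>UNIV. z j *\<^sub>C (D_T (D_T (p n)) $ j)) \<longlonglongrightarrow> (\<Sum>j\<in>UNIV. z j *\<^sub>C (D_T xs $ j))"
        by (intro tendsto_sum bclin_tendsto[OF bclin_scaleC[OF bclin_nth]]
            bclin_tendsto[OF bclin_D_T] lim)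
    qed
    have cfE: "char_fun z xs \<in> Es"
      using closed_sequentially[OF closed_csubspaceD(2)[OF Es] cf_in cf_lim] .
    have "(\<lambda>n. S z (\<beta> (D_T (p n)))) \<longlonglongrightarrow> S z (\<beta> xs)"
      by (rule bclin_tendsto[OF S_op[OF z] isometry_tendsto[where W=\<beta>, OF unitary_onD(3)[OF ub] inE[OF p(1)] xs lim]])
    moreover have "(\<lambda>n. \<alpha> (char_fun z (D_T (p n)))) \<longlonglongrightarrow> \<alpha> (char_fun z xs)"
      by (rule isometry_tendsto[where W=\<alpha>, OF unitary_onD(3)[OF ua] cf_in cfE cf_lim])
    ultimately have "S z (\<beta> xs) = \<alpha> (char_fun z xs)"
      unfolding eq by (rule LIMSEQ_unique)
    then show ?thesis using cfE by blast
  qed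
  show ?thesis by (rule that[OF ua ub main])
qed

end

section \<open>Strong stability\<close>

lemma finite_multi_indices: "finite {n :: 'd::finite \<Rightarrow> nat. sum n UNIV = N}"
proof (rule finite_subset)
  show "{n :: 'd \<Rightarrow> nat. sum n UNIV = N} \<subseteq> PiE UNIV (\<lambda>_. {..N})"
    by (auto simp: PiE_def extensional_def intro: member_le_sum)
qed (simp add: finite_PiE)

lemma sum_fun_upd_Suc:
  "sum (n(j := Suc (n j))) UNIV = Suc (sum (n :: 'd::finite \<Rightarrow> nat) UNIV)"
  by (simp add: sum.remove[of UNIV j])

lemma prod_fact_upd_Suc:
  "(\<Prod>i\<in>UNIV. fact ((n(j := Suc (n j))) i)) = real (Suc (n j)) * (\<Prod>i\<in>UNIV. fact (n i))"
  for n :: "'d::finite \<Rightarrow> nat"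
  by (simp add: prod.remove[of UNIV j])

lemma multinomial_sum_Suc:
  fixes a :: "('d::finite \<Rightarrow> nat) \<Rightarrow> real"
  shows "(\<Sum>n\<in>{n. sum n UNIV = Suc N}. (fact (Suc N) / (\<Prod>j\<in>UNIV. fact (n j))) * a n) =
    (\<Sum>j\<in>UNIV. \<Sum>n\<in>{n. sum n UNIV = N}. (fact N / (\<Prod>j\<in>UNIV. fact (n j))) * a (n(j := Suc (n j))))"
proof -
  define c where "c n = fact N / (\<Prod>j\<in>UNIV. fact (n j)) * a n" for n :: "'d \<Rightarrow> nat"
  have "(\<Sum>n\<in>{n. sum n UNIV = Suc N}. (fact (Suc N) / (\<Prod>j\<in>UNIV. fact (n j))) * a n) =
     (\<Sum>n\<in>{n. sum n UNIV = Suc N}. \<Sum>j\<in>UNIV. real (n j) * c n)"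
  proof (rule sum.cong[OF refl])
    fix n :: "'d \<Rightarrow> nat" assume "n \<in> {n. sum n UNIV = Suc N}"
    then have "(\<Sum>j\<in>UNIV. real (n j)) = real (Suc N)" by (simp flip: of_nat_sum)
    then have "(\<Sum>j\<in>UNIV. real (n j) * c n) = real (Suc N) * c n" by (simp flip: sum_distrib_right)
    then show "(fact (Suc N) / (\<Prod>j\<in>UNIV. fact (n j))) * a n = (\<Sum>j\<in>UNIV. real (n j) * c n)"
      by (simp add: c_def)
  qed
  also have "\<dots> = (\<Sum>j\<in>UNIV. \<Sum>n\<in>{n. sum n UNIV = Suc N}. real (n j) * c n)" by (rule sum.swap)
  also have "\<dots> = (\<Sum>j\<in>UNIV. \<Sum>n\<in>{n. sum n UNIV = N}. (fact N / (\<Prod>j\<in>UNIV. fact (n j))) * a (n(j := Suc (n j))))"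
  proof (rule sum.cong[OF refl])
    fix j :: 'd
    have "(\<Sum>n\<in>{n. sum n UNIV = Suc N}. real (n j) * c n) =
        (\<Sum>n\<in>{n. sum n UNIV = Suc N \<and> n j > 0}. real (n j) * c n)"
      by (rule sum.mono_neutral_right[OF finite_multi_indices]) auto
    also have "\<dots> = (\<Sum>n\<in>{n. sum n UNIV = N}. (fact N / (\<Prod>j\<in>UNIV. fact (n j))) * a (n(j := Suc (n j))))"
    proof (rule sum.reindex_bij_witness[where j="\<lambda>n. n(j := n j - 1)" and i="\<lambda>n. n(j := Suc (n j))"])
      fix n :: "'d \<Rightarrow> nat" assume n: "n \<in> {n. sum n UNIV = Suc N \<and> n j > 0}"
      define m where "m = n(j := n j - 1)"
      have nm: "n = m(j := Suc (m j))" using n by (auto simp: m_def)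
      show "(n(j := n j - 1))(j := Suc ((n(j := n j - 1)) j)) = n" using nm by (simp add: m_def)
      have "sum n UNIV = Suc (sum m UNIV)" by (subst nm) (rule sum_fun_upd_Suc)
      then show "n(j := n j - 1) \<in> {n. sum n UNIV = N}"
        using n unfolding m_def[symmetric] by simp
      have "real (n j) * c n = (fact N / (\<Prod>j\<in>UNIV. fact (m j))) * a n"
        unfolding c_def by (subst (2) nm, subst prod_fact_upd_Suc) (subst nm, simp)
      then show "fact N / (\<Prod>ja\<in>UNIV. fact ((n(j := n j - 1)) ja)) *
          a ((n(j := n j - 1))(j := Suc ((n(j := n j - 1)) j))) = real (n j) * c n"
        unfolding m_def[symmetric] nm[symmetric] by simp
    next
      fix n :: "'d \<Rightarrow> nat" assume n: "n \<in> {n. sum n UNIV = N}"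
      then show "n(j := Suc (n j)) \<in> {n. sum n UNIV = Suc N \<and> n j > 0}"
        by (simp only: mem_Collect_eq sum_fun_upd_Suc) simp
      show "(n(j := Suc (n j)))(j := (n(j := Suc (n j))) j - 1) = n" by simp
    qed
    finally show "(\<Sum>n\<in>{n. sum n UNIV = Suc N}. real (n j) * c n) =
      (\<Sum>n\<in>{n. sum n UNIV = N}. (fact N / (\<Prod>j\<in>UNIV. fact (n j))) * a (n(j := Suc (n j))))" .
  qed
  finally show ?thesis .
qed

context
  fixes A :: "'d \<Rightarrow> 'a \<Rightarrow> 'a" and V :: "'a set"
  assumes A_in: "\<And>j x. x \<in> V \<Longrightarrow> A j x \<in> V"
    and A_comm: "\<And>i j x. x \<in> V \<Longrightarrow> A i (A j x) = A j (A i x)"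
begin

lemma funpow_in: "x \<in> V \<Longrightarrow> (A j ^^ k) x \<in> V"
  by (induction k) (auto simp: A_in)

lemma funpow_comm: "x \<in> V \<Longrightarrow> (A i ^^ k) (A j x) = A j ((A i ^^ k) x)"
  by (induction k) (auto simp: A_comm funpow_in)

lemma foldr_pow_in: "x \<in> V \<Longrightarrow> foldr (\<lambda>j g. (A j ^^ n j) \<circ> g) js id x \<in> V"
  by (induction js) (auto simp: funpow_in)

lemma foldr_pow_comm:
  "x \<in> V \<Longrightarrow> foldr (\<lambda>j g. (A j ^^ n j) \<circ> g) js id (A i x) = A i (foldr (\<lambda>j g. (A j ^^ n j) \<circ> g) js id x)"
  by (induction js) (auto simp: funpow_comm foldr_pow_in)

lemma foldr_pow_upd_notin:
  "i \<notin> set js \<Longrightarrow> foldr (\<lambda>j g. (A j ^^ (n(i := k)) j) \<circ> g) js id = foldr (\<lambda>j g. (A j ^^ n j) \<circ> g) js id"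
  by (induction js) auto

lemma foldr_pow_upd:
  assumes x: "x \<in> V" and "distinct js" "i \<in> set js"
  shows "foldr (\<lambda>j g. (A j ^^ (n(i := Suc (n i))) j) \<circ> g) js id x =
    A i (foldr (\<lambda>j g. (A j ^^ n j) \<circ> g) js id x)"
  using assms(2,3)
proof (induction js)
  case (Cons a js)
  show ?case
  proof (cases "a = i")
    case True
    then have "i \<notin> set js" using Cons.prems by simp
    let ?F = "\<lambda>n. foldr (\<lambda>j g. (A j ^^ n j) \<circ> g) js id"
    have eq: "?F (n(i := Suc (n i))) = ?F n" by (rule foldr_pow_upd_notin) fact
    have "foldr (\<lambda>j g. (A j ^^ (n(i := Suc (n i))) j) \<circ> g) (a # js) id x =
        (A i ^^ Suc (n i)) (?F (n(i := Suc (n i))) x)" using True by simp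
    also have "\<dots> = A i ((A i ^^ n i) (?F n x))" unfolding eq by simp
    also have "\<dots> = A i (foldr (\<lambda>j g. (A j ^^ n j) \<circ> g) (a # js) id x)" using True by simp
    finally show ?thesis .
  next
    case False
    let ?F = "\<lambda>n. foldr (\<lambda>j g. (A j ^^ n j) \<circ> g) js id"
    have IH: "?F (n(i := Suc (n i))) x = A i (?F n x)"
      by (rule Cons.IH) (use Cons.prems False in auto)
    have "foldr (\<lambda>j g. (A j ^^ (n(i := Suc (n i))) j) \<circ> g) (a # js) id x =
        (A a ^^ n a) (?F (n(i := Suc (n i))) x)" using False by simp
    also have "\<dots> = A i ((A a ^^ n a) (?F n x))"
      unfolding IH by (rule funpow_comm[OF foldr_pow_in[OF x]])
    also have "\<dots> = A i (foldr (\<lambda>j g. (A j ^^ n j) \<circ> g) (a # js) id x)" by simp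
    finally show ?thesis .
  qed
qed simp

end

lemma mpow_zero: "mpow A (\<lambda>_. 0) x = x"
proof -
  have "foldr (\<lambda>j g. (A j ^^ 0) \<circ> g) js id = id" for js by (induction js) auto
  then show ?thesis by (simp add: mpow_def)
qed

lemma mpow_Suc:
  assumes "\<And>j x. x \<in> V \<Longrightarrow> A j x \<in> V" "\<And>i j x. x \<in> V \<Longrightarrow> A i (A j x) = A j (A i x)" "x \<in> V"
  shows "mpow A (n(i := Suc (n i))) x = mpow A n (A i x)"
  unfolding mpow_def
  by (subst foldr_pow_upd[where A=A and V=V], simp_all add: assms)
     (subst foldr_pow_comm[where A=A and V=V], simp_all add: assms)

lemma fock_partial_sums:
  fixes x :: "('d::finite list, 'y::complex_inner) ell2"
  shows "(\<lambda>N. \<Sum>w | length w < N. (norm (ell2_nth x w))\<^sup>2) \<longlonglongrightarrow> (norm x)\<^sup>2"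
proof -
  have "(sum (\<lambda>w. (norm (ell2_nth x w))\<^sup>2) \<longlongrightarrow> (norm x)\<^sup>2) (finite_subsets_at_top UNIV)"
    using has_sum_infsum[OF ell2_nth_summable[of x]] unfolding norm_ell2_sq has_sum_def .
  moreover have "filterlim (\<lambda>N. {w :: 'd list. length w < N}) (finite_subsets_at_top UNIV) sequentially"
    unfolding filterlim_finite_subsets_at_top
  proof (intro allI impI)
    fix F :: "'d list set" assume F: "finite F \<and> F \<subseteq> UNIV"
    have sub: "F \<subseteq> {w. length w < N}" if N: "N \<ge> Suc (Max (length ` F))" for N
    proof
      fix w assume "w \<in> F"
      then have "length w \<le> Max (length ` F)" using F by simp
      then show "w \<in> {w. length w < N}" using N by simp
    qed
    show "\<forall>\<^sub>F N in sequentially. finite {w :: 'd list. length w < N} \<and> F \<subseteq> {w. length w < N} \<and> {w. length w < N} \<subseteq> UNIV"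
      by (rule eventually_sequentiallyI[of "Suc (Max (length ` F))"]) (use finite_words[where 'd='d] sub in simp)
  qed
  ultimately show ?thesis by (rule filterlim_compose)
qed

section \<open>Transfer to spaces of functions\<close>

definition fock_of :: "(('d::finite \<Rightarrow> complex) \<Rightarrow> 'y::chilbert_space) \<Rightarrow> ('d list, 'y) ell2" where
  "fock_of = inv_into sym_fock fock_eval"

lemma fock_of_eval: "x \<in> sym_fock \<Longrightarrow> fock_of (fock_eval x) = x"
  unfolding fock_of_def by (rule inv_into_f_f) (auto simp: inj_on_def fock_eval_inj)

lemma is_pos_sqrt_transfer:
  assumes V: "csubspace V" and P: "bounded_clinear_op P" "\<And>x. x \<in> V \<Longrightarrow> P x \<in> V"
      "\<And>x y. cinner (P x) y = cinner x (P y)" "\<And>x. 0 \<le> Re (cinner (P x) x)"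
    and J: "\<And>x y. J (x + y) = J x + J y" "\<And>c x. J (c *\<^sub>C x) = sc c (J x)"
      "\<And>x y. x \<in> V \<Longrightarrow> y \<in> V \<Longrightarrow> ip (J x) (J y) = cinner x y"
    and Q: "\<And>x. x \<in> V \<Longrightarrow> Q (J x) = J (P x)" and A: "\<And>x. x \<in> V \<Longrightarrow> A (J x) = J (P (P x))"
  shows "is_pos_sqrt_on (J ` V) ip sc A Q"
  unfolding is_pos_sqrt_on_def ball_simps(9)
proof (intro conjI allI ballI)
  fix x y c assume x: "x \<in> V"
  show "Q (J x) \<in> J ` V" using P(2)[OF x] by (simp add: Q x)
  show "Q (sc c (J x)) = sc c (Q (J x))"
    by (simp add: J(2)[symmetric] Q x csubspaceD(3)[OF V] bclinD(2)[OF P(1)])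
  have "Im (cinner (P x) x) = 0"
    using arg_cong[OF cinner_commute[of "P x" x], of Im] P(3)[of x x] by simp
  then show "Im (ip (Q (J x)) (J x)) = 0" by (simp add: Q x J(3) P(2))
  show "0 \<le> Re (ip (Q (J x)) (J x))" by (simp add: Q x J(3) P(2,4))
  show "Q (Q (J x)) = A (J x)" by (simp add: Q x P(2) A)
  assume y: "y \<in> V"
  show "Q (J x + J y) = Q (J x) + Q (J y)"
    by (simp add: J(1)[symmetric] Q x y csubspaceD(2)[OF V] bclinD(1)[OF P(1)])
  show "ip (Q (J x)) (J y) = ip (J x) (Q (J y))" by (simp add: Q x y J(3) P(2,3))
qed

lemma approx_range_eq:
  assumes V: "closed V" and P: "\<And>x. x \<in> V \<Longrightarrow> P x \<in> V"
    and d: "\<And>x z. x \<in> V \<Longrightarrow> z \<in> V \<Longrightarrow> nu (J x - Q (J z)) = dist (P z) x"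
  shows "{f\<in>J ` V. \<forall>e>0. \<exists>g\<in>J ` V. nu (f - Q g) < (e::real)} = J ` closure (P ` V)"
proof -
  have key: "(\<forall>e>0. \<exists>g\<in>J ` V. nu (J x - Q g) < e) \<longleftrightarrow> x \<in> closure (P ` V)" if "x \<in> V" for x
    unfolding closure_approachable by (simp add: d that)
  have "closure (P ` V) \<subseteq> V" by (rule closure_minimal[OF _ V]) (use P in blast)
  then show ?thesis using key by blast
qed

context inner_pure
begin

definition tuple_of :: "('d \<Rightarrow> ('d \<Rightarrow> complex) \<Rightarrow> 'y) \<Rightarrow> (('d list, 'y) ell2, 'd) vec" where
  "tuple_of fs = (\<chi> j. fock_of (fs j))"

abbreviation "fmodel \<equiv> fock_eval ` model"

definition T_fun :: "'d \<Rightarrow> (('d \<Rightarrow> complex) \<Rightarrow> 'y) \<Rightarrow> ('d \<Rightarrow> complex) \<Rightarrow> 'y" where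
  "T_fun j f = fock_eval (T_op j (fock_of f))"

definition Ta_fun :: "'d \<Rightarrow> (('d \<Rightarrow> complex) \<Rightarrow> 'y) \<Rightarrow> ('d \<Rightarrow> complex) \<Rightarrow> 'y" where
  "Ta_fun j f = fock_eval (shift j (fock_of f))"

lemma fock_of_model: "x \<in> model \<Longrightarrow> fock_of (fock_eval x) = x"
  by (rule fock_of_eval[OF model_in_sym_fock])

lemma tuple_of_eval: "xs \<in> model_d \<Longrightarrow> tuple_of (tuple_eval xs) = xs"
  by (simp add: tuple_of_def tuple_eval_def fock_of_model vec_eq_iff)

lemma tupX_fmodel: "tupX fmodel = tuple_eval ` model_d"
proof (intro equalityI subsetI)
  fix fs :: "'d \<Rightarrow> ('d \<Rightarrow> complex) \<Rightarrow> 'y" assume "fs \<in> tupX fmodel"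
  then have fs: "\<And>j. fs j \<in> fmodel" by (simp add: tupX_def)
  have "tuple_of fs $ j \<in> model \<and> fock_eval (tuple_of fs $ j) = fs j" for j
    using fs[of j] by (auto simp: tuple_of_def fock_of_model)
  then have "tuple_of fs \<in> model_d" "fs = tuple_eval (tuple_of fs)" by (auto simp: tuple_eval_def)
  then show "fs \<in> tuple_eval ` model_d" by blast
qed (auto simp: tupX_def tuple_eval_def)

lemma hda_norm_model: "x \<in> model \<Longrightarrow> hda_norm (fock_eval x) = norm x"
  by (rule hda_norm_eval[OF model_in_sym_fock])

lemma hda_inner_model: "x \<in> model \<Longrightarrow> y \<in> model \<Longrightarrow> hda_inner (fock_eval x) (fock_eval y) = cinner x y"
  by (rule hda_inner_eval[OF model_in_sym_fock model_in_sym_fock])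

lemma tup_hda_inner_eval:
  "xs \<in> model_d \<Longrightarrow> ys \<in> model_d \<Longrightarrow> tup_hda_inner (tuple_eval xs) (tuple_eval ys) = cinner xs ys"
  by (simp add: tup_hda_inner_def tuple_eval_def hda_inner_model cinner_vec_def)

lemma tup_hda_norm_eval: "xs \<in> model_d \<Longrightarrow> tup_hda_norm (tuple_eval xs) = norm xs"
  by (simp add: tup_hda_norm_def tuple_eval_def hda_norm_model norm_vec_def L2_set_def)

lemma tuple_eval_add: "tuple_eval (xs + ys) = tuple_eval xs + tuple_eval ys"
  by (rule ext) (simp add: tuple_eval_def fock_eval_add)

lemma tuple_eval_diff: "tuple_eval (xs - ys) = tuple_eval xs - tuple_eval ys"
  by (rule ext) (simp add: tuple_eval_def fock_eval_diff)

lemma tuple_eval_scale: "tuple_eval (c *\<^sub>C xs) = (\<lambda>j. fscale c (tuple_eval xs j))"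
  by (rule ext) (simp add: tuple_eval_def fock_eval_scale)

lemma T_fun_eval: "x \<in> model \<Longrightarrow> T_fun j (fock_eval x) = fock_eval (T_op j x)"
  by (simp add: T_fun_def fock_of_model)

lemma Ta_fun_eval: "x \<in> model \<Longrightarrow> Ta_fun j (fock_eval x) = fock_eval (shift j x)"
  by (simp add: Ta_fun_def fock_of_model)

lemma sum_T_fun: "xs \<in> model_d \<Longrightarrow> (\<Sum>j\<in>UNIV. T_fun j (tuple_eval xs j)) = fock_eval (T_row xs)"
  by (simp add: tuple_eval_def T_fun_eval T_row_def fock_eval_sum)

lemma sum_Ta_fun: "x \<in> model \<Longrightarrow> (\<Sum>j\<in>UNIV. fscale (z j) (Ta_fun j (fock_eval x))) = fock_eval (shift_comb z x)"
  by (simp add: Ta_fun_eval shift_comb_def fock_eval_sum fock_eval_scale)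

lemma closed_subspace_fmodel: "closed_subspace_hda fmodel"
  unfolding closed_subspace_hda_def
proof (intro conjI ballI allI impI)
  show "fmodel \<subseteq> HDA" unfolding HDA_eq using model_in_sym_fock by blast
  show "0 \<in> fmodel" using model_sub(1) fock_eval_zero by (metis image_eqI)
  show "f + g \<in> fmodel" if "f \<in> fmodel" "g \<in> fmodel" for f g
    using that model_sub(2) by (auto simp: fock_eval_add[symmetric])
  show "fscale c f \<in> fmodel" if "f \<in> fmodel" for c f
    using that model_sub(3) by (auto simp: fock_eval_scale[symmetric])
next
  fix f assume f: "f \<in> HDA" and close: "\<forall>e>0. \<exists>g\<in>fmodel. hda_norm (f - g) < e"
  obtain x where x: "x \<in> sym_fock" "f = fock_eval x" using f unfolding HDA_eq by blast
  have "\<exists>m\<in>model. dist m x < e" if e: "e > 0" for e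
  proof -
    obtain m where m: "m \<in> model" "hda_norm (f - fock_eval m) < e" using close e by blast
    have "x - m \<in> sym_fock"
      using csubspace_diff[OF csubspace_sym_fock x(1) model_in_sym_fock[OF m(1)]] .
    then have "norm (x - m) < e" using m(2) by (simp add: x(2) fock_eval_diff[symmetric] hda_norm_eval)
    then show ?thesis using m(1) by (auto simp: dist_norm norm_minus_commute)
  qed
  then have "x \<in> closure model" by (simp add: closure_approachable)
  then have "x \<in> model" using closed_csubspaceD(2)[OF closed_csubspace_model] by simp
  then show "f \<in> fmodel" using x(2) by blast
qed

lemma T_op_commute: "T_op i (T_op j x) = T_op j (T_op i x)"
proof (rule cinner_extI)
  fix y
  let ?p = "proj model y"
  have p: "?p \<in> model" by (rule proj_works(1)[OF closed_csubspace_model])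
  have "cinner (T_op a (T_op b x)) y = cinner x (shift b (shift a ?p))" for a b
    by (simp add: cinner_T_op proj_id[OF closed_csubspace_model] shift_model p)
  then show "cinner (T_op i (T_op j x)) y = cinner (T_op j (T_op i x)) y"
    using shift_commute[OF model_in_sym_fock[OF p]] by simp
qed

lemma comm_row_contraction_T_fun: "comm_row_contraction fmodel T_fun"
  unfolding comm_row_contraction_def
proof (intro conjI allI ballI impI)
  fix j
  obtain K where K: "\<And>x. norm (T_op j x) \<le> K * norm x"
    using bclinD(3)[OF bclin_T_op] by blast
  show "lin_on_hda fmodel (T_fun j)"
    unfolding lin_on_hda_def op_on_def
  proof (intro conjI ballI allI exI[of _ K])
    show "T_fun j f \<in> fmodel" if "f \<in> fmodel" for f
      using that by (auto simp: T_fun_eval T_op_in)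
    show "T_fun j (f + g) = T_fun j f + T_fun j g" if "f \<in> fmodel" "g \<in> fmodel" for f g
      using that by (auto simp: fock_eval_add[symmetric] T_fun_eval model_sub bclinD(1)[OF bclin_T_op])
    show "T_fun j (fscale c f) = fscale c (T_fun j f)" if "f \<in> fmodel" for c f
      using that by (auto simp: fock_eval_scale[symmetric] T_fun_eval model_sub bclinD(2)[OF bclin_T_op])
    show "hda_norm (T_fun j f) \<le> K * hda_norm f" if "f \<in> fmodel" for f
      using that by (auto simp: T_fun_eval hda_norm_model T_op_in K)
  qed
next
  show "T_fun i (T_fun j f) = T_fun j (T_fun i f)" if "f \<in> fmodel" for i j f
    using that by (auto simp: T_fun_eval T_op_in T_op_commute[of i j])
next
  fix fs :: "'d \<Rightarrow> ('d \<Rightarrow> complex) \<Rightarrow> 'y" assume "\<forall>j. fs j \<in> fmodel"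
  then have "fs \<in> tupX fmodel" by (simp add: tupX_def)
  then obtain xs where xs: "xs \<in> model_d" "fs = tuple_eval xs" unfolding tupX_fmodel by blast
  have "(norm (T_row xs))\<^sup>2 \<le> (norm xs)\<^sup>2" by (intro power_mono norm_T_row_le) simp
  moreover have "(\<Sum>j\<in>UNIV. (hda_norm (tuple_eval xs j))\<^sup>2) = (norm xs)\<^sup>2"
    using xs(1) by (simp add: tuple_eval_def hda_norm_model norm_vec_sq)
  ultimately show "(hda_norm (\<Sum>j\<in>UNIV. T_fun j (fs j)))\<^sup>2 \<le> (\<Sum>j\<in>UNIV. (hda_norm (fs j))\<^sup>2)"
    unfolding xs(2) sum_T_fun[OF xs(1)] by (simp add: hda_norm_model T_row_in)
qed

lemma is_adjoint_T_fun: "is_adjoint_on fmodel (T_fun j) (Ta_fun j)"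
  unfolding is_adjoint_on_def op_on_def
  by (auto simp: Ta_fun_eval T_fun_eval shift_model T_op_in hda_inner_model cinner_T_op
      proj_id[OF closed_csubspace_model])

lemma stable_sum:
  "x \<in> model \<Longrightarrow> (\<Sum>n\<in>{n. sum n UNIV = N}. (fact N / (\<Prod>j\<in>UNIV. fact (n j)) :: real) *
      (hda_norm (mpow Ta_fun n (fock_eval x)))\<^sup>2) =
    (norm x)\<^sup>2 - (\<Sum>w | length w < N. (norm (ell2_nth x w))\<^sup>2)"
proof (induction N arbitrary: x)
  case 0
  have "{n :: 'd \<Rightarrow> nat. sum n UNIV = 0} = {\<lambda>_. 0}" by (auto simp: fun_eq_iff)
  then show ?case using 0 by (simp add: mpow_zero hda_norm_model)
next
  case (Suc N)
  have step: "mpow Ta_fun (n(j := Suc (n j))) (fock_eval x) = mpow Ta_fun n (fock_eval (shift j x))" for n j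
  proof -
    have "mpow Ta_fun (n(j := Suc (n j))) (fock_eval x) = mpow Ta_fun n (Ta_fun j (fock_eval x))"
    proof (rule mpow_Suc[where V=fmodel])
      show "Ta_fun j f \<in> fmodel" if "f \<in> fmodel" for j f
        using that by (auto simp: Ta_fun_eval shift_model)
      show "Ta_fun i (Ta_fun j f) = Ta_fun j (Ta_fun i f)" if "f \<in> fmodel" for i j f
        using that by (auto simp: Ta_fun_eval shift_model shift_commute[OF model_in_sym_fock, of _ i j])
    qed (use Suc.prems in auto)
    then show ?thesis by (simp add: Ta_fun_eval Suc.prems)
  qed
  have "(\<Sum>n\<in>{n. sum n UNIV = Suc N}. (fact (Suc N) / (\<Prod>j\<in>UNIV. fact (n j))) *
      (hda_norm (mpow Ta_fun n (fock_eval x)))\<^sup>2) =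
    (\<Sum>j\<in>UNIV. (norm (shift j x))\<^sup>2 - (\<Sum>w | length w < N. (norm (ell2_nth (shift j x) w))\<^sup>2))"
    by (simp only: multinomial_sum_Suc step Suc.IH[OF shift_model[OF Suc.prems]])
  also have "\<dots> = (norm x)\<^sup>2 - (\<Sum>w | length w < Suc N. (norm (ell2_nth x w))\<^sup>2)"
    unfolding sum_list_split using fock_norm_split[of x] by (simp add: sum_subtractf vacuum_def)
  finally show ?case .
qed

lemma star_strongly_stable_Ta_fun: "star_strongly_stable fmodel Ta_fun"
  unfolding star_strongly_stable_def
proof
  fix f assume "f \<in> fmodel"
  then obtain x where x: "x \<in> model" "f = fock_eval x" by blast
  have "(\<lambda>N. (norm x)\<^sup>2 - (\<Sum>w | length w < N. (norm (ell2_nth x w))\<^sup>2)) \<longlonglongrightarrow> (norm x)\<^sup>2 - (norm x)\<^sup>2"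
    by (intro tendsto_diff tendsto_const fock_partial_sums)
  then show "(\<lambda>N. \<Sum>n\<in>{n. sum n UNIV = N}. (fact N / (\<Prod>j\<in>UNIV. fact (n j)) :: real) * (hda_norm (mpow Ta_fun n f))\<^sup>2)
       \<longlonglongrightarrow> 0"
    unfolding x(2) stable_sum[OF x(1)] by simp
qed

definition DT_fun :: "('d \<Rightarrow> ('d \<Rightarrow> complex) \<Rightarrow> 'y) \<Rightarrow> 'd \<Rightarrow> ('d \<Rightarrow> complex) \<Rightarrow> 'y" where
  "DT_fun fs = tuple_eval (D_T (tuple_of fs))"

definition DTs_fun :: "(('d \<Rightarrow> complex) \<Rightarrow> 'y) \<Rightarrow> ('d \<Rightarrow> complex) \<Rightarrow> 'y" where
  "DTs_fun f = fock_eval (D_Ts (fock_of f))"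

definition res_fun :: "('d \<Rightarrow> complex) \<Rightarrow> (('d \<Rightarrow> complex) \<Rightarrow> 'y) \<Rightarrow> ('d \<Rightarrow> complex) \<Rightarrow> 'y" where
  "res_fun z f = fock_eval (res z (fock_of f))"

lemma DT_fun_eval: "xs \<in> model_d \<Longrightarrow> DT_fun (tuple_eval xs) = tuple_eval (D_T xs)"
  by (simp only: DT_fun_def tuple_of_eval)

lemma DTs_fun_eval: "x \<in> model \<Longrightarrow> DTs_fun (fock_eval x) = fock_eval (D_Ts x)"
  by (simp add: DTs_fun_def fock_of_model)

lemma res_fun_eval: "x \<in> model \<Longrightarrow> res_fun z (fock_eval x) = fock_eval (res z x)"
  by (simp add: res_fun_def fock_of_model)

lemmas model_d_sub = csubspaceD[OF csubspace_model_d]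

lemma is_pos_sqrt_DT_fun:
  "is_pos_sqrt_on (tupX fmodel) tup_hda_inner (\<lambda>c xs. (\<lambda>j. fscale c (xs j)))
    (\<lambda>xs. xs - (\<lambda>j. Ta_fun j (\<Sum>k\<in>UNIV. T_fun k (xs k)))) DT_fun"
  unfolding tupX_fmodel
proof (rule is_pos_sqrt_transfer[where P=D_T])
  fix xs assume xs: "xs \<in> model_d"
  have "(\<lambda>j. Ta_fun j (\<Sum>k\<in>UNIV. T_fun k (tuple_eval xs k))) = tuple_eval (T_col (T_row xs))"
    unfolding sum_T_fun[OF xs] Ta_fun_eval[OF T_row_in] by (simp add: tuple_eval_def T_col_model T_row_in)
  then show "tuple_eval xs - (\<lambda>j. Ta_fun j (\<Sum>k\<in>UNIV. T_fun k (tuple_eval xs k))) = tuple_eval (D_T (D_T xs))"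
    unfolding D_T_square tuple_eval_diff by simp
qed (fact csubspace_model_d bclin_D_T D_T_in D_T_selfadjoint D_T_nonneg
    tuple_eval_add tuple_eval_scale tup_hda_inner_eval DT_fun_eval)+

lemma is_pos_sqrt_DTs_fun:
  "is_pos_sqrt_on fmodel hda_inner fscale (\<lambda>x. x - (\<Sum>j\<in>UNIV. T_fun j (Ta_fun j x))) DTs_fun"
proof (rule is_pos_sqrt_transfer[where P=D_Ts])
  fix x assume x: "x \<in> model"
  have "(\<Sum>j\<in>UNIV. T_fun j (Ta_fun j (fock_eval x))) = fock_eval (T_row (T_col x))"
    by (simp add: Ta_fun_eval x T_fun_eval shift_model T_row_def fock_eval_sum T_col_model)
  then show "fock_eval x - (\<Sum>j\<in>UNIV. T_fun j (Ta_fun j (fock_eval x))) = fock_eval (D_Ts (D_Ts x))"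
    unfolding D_Ts_square fock_eval_diff by simp
qed (fact csubspace_model bclin_D_Ts D_Ts_in D_Ts_selfadjoint D_Ts_nonneg
    fock_eval_add fock_eval_scale hda_inner_model DTs_fun_eval)+

lemma resolvent_fun:
  assumes z: "z \<in> Ball_d" and f: "f \<in> fmodel"
  shows "res_fun z f \<in> fmodel"
    "res_fun z (f - (\<Sum>j\<in>UNIV. fscale (z j) (Ta_fun j f))) = f"
    "res_fun z f - (\<Sum>j\<in>UNIV. fscale (z j) (Ta_fun j (res_fun z f))) = f"
proof -
  obtain x where x: "x \<in> model" "f = fock_eval x" using f by blast
  have d: "x - shift_comb z x \<in> model"
    by (rule csubspace_diff[OF csubspace_model x(1) shift_comb_model[OF x(1)]])
  show "res_fun z f \<in> fmodel"
    unfolding x(2) res_fun_eval[OF x(1)] by (rule imageI[OF res(1)[OF z x(1)]])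
  show "res_fun z (f - (\<Sum>j\<in>UNIV. fscale (z j) (Ta_fun j f))) = f"
    unfolding x(2) sum_Ta_fun[OF x(1)] fock_eval_diff[symmetric] res_fun_eval[OF d]
      res_eqI[OF z x(1) refl] ..
  show "res_fun z f - (\<Sum>j\<in>UNIV. fscale (z j) (Ta_fun j (res_fun z f))) = f"
    unfolding x(2) res_fun_eval[OF x(1)] sum_Ta_fun[OF res(1)[OF z x(1)]] fock_eval_diff[symmetric]
      res(2)[OF z x(1)] ..
qed

lemma closure_D_T_sub: "closure (D_T ` model_d) \<subseteq> model_d"
  by (rule closure_minimal[OF _ closed_csubspaceD(2)[OF closed_csubspace_model_d]]) (use D_T_in in blast)

lemma closure_D_Ts_sub: "closure (D_Ts ` model) \<subseteq> model"
  by (rule closure_minimal[OF _ closed_csubspaceD(2)[OF closed_csubspace_model]]) (use D_Ts_in in blast)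

lemma defect_space_eq:
  "{xs\<in>tupX fmodel. \<forall>e>0. \<exists>zs\<in>tupX fmodel. tup_hda_norm (xs - DT_fun zs) < e} =
    tuple_eval ` closure (D_T ` model_d)"
  unfolding tupX_fmodel
proof (rule approx_range_eq[OF closed_csubspaceD(2)[OF closed_csubspace_model_d] D_T_in])
  fix xs zs assume xs: "xs \<in> model_d" and zs: "zs \<in> model_d"
  show "tup_hda_norm (tuple_eval xs - DT_fun (tuple_eval zs)) = dist (D_T zs) xs"
    unfolding DT_fun_eval[OF zs] tuple_eval_diff[symmetric]
      tup_hda_norm_eval[OF csubspace_diff[OF csubspace_model_d xs D_T_in[OF zs]]]
    by (simp add: dist_norm norm_minus_commute)
qed

lemma defect_space_star_eq:
  "{x\<in>fmodel. \<forall>e>0. \<exists>z\<in>fmodel. hda_norm (x - DTs_fun z) < e} = fock_eval ` closure (D_Ts ` model)"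
proof (rule approx_range_eq[OF closed_csubspaceD(2)[OF closed_csubspace_model] D_Ts_in])
  fix x z assume x: "x \<in> model" and z: "z \<in> model"
  show "hda_norm (fock_eval x - DTs_fun (fock_eval z)) = dist (D_Ts z) x"
    unfolding DTs_fun_eval[OF z] fock_eval_diff[symmetric]
      hda_norm_model[OF csubspace_diff[OF csubspace_model x D_Ts_in[OF z]]]
    by (simp add: dist_norm norm_minus_commute)
qed

lemma char_fun_eval:
  assumes z: "z \<in> Ball_d" and xs: "xs \<in> model_d"
  shows "- (\<Sum>j\<in>UNIV. T_fun j (tuple_eval xs j)) +
      DTs_fun (res_fun z (\<Sum>j\<in>UNIV. fscale (z j) (DT_fun (tuple_eval xs) j))) = fock_eval (char_fun z xs)"
proof -
  have s: "(\<Sum>j\<in>UNIV. fscale (z j) (DT_fun (tuple_eval xs) j)) = fock_eval (\<Sum>j\<in>UNIV. z j *\<^sub>C (D_T xs $ j))"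
    unfolding DT_fun_eval[OF xs] by (simp add: tuple_eval_def fock_eval_sum fock_eval_scale)
  note m = comb_in_model[OF D_T_in[OF xs], of z]
  have neg: "fock_eval (- x) = - fock_eval x" for x :: "('d list, 'y) ell2"
    using fock_eval_diff[of 0 x] by (simp add: fock_eval_zero)
  show ?thesis
    unfolding s sum_T_fun[OF xs] res_fun_eval[OF m] DTs_fun_eval[OF res(1)[OF z m]] char_fun_def
      fock_eval_add neg ..
qed

lemma char_coincide_S:
  assumes dim: "same_hdim (tup_inner S) (Dperp S) cinner (US0 S)"
  shows "char_coincide S"
proof -
  define E where "E = closure (D_T ` model_d)"
  define Es where "Es = closure (D_Ts ` model)"
  obtain \<alpha> \<beta> where ua: "unitary_on Es UNIV \<alpha>" and ub: "unitary_on E UNIV \<beta>"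
    and main: "\<And>z xs. z \<in> Ball_d \<Longrightarrow> xs \<in> E \<Longrightarrow> char_fun z xs \<in> Es \<and> S z (\<beta> xs) = \<alpha> (char_fun z xs)"
    using char_fun_coincides[OF dim] unfolding E_def Es_def by blast
  note \<alpha> = unitary_onD[OF ua] and \<beta> = unitary_onD[OF ub]
  have Esub: "xs \<in> model_d" if "xs \<in> E" for xs using that closure_D_T_sub unfolding E_def by (rule subsetD[rotated])
  have Essub: "x \<in> model" if "x \<in> Es" for x using that closure_D_Ts_sub unfolding Es_def by (rule subsetD[rotated])
  define \<alpha>' where "\<alpha>' f = \<alpha> (fock_of f)" for f
  define \<beta>' where "\<beta>' fs = \<beta> (tuple_of fs)" for fs
  have \<alpha>': "\<alpha>' (fock_eval x) = \<alpha> x" if "x \<in> model" for x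
    by (simp add: \<alpha>'_def fock_of_model that)
  have \<beta>': "\<beta>' (tuple_eval xs) = \<beta> xs" if "xs \<in> model_d" for xs
    unfolding \<beta>'_def tuple_of_eval[OF that] ..
  show ?thesis
    unfolding char_coincide_def
  proof (rule exI[of _ fmodel], rule exI[of _ T_fun], rule exI[of _ Ta_fun], rule exI[of _ DT_fun],
      rule exI[of _ DTs_fun], rule exI[of _ res_fun], rule exI[of _ \<alpha>'], rule exI[of _ \<beta>'],
      intro conjI allI ballI)
    show "closed_subspace_hda fmodel" by (rule closed_subspace_fmodel)
    show "comm_row_contraction fmodel T_fun" by (rule comm_row_contraction_T_fun)
    show "is_adjoint_on fmodel (T_fun j) (Ta_fun j)" for j by (rule is_adjoint_T_fun)
    show "star_strongly_stable fmodel Ta_fun" by (rule star_strongly_stable_Ta_fun)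
    show "is_pos_sqrt_on (tupX fmodel) tup_hda_inner (\<lambda>c xs. (\<lambda>j. fscale c (xs j)))
        (\<lambda>xs. xs - (\<lambda>j. Ta_fun j (\<Sum>k\<in>UNIV. T_fun k (xs k)))) DT_fun" by (rule is_pos_sqrt_DT_fun)
    show "is_pos_sqrt_on fmodel hda_inner fscale (\<lambda>x. x - (\<Sum>j\<in>UNIV. T_fun j (Ta_fun j x))) DTs_fun"
      by (rule is_pos_sqrt_DTs_fun)
    show "res_fun l x \<in> fmodel" "res_fun l (x - (\<Sum>j\<in>UNIV. fscale (l j) (Ta_fun j x))) = x"
      "res_fun l x - (\<Sum>j\<in>UNIV. fscale (l j) (Ta_fun j (res_fun l x))) = x"
      if "l \<in> Ball_d" "x \<in> fmodel" for l x using resolvent_fun[OF that] by blast+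
    show "let calDT = {xs\<in>tupX fmodel. \<forall>e>0. \<exists>zs\<in>tupX fmodel. tup_hda_norm (xs - DT_fun zs) < e};
           calDTs = {x\<in>fmodel. \<forall>e>0. \<exists>z\<in>fmodel. hda_norm (x - DTs_fun z) < e};
           \<theta> = (\<lambda>l xs. - (\<Sum>j\<in>UNIV. T_fun j (xs j)) + DTs_fun (res_fun l (\<Sum>j\<in>UNIV. fscale (l j) (DT_fun xs j))))
       in (\<forall>x\<in>calDTs. \<forall>y\<in>calDTs. \<alpha>' (x + y) = \<alpha>' x + \<alpha>' y) \<and>
          (\<forall>c. \<forall>x\<in>calDTs. \<alpha>' (fscale c x) = c *\<^sub>C \<alpha>' x) \<and>
          (\<forall>x\<in>calDTs. \<forall>y\<in>calDTs. cinner (\<alpha>' x) (\<alpha>' y) = hda_inner x y) \<and>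
          \<alpha>' ` calDTs = UNIV \<and>
          (\<forall>x\<in>calDT. \<forall>y\<in>calDT. \<beta>' (x + y) = \<beta>' x + \<beta>' y) \<and>
          (\<forall>c. \<forall>x\<in>calDT. \<beta>' (\<lambda>j. fscale c (x j)) = c *\<^sub>C \<beta>' x) \<and>
          (\<forall>x\<in>calDT. \<forall>y\<in>calDT. cinner (\<beta>' x) (\<beta>' y) = tup_hda_inner x y) \<and>
          \<beta>' ` calDT = UNIV \<and>
          (\<forall>l\<in>Ball_d. \<forall>xs\<in>calDT. S l (\<beta>' xs) = \<alpha>' (\<theta> l xs))"
      unfolding Let_def defect_space_eq defect_space_star_eq E_def[symmetric] Es_def[symmetric] ball_simps(9)
    proof (intro conjI allI ballI)
      fix x y c assume xE: "x \<in> Es"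
      note x = Essub[OF xE]
      show "\<alpha>' (fscale c (fock_eval x)) = c *\<^sub>C \<alpha>' (fock_eval x)"
        unfolding fock_eval_scale[symmetric] \<alpha>'[OF x] \<alpha>'[OF model_sub(3)[OF x]] by (rule \<alpha>(2)[OF xE])
      assume yE: "y \<in> Es"
      note y = Essub[OF yE]
      show "\<alpha>' (fock_eval x + fock_eval y) = \<alpha>' (fock_eval x) + \<alpha>' (fock_eval y)"
        unfolding fock_eval_add[symmetric] \<alpha>'[OF x] \<alpha>'[OF y] \<alpha>'[OF model_sub(2)[OF x y]] by (rule \<alpha>(1)[OF xE yE])
      show "cinner (\<alpha>' (fock_eval x)) (\<alpha>' (fock_eval y)) = hda_inner (fock_eval x) (fock_eval y)"
        unfolding \<alpha>'[OF x] \<alpha>'[OF y] hda_inner_model[OF x y] by (rule \<alpha>(3)[OF xE yE])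
    next
      have "\<alpha>' ` fock_eval ` Es = \<alpha> ` Es" unfolding image_image by (rule image_cong[OF refl \<alpha>'[OF Essub]])
      then show "\<alpha>' ` fock_eval ` Es = UNIV" using \<alpha>(4) by simp
    next
      fix x y c assume xE: "x \<in> E"
      note x = Esub[OF xE]
      show "\<beta>' (\<lambda>j. fscale c (tuple_eval x j)) = c *\<^sub>C \<beta>' (tuple_eval x)"
        unfolding tuple_eval_scale[symmetric] \<beta>'[OF x] \<beta>'[OF model_d_sub(3)[OF x]] by (rule \<beta>(2)[OF xE])
      assume yE: "y \<in> E"
      note y = Esub[OF yE]
      show "\<beta>' (tuple_eval x + tuple_eval y) = \<beta>' (tuple_eval x) + \<beta>' (tuple_eval y)"
        unfolding tuple_eval_add[symmetric] \<beta>'[OF x] \<beta>'[OF y] \<beta>'[OF model_d_sub(2)[OF x y]] by (rule \<beta>(1)[OF xE yE])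
      show "cinner (\<beta>' (tuple_eval x)) (\<beta>' (tuple_eval y)) = tup_hda_inner (tuple_eval x) (tuple_eval y)"
        unfolding \<beta>'[OF x] \<beta>'[OF y] tup_hda_inner_eval[OF x y] by (rule \<beta>(3)[OF xE yE])
    next
      have "\<beta>' ` tuple_eval ` E = \<beta> ` E" unfolding image_image by (rule image_cong[OF refl \<beta>'[OF Esub]])
      then show "\<beta>' ` tuple_eval ` E = UNIV" using \<beta>(4) by simp
    next
      fix l :: "'d \<Rightarrow> complex" and xs assume l: "l \<in> Ball_d" and xsE: "xs \<in> E"
      note xs = Esub[OF xsE]
      have cf: "char_fun l xs \<in> Es" "S l (\<beta> xs) = \<alpha> (char_fun l xs)" using main[OF l xsE] by blast+
      show "S l (\<beta>' (tuple_eval xs)) = \<alpha>' (- (\<Sum>j\<in>UNIV. T_fun j (tuple_eval xs j)) +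
          DTs_fun (res_fun l (\<Sum>j\<in>UNIV. fscale (l j) (DT_fun (tuple_eval xs) j))))"
        unfolding char_fun_eval[OF l xs] \<beta>'[OF xs] \<alpha>'[OF Essub[OF cf(1)]] by (rule cf(2))
    qed
  qed
qed

end

theorem theorem5p2:
  fixes S :: "('d::{finite,linorder} \<Rightarrow> complex) \<Rightarrow> 'u::chilbert_space \<Rightarrow> 'y::chilbert_space"
  assumes "schur_class S"
    and "inner_schur S"
    and "pure_schur S"
    and "same_hdim (tup_inner S) (Dperp S) cinner (US0 S)"
  shows "char_coincide S"
  using inner_pure.char_coincide_S[OF inner_pure.intro[OF assms(1-3)] assms(4)] .

end
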